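(* Let $\rho:\Gamma\to GL_4(\mathbb{C})$ be a $T$-determined, $T$-unitarizable representation, $\upsilon$ a multiplier system with cusp parameter $m$, and let $\lambda_1,\dots,\lambda_4$, $k_0$, $F_0$ and $\rho_0$ be as in the context. Then: (i) $\mathcal{H}(\rho_0,\upsilon)=\bigoplus_{k\ge0}\mathcal{H}(k_0+2k,\rho_0,\upsilon)$, and $\mathcal{H}(k_0,\rho_0,\upsilon)$ contains the vector $F_0$, whose components form a fundamental system of solutions of an MLDE in weight $k_0$; (ii) $\mathcal{H}(\rho_0,\upsilon)$ is a free $\mathcal{M}$-module of rank 4 with basis $\{F_0,DF_0,D^2F_0,D^3F_0\}$; (iii) $\mathcal{H}(\rho_0,\upsilon)=\mathcal{R}F_0$ is a cyclic $\mathcal{R}$-module; (iv) for each integer $k\ge0$, $\dim\mathcal{H}(k_0+2k,\rho_0,\upsilon)=\left[\frac{2k}{3}\right]+1$.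
   Context: $\Gamma=SL(2,\mathbb{Z})$ acts on the upper half-plane $\mathbb{H}$ by Möbius transformations; $T=\begin{pmatrix}1&1\\0&1\end{pmatrix}$; $q=e^{2\pi iz}$, $\mathbf{e}(r)=e^{2\pi ir}$; $[x]$ is the greatest integer $\le x$. Complex powers use the principal branch of $\log$. For $k\in\mathbb{R}$, a multiplier system of weight $k$ is a map $\upsilon:\Gamma\to\{|w|=1\}$ such that $\nu(\gamma,z)=\upsilon(\gamma)(cz+d)^k$ satisfies $\nu(\gamma\sigma,z)=\nu(\gamma,\sigma z)\nu(\sigma,z)$; it is also one of weight $k+n$, $n\in\mathbb{Z}$. Cusp parameter: the $m\in[0,12)$ with $\upsilon(T)=\mathbf{e}(m/12)$. Slash: $(f|_k^\upsilon\gamma)(z)=\upsilon(\gamma)^{-1}(cz+d)^{-k}f(\gamma z)$. Moderate growth: $|f(x+iy)|\le y^N$ for $y>c$. $\mathcal{H}(k,\rho,\upsilon)$: column vectors $F$ of holomorphic moderate-growth functions on $\mathbb{H}$ with $F|_k^\upsilon\gamma=\rho(\gamma)F$ for all $\gamma$; $\mathcal{H}(\rho,\upsilon)=\bigoplus_{n\in\mathbb{Z}}\mathcal{H}(k+n,\rho,\upsilon)$. $\mathcal{M}=\mathbb{C}[E_4,E_6]$ is the graded ring of holomorphic integral-weight modular forms for $\Gamma$ with trivial multiplier, acting by multiplication. $T$-unitarizable: $\rho(T)$ conjugate to a unitary matrix. An irreducible $\rho$ of dimension $d$ is $T$-determined if every indecomposable $\rho':\Gamma\to GL_d(\mathbb{C})$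 with $\rho'(T)$ having the same eigenvalues as $\rho(T)$ is irreducible. $\eta=q^{1/24}\prod_{n\ge1}(1-q^n)$, $P=\frac{i}{\pi}\frac{\eta'}{\eta}$, $D_kf=\frac{1}{2\pi i}\frac{df}{dz}+kPf$; $D$ acts on $\mathcal{H}(k,\rho,\upsilon)$ componentwise as $D_k$, $D^n=D_{k+2(n-1)}\circ\cdots\circ D_k$. An MLDE of order $n$ in weight $k$ is $D_k^nf+M_4D_k^{n-2}f+\cdots+M_{2n}f=0$, $M_{2j}\in\mathcal{M}_{2j}$; rewriting it as $q^n\frac{d^nf}{dq^n}+\sum_{j<n}q^jg_j(q)\frac{d^jf}{dq^j}=0$ with $g_j$ holomorphic at $q=0$, its indicial roots are the roots of $r(r-1)\cdots(r-n+1)+\sum_{j<n}g_j(0)r(r-1)\cdots(r-j+1)$. A fundamental system is a basis of the solution space. $\mathcal{R}=\mathcal{M}[d]$ with $dM=Md+DM$ acts by $d\cdot F=DF$; $\mathcal{R}F_0$ = all finite sums $\sum M_jD^jF_0$. Setting: write the (distinct) eigenvalues of $\rho(T)$ as $\mathbf{e}(r_1),\dots,\mathbf{e}(r_4)$ with $0\le r_1<r_2<r_3<r_4<1$; let $\lambda_j\in[0,1)$ with $\lambda_j\equiv r_j+\frac{m}{12}\pmod{\mathbb{Z}}$, $\lambda_0=\sum_j\lambda_j$, $k_0=3\lambda_0-3$. Let $L[f]=0$ be the unique fourth order MLDE (in weight $k_0$) whose indicial roots are $\lambda_1,\dots,\lambda_4$; it has a fundamental system $f_j=q^{\lambda_j}+\sum_{n\ge1}a_j(n)q^{\lambda_j+n}$,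 $j=1,\dots,4$. Put $F_0=(f_1,\dots,f_4)^t$, and let $\rho_0:\Gamma\to GL_4(\mathbb{C})$ be the representation with $F_0|_{k_0}^\upsilon\gamma=\rho_0(\gamma)F_0$ for all $\gamma\in\Gamma$ (here $\upsilon$ is a multiplier system of weight $k_0$). *)

theory Defs
  imports "HOL-Analysis.Analysis" "HOL-Library.Function_Algebras"
begin

definition SL2Z :: "(int^2^2) set" where
  "SL2Z = {g. det g = 1}"

definition Tmat :: "int^2^2" where
  "Tmat = vector [vector [1, 1], vector [0, 1]]"

definition uhp :: "complex set" where
  "uhp = {z. Im z > 0}"

definition ent_a :: "int^2^2 \<Rightarrow> complex" where "ent_a g = of_int (g$1$1)"
definition ent_b :: "int^2^2 \<Rightarrow> complex" where "ent_b g = of_int (g$1$2)"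
definition ent_c :: "int^2^2 \<Rightarrow> complex" where "ent_c g = of_int (g$2$1)"
definition ent_d :: "int^2^2 \<Rightarrow> complex" where "ent_d g = of_int (g$2$2)"

definition moeb :: "int^2^2 \<Rightarrow> complex \<Rightarrow> complex" where
  "moeb g z = (ent_a g * z + ent_b g) / (ent_c g * z + ent_d g)"

definition ee :: "complex \<Rightarrow> complex" where
  "ee r = exp (2 * pi * \<i> * r)"

definition autf :: "real \<Rightarrow> int^2^2 \<Rightarrow> complex \<Rightarrow> complex" where
  "autf k g z = (ent_c g * z + ent_d g) powr (of_real k)"

definition nu :: "real \<Rightarrow> (int^2^2 \<Rightarrow> complex) \<Rightarrow> int^2^2 \<Rightarrow> complex \<Rightarrow> complex" where
  "nu k ups g z = ups g * autf k g z"

definition multiplier_system :: "real \<Rightarrow> (int^2^2 \<Rightarrow> complex) \<Rightarrow> bool" where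
  "multiplier_system k ups \<longleftrightarrow>
     (\<forall>g\<in>SL2Z. norm (ups g) = 1) \<and>
     (\<forall>g\<in>SL2Z. \<forall>s\<in>SL2Z. \<forall>z\<in>uhp.
        nu k ups (g ** s) z = nu k ups g (moeb s z) * nu k ups s z)"

definition cusp_parameter :: "(int^2^2 \<Rightarrow> complex) \<Rightarrow> real \<Rightarrow> bool" where
  "cusp_parameter ups m \<longleftrightarrow> 0 \<le> m \<and> m < 12 \<and> ups Tmat = ee (of_real (m / 12))"

text \<open>Functions on the upper half-plane are encoded as functions on C that vanish
  off the upper half-plane.\<close>

definition slash :: "real \<Rightarrow> (int^2^2 \<Rightarrow> complex) \<Rightarrow> (complex \<Rightarrow> complex^'n)
                     \<Rightarrow> int^2^2 \<Rightarrow> complex \<Rightarrow> complex^'n" where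
  "slash k ups F g z = (inverse (ups g) * inverse (autf k g z)) *s F (moeb g z)"

definition moderate_growth :: "(complex \<Rightarrow> 'a::real_normed_vector) \<Rightarrow> bool" where
  "moderate_growth F \<longleftrightarrow>
     (\<exists>N c. \<forall>x y. y > c \<longrightarrow> norm (F (Complex x y)) \<le> y powr N)"

definition Hk :: "real \<Rightarrow> (int^2^2 \<Rightarrow> complex^'n^'n) \<Rightarrow> (int^2^2 \<Rightarrow> complex)
                  \<Rightarrow> (complex \<Rightarrow> complex^'n) set" where
  "Hk k rho ups = {F.
     (\<forall>z. z \<notin> uhp \<longrightarrow> F z = 0) \<and>
     (\<forall>i. (\<lambda>z. F z $ i) holomorphic_on uhp) \<and>
     moderate_growth F \<and>
     (\<forall>g\<in>SL2Z. \<forall>z\<in>uhp. slash k ups F g z = rho g *v F z)}"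

definition Hsum :: "real \<Rightarrow> (int^2^2 \<Rightarrow> complex^'n^'n) \<Rightarrow> (int^2^2 \<Rightarrow> complex)
                  \<Rightarrow> (complex \<Rightarrow> complex^'n) set" where
  "Hsum k rho ups = {F. \<exists>S G. finite S \<and> (\<forall>n\<in>S. G n \<in> Hk (k + real_of_int n) rho ups)
                        \<and> F = (\<lambda>z. \<Sum>n\<in>S. G n z)}"

definition Mk :: "int \<Rightarrow> (complex \<Rightarrow> complex) set" where
  "Mk w = {f.
     (\<forall>z. z \<notin> uhp \<longrightarrow> f z = 0) \<and>
     f holomorphic_on uhp \<and>
     moderate_growth f \<and>
     (\<forall>g\<in>SL2Z. \<forall>z\<in>uhp. f (moeb g z) = (ent_c g * z + ent_d g) powi w * f z)}"

definition Mring :: "(complex \<Rightarrow> complex) set" where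
  "Mring = {f. \<exists>S G. finite S \<and> (\<forall>w\<in>S. G w \<in> Mk w) \<and> f = (\<lambda>z. \<Sum>w\<in>S. G w z)}"

definition eta :: "complex \<Rightarrow> complex" where
  "eta z = ee (z / 24) * prodinf (\<lambda>n. 1 - ee z ^ Suc n)"

definition Pfun :: "complex \<Rightarrow> complex" where
  "Pfun z = (\<i> / of_real pi) * deriv eta z / eta z"

definition Dsc :: "real \<Rightarrow> (complex \<Rightarrow> complex) \<Rightarrow> complex \<Rightarrow> complex" where
  "Dsc k f z = (if z \<in> uhp then deriv f z / (2 * of_real pi * \<i>) + of_real k * Pfun z * f z else 0)"

fun Dscpow :: "nat \<Rightarrow> real \<Rightarrow> (complex \<Rightarrow> complex) \<Rightarrow> complex \<Rightarrow> complex" where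
  "Dscpow 0 k f = f"
| "Dscpow (Suc n) k f = Dsc (k + 2 * real n) (Dscpow n k f)"

definition Dvec :: "real \<Rightarrow> (complex \<Rightarrow> complex^'n) \<Rightarrow> complex \<Rightarrow> complex^'n" where
  "Dvec k F z = (\<chi> i. Dsc k (\<lambda>w. F w $ i) z)"

fun Dpow :: "nat \<Rightarrow> real \<Rightarrow> (complex \<Rightarrow> complex^'n) \<Rightarrow> complex \<Rightarrow> complex^'n" where
  "Dpow 0 k F = F"
| "Dpow (Suc n) k F = Dvec (k + 2 * real n) (Dpow n k F)"

definition mlde4 :: "real \<Rightarrow> (complex \<Rightarrow> complex) \<Rightarrow> (complex \<Rightarrow> complex) \<Rightarrow> (complex \<Rightarrow> complex)
                    \<Rightarrow> (complex \<Rightarrow> complex) \<Rightarrow> complex \<Rightarrow> complex" where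
  "mlde4 k M4 M6 M8 f z =
     Dscpow 4 k f z + M4 z * Dscpow 2 k f z + M6 z * Dscpow 1 k f z + M8 z * f z"

definition mlde4_solutions :: "real \<Rightarrow> (complex \<Rightarrow> complex) \<Rightarrow> (complex \<Rightarrow> complex)
                    \<Rightarrow> (complex \<Rightarrow> complex) \<Rightarrow> (complex \<Rightarrow> complex) set" where
  "mlde4_solutions k M4 M6 M8 = {f.
     (\<forall>z. z \<notin> uhp \<longrightarrow> f z = 0) \<and> f holomorphic_on uhp \<and>
     (\<forall>z\<in>uhp. mlde4 k M4 M6 M8 f z = 0)}"

definition fundamental_system4 :: "real \<Rightarrow> (complex \<Rightarrow> complex) \<Rightarrow> (complex \<Rightarrow> complex)
       \<Rightarrow> (complex \<Rightarrow> complex) \<Rightarrow> (4 \<Rightarrow> complex \<Rightarrow> complex) \<Rightarrow> bool" where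
  "fundamental_system4 k M4 M6 M8 fs \<longleftrightarrow>
     (\<forall>j. fs j \<in> mlde4_solutions k M4 M6 M8) \<and>
     (\<forall>c::4 \<Rightarrow> complex. (\<lambda>z. \<Sum>j\<in>UNIV. c j * fs j z) = (\<lambda>z. 0) \<longrightarrow> (\<forall>j. c j = 0)) \<and>
     (\<forall>f\<in>mlde4_solutions k M4 M6 M8. \<exists>c::4 \<Rightarrow> complex. f = (\<lambda>z. \<Sum>j\<in>UNIV. c j * fs j z))"

definition representation :: "(int^2^2 \<Rightarrow> complex^'n^'n) \<Rightarrow> bool" where
  "representation rho \<longleftrightarrow>
     (\<forall>g\<in>SL2Z. invertible (rho g)) \<and>
     (\<forall>g\<in>SL2Z. \<forall>s\<in>SL2Z. rho (g ** s) = rho g ** rho s)"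

definition csubspace :: "(complex^'n) set \<Rightarrow> bool" where
  "csubspace V \<longleftrightarrow> 0 \<in> V \<and> (\<forall>x\<in>V. \<forall>y\<in>V. x + y \<in> V) \<and> (\<forall>c. \<forall>x\<in>V. c *s x \<in> V)"

definition invariant_subspace :: "(int^2^2 \<Rightarrow> complex^'n^'n) \<Rightarrow> (complex^'n) set \<Rightarrow> bool" where
  "invariant_subspace rho V \<longleftrightarrow> csubspace V \<and> (\<forall>g\<in>SL2Z. \<forall>v\<in>V. rho g *v v \<in> V)"

definition irreducible_rep :: "(int^2^2 \<Rightarrow> complex^'n^'n) \<Rightarrow> bool" where
  "irreducible_rep rho \<longleftrightarrow> representation rho \<and>
     (\<forall>V. invariant_subspace rho V \<longrightarrow> V = {0} \<or> V = UNIV)"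

definition indecomposable_rep :: "(int^2^2 \<Rightarrow> complex^'n^'n) \<Rightarrow> bool" where
  "indecomposable_rep rho \<longleftrightarrow> representation rho \<and>
     \<not> (\<exists>V W. invariant_subspace rho V \<and> invariant_subspace rho W \<and>
              V \<noteq> {0} \<and> W \<noteq> {0} \<and> V \<inter> W = {0} \<and> {v + w | v w. v \<in> V \<and> w \<in> W} = UNIV)"

definition eigenvalues :: "complex^'n^'n \<Rightarrow> complex set" where
  "eigenvalues A = {l. \<exists>v. v \<noteq> 0 \<and> A *v v = l *s v}"

definition T_determined :: "(int^2^2 \<Rightarrow> complex^'n^'n) \<Rightarrow> bool" where
  "T_determined rho \<longleftrightarrow> irreducible_rep rho \<and>
     (\<forall>rho' :: int^2^2 \<Rightarrow> complex^'n^'n.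
        indecomposable_rep rho' \<and> eigenvalues (rho' Tmat) = eigenvalues (rho Tmat)
        \<longrightarrow> irreducible_rep rho')"

definition adjoint_mat :: "complex^'n^'n \<Rightarrow> complex^'n^'n" where
  "adjoint_mat U = (\<chi> i j. cnj (U $ j $ i))"

definition unitary_mat :: "complex^'n^'n \<Rightarrow> bool" where
  "unitary_mat U \<longleftrightarrow> U ** adjoint_mat U = mat 1"

definition T_unitarizable :: "(int^2^2 \<Rightarrow> complex^'n^'n) \<Rightarrow> bool" where
  "T_unitarizable rho \<longleftrightarrow>
     (\<exists>Q U :: complex^'n^'n. invertible Q \<and> unitary_mat U \<and> rho Tmat = Q ** U ** matrix_inv Q)"

definition cdim :: "(complex \<Rightarrow> complex^'n) set \<Rightarrow> nat" where
  "cdim S = vector_space.dim (\<lambda>(c::complex) (F::complex \<Rightarrow> complex^'n). (\<lambda>z. c *s F z)) S"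

end

theory Submission
  imports Defs "HOL-Complex_Analysis.Conformal_Mappings" "HOL-Real_Asymp.Real_Asymp"
begin

text \<open>
  Let \<open>W\<close> be the Wronskian of the \<open>f\<^sub>j\<close>. Since the MLDE has no third order term, Abel's formula says that
  \<open>W\<close> solves the same first order equation as \<open>\<eta>\<close> to the power \<open>24 \<lambda>\<^sub>0\<close>; hence \<open>W\<close> has no zeros, its
  leading coefficient at the cusp being a Vandermonde determinant in the distinct \<open>\<lambda>\<^sub>j\<close>. The
  hypothesis on \<open>\<rho>\<^sub>0\<close> makes \<open>W\<close> transform by \<open>det \<rho>\<^sub>0(\<gamma>)\<close> times an automorphy factor, so taking logarithmic
  derivatives yields the quasimodularity of \<open>P\<close>, and with it \<open>E\<^sub>4\<close>, \<open>E\<^sub>6\<close>, \<open>\<Delta>\<close> and the dimensions of the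
  spaces \<open>\<M>\<^sub>k\<close>. By Cramer's rule every \<open>F\<close> in \<open>\<H>(\<rho>\<^sub>0, \<upsilon>)\<close> is a combination of
  \<open>F\<^sub>0, D F\<^sub>0, D\<^sup>2 F\<^sub>0, D\<^sup>3 F\<^sub>0\<close> with coefficients invariant under the modular group and holomorphic, also at
  the cusp because the exponents of \<open>F\<close> there are at least \<open>\<lambda>\<^sub>j\<close>.
\<close>

section \<open>The modular group\<close>

text \<open>The weight \<open>k0\<close> makes two descriptions of the Wronskian agree: the diagonal
  of the companion matrix adds up to
  \<open>-(k0 + (k0+2) + (k0+4) + (k0+6)) P = -(4 k0 + 12) P\<close>, and
  \<open>4 k0 + 12 = 12 \<lambda>\<^sub>0\<close>, while P is minus twice the logarithmic derivative
  of eta. The obstacle is a circularity: the iterates of D transform well only once P is known to be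
  quasimodular, and this is to be drawn from the Wronskian. So the Wronskian is formed a second time
  with the plain derivation \<open>qder\<close>; the change of basis is unitriangular and the
  determinants coincide. The plain version gives the transformation law and the leading coefficient,
  the version with D gives the differential equation. The bound on the exponents has this reason:
  the expansions of the solutions force \<open>rho0 Tmat\<close> to be diagonal, and moderate growth
  together with \<open>\<lambda>\<^sub>j < 1\<close> excludes negative powers of q. Scalar forms are
  controlled by the maximum principle in weight 0, by multiplication with \<open>Delta\<close> in
  negative weight, and by a linear differential equation in weight 2.\<close>

lemma open_uhp: "open uhp"
  unfolding uhp_def using open_halfspace_Im_gt by simp

lemma convex_uhp: "convex uhp"
  unfolding uhp_def using convex_halfspace_Im_gt by simp

lemma connected_uhp: "connected uhp"
  using convex_uhp by (rule convex_connected)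

lemma i_in_uhp: "\<i> \<in> uhp"
  by (simp add: uhp_def)

definition jfac :: "int^2^2 \<Rightarrow> complex \<Rightarrow> complex" where
  "jfac g z = ent_c g * z + ent_d g"

lemma SL2Z_det: "g \<in> SL2Z \<Longrightarrow> ent_a g * ent_d g - ent_b g * ent_c g = 1"
proof -
  assume "g \<in> SL2Z"
  then have "g$1$1 * g$2$2 - g$1$2 * g$2$1 = 1" by (simp add: SL2Z_def det_2)
  then have "of_int (g$1$1 * g$2$2 - g$1$2 * g$2$1) = (1::complex)" by simp
  then show ?thesis by (simp add: ent_a_def ent_b_def ent_c_def ent_d_def)
qed

lemma jfac_nonzero: "g \<in> SL2Z \<Longrightarrow> z \<in> uhp \<Longrightarrow> jfac g z \<noteq> 0"
proof
  assume g: "g \<in> SL2Z" and z: "z \<in> uhp" and 0: "jfac g z = 0"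
  have "Im (jfac g z) = of_int (g$2$1) * Im z"
    by (simp add: jfac_def ent_c_def ent_d_def)
  with 0 z have c: "g$2$1 = 0" by (auto simp: uhp_def)
  with 0 have "g$2$2 = 0" by (simp add: jfac_def ent_c_def ent_d_def)
  with c SL2Z_det[OF g] show False by (simp add: ent_c_def ent_d_def)
qed

lemma Im_moeb:
  assumes "g \<in> SL2Z" "z \<in> uhp"
  shows "Im (moeb g z) = Im z / (cmod (jfac g z))\<^sup>2"
proof -
  have J: "jfac g z \<noteq> 0" using jfac_nonzero assms .
  have det: "real_of_int (g$1$1) * of_int (g$2$2) - of_int (g$1$2) * of_int (g$2$1) = 1"
  proof -
    have "g$1$1 * g$2$2 - g$1$2 * g$2$1 = 1" using assms(1) by (simp add: SL2Z_def det_2)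
    then have "real_of_int (g$1$1 * g$2$2 - g$1$2 * g$2$1) = 1" by simp
    then show ?thesis by simp
  qed
  have "moeb g z = (ent_a g * z + ent_b g) * cnj (jfac g z) / (jfac g z * cnj (jfac g z))"
    unfolding moeb_def jfac_def[symmetric] using J by (subst mult_divide_mult_cancel_right) simp_all
  also have "jfac g z * cnj (jfac g z) = of_real ((cmod (jfac g z))\<^sup>2)"
    by (rule complex_norm_square[symmetric])
  finally have "Im (moeb g z) = Im ((ent_a g * z + ent_b g) * cnj (jfac g z)) / (cmod (jfac g z))\<^sup>2"
    by (simp add: Im_divide_of_real)
  also have "Im ((ent_a g * z + ent_b g) * cnj (jfac g z)) =
     (real_of_int (g$1$1) * of_int (g$2$2) - of_int (g$1$2) * of_int (g$2$1)) * Im z"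
    by (simp add: jfac_def ent_a_def ent_b_def ent_c_def ent_d_def algebra_simps)
  finally show ?thesis using det by simp
qed

lemma moeb_in_uhp: "g \<in> SL2Z \<Longrightarrow> z \<in> uhp \<Longrightarrow> moeb g z \<in> uhp"
  using Im_moeb[of g z] jfac_nonzero[of g z] by (simp add: uhp_def)

lemma moeb_has_field_derivative:
  assumes "g \<in> SL2Z" "z \<in> uhp"
  shows "(moeb g has_field_derivative inverse ((jfac g z)\<^sup>2)) (at z)"
proof -
  have J: "ent_c g * z + ent_d g \<noteq> 0" using jfac_nonzero[OF assms] by (simp add: jfac_def)
  have "((\<lambda>z. (ent_a g * z + ent_b g) / (ent_c g * z + ent_d g)) has_field_derivative
      (ent_a g * (ent_c g * z + ent_d g) - (ent_a g * z + ent_b g) * ent_c g) /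
      ((ent_c g * z + ent_d g) * (ent_c g * z + ent_d g))) (at z)"
    using J by (auto intro!: derivative_eq_intros)
  also have "ent_a g * (ent_c g * z + ent_d g) - (ent_a g * z + ent_b g) * ent_c g = 1"
    using SL2Z_det[OF assms(1)] by (simp add: algebra_simps)
  finally show ?thesis
    unfolding moeb_def[abs_def] jfac_def by (simp add: power2_eq_square inverse_eq_divide)
qed

lemma moeb_holomorphic: "g \<in> SL2Z \<Longrightarrow> moeb g holomorphic_on uhp"
  using moeb_has_field_derivative holomorphic_on_open[OF open_uhp] by blast

lemma jfac_holomorphic [holomorphic_intros]: "jfac g holomorphic_on A"
  unfolding jfac_def[abs_def] by (intro holomorphic_intros)

lemma jfac_has_field_derivative: "(jfac g has_field_derivative ent_c g) (at z)"
  unfolding jfac_def[abs_def] by (auto intro!: derivative_eq_intros)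

definition Smat :: "int^2^2" where
  "Smat = vector [vector [0, -1], vector [1, 0]]"

lemma ent_Tmat: "ent_a Tmat = 1" "ent_b Tmat = 1" "ent_c Tmat = 0" "ent_d Tmat = 1"
  by (simp_all add: ent_a_def ent_b_def ent_c_def ent_d_def Tmat_def)

lemma ent_Smat: "ent_a Smat = 0" "ent_b Smat = -1" "ent_c Smat = 1" "ent_d Smat = 0"
  by (simp_all add: ent_a_def ent_b_def ent_c_def ent_d_def Smat_def)

lemma Tmat_SL2Z: "Tmat \<in> SL2Z" and Smat_SL2Z: "Smat \<in> SL2Z"
  by (simp_all add: SL2Z_def det_2 Tmat_def Smat_def)

lemma moeb_Tmat: "moeb Tmat z = z + 1" and jfac_Tmat: "jfac Tmat z = 1"
  by (simp_all add: moeb_def jfac_def ent_Tmat)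

lemma moeb_Smat: "moeb Smat z = - (1 / z)" and jfac_Smat: "jfac Smat z = z"
  by (simp_all add: moeb_def jfac_def ent_Smat)

lemma ee_eq: "ee r = exp (2 * of_real pi * \<i> * r)"
  by (simp add: ee_def)

lemma ee_add: "ee (a + b) = ee a * ee b"
  by (simp add: ee_eq exp_add[symmetric] algebra_simps)

lemma ee_diff: "ee (a - b) = ee a / ee b"
  by (simp add: ee_eq exp_diff[symmetric] algebra_simps)

lemma ee_minus: "ee (- a) = inverse (ee a)"
  by (simp add: ee_eq exp_minus[symmetric])

lemma ee_0 [simp]: "ee 0 = 1" by (simp add: ee_eq)

lemma ee_1 [simp]: "ee 1 = 1"
  using exp_two_pi_i by (simp add: ee_eq)

lemma ee_nonzero [simp]: "ee z \<noteq> 0" by (simp add: ee_eq)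

lemma ee_of_nat_mult: "ee (of_nat n * z) = ee z ^ n"
  by (simp add: ee_eq exp_of_nat_mult[symmetric] algebra_simps)

lemma norm_ee: "norm (ee z) = exp (- (2 * pi * Im z))"
  by (simp add: ee_eq norm_exp_eq_Re)

lemma ee_in_ball: "z \<in> uhp \<Longrightarrow> ee z \<in> ball 0 1"
  by (simp add: norm_ee uhp_def)

lemma ee_has_field_derivative [derivative_intros]:
  assumes "(f has_field_derivative f') (at z within A)"
  shows "((\<lambda>z. ee (f z)) has_field_derivative (2 * of_real pi * \<i> * f' * ee (f z))) (at z within A)"
  unfolding ee_eq by (rule derivative_eq_intros assms refl)+ (simp add: algebra_simps)

lemma ee_holomorphic [holomorphic_intros]:
  "f holomorphic_on A \<Longrightarrow> (\<lambda>z. ee (f z)) holomorphic_on A"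
  unfolding ee_eq by (intro holomorphic_intros)

lemma ee_Ln: "q \<noteq> 0 \<Longrightarrow> ee (Ln q / (2 * of_real pi * \<i>)) = q"
  by (simp add: ee_eq)

lemma ee_onto_punctured_disc:
  assumes "q \<noteq> 0" "norm q < 1"
  obtains z where "z \<in> uhp" "ee z = q"
proof
  show "ee (Ln q / (2 * of_real pi * \<i>)) = q" using assms by (intro ee_Ln)
  have "ln (norm q) < 0" using assms by simp
  then show "Ln q / (2 * of_real pi * \<i>) \<in> uhp"
    using assms by (simp add: uhp_def Im_divide power2_eq_square divide_neg_pos field_simps zero_less_mult_iff)
qed

lemma ee_eq_iff: "ee w = ee z \<longleftrightarrow> (\<exists>n::int. w = z + of_int n)"
proof -
  have "ee w = ee z \<longleftrightarrow> (\<exists>n::int. 2 * of_real pi * \<i> * w = 2 * of_real pi * \<i> * z + (of_int (2 * n) * pi) * \<i>)"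
    unfolding ee_eq exp_eq ..
  also have "\<dots> \<longleftrightarrow> (\<exists>n::int. w = z + of_int n)"
  proof (intro iff_exI)
    fix n :: int
    have "2 * of_real pi * \<i> * z + (of_int (2 * n) * pi) * \<i> = (2 * of_real pi * \<i>) * (z + of_int n)"
      by (simp add: distrib_left)
    then have "2 * of_real pi * \<i> * w = 2 * of_real pi * \<i> * z + (of_int (2 * n) * pi) * \<i>
      \<longleftrightarrow> (2 * of_real pi * \<i>) * w = (2 * of_real pi * \<i>) * (z + of_int n)"
      by (simp only:)
    also have "\<dots> \<longleftrightarrow> w = z + of_int n" by (subst mult_cancel_left) simp
    finally show "2 * of_real pi * \<i> * w = 2 * of_real pi * \<i> * z + (of_int (2 * n) * pi) * \<i> \<longleftrightarrow> w = z + of_int n" .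
  qed
  finally show ?thesis .
qed

section \<open>The derivation \<open>q d/dq\<close>\<close>

definition qder :: "(complex \<Rightarrow> complex) \<Rightarrow> complex \<Rightarrow> complex" where
  "qder f z = deriv f z / (2 * of_real pi * \<i>)"

lemma qder_eqI:
  "(f has_field_derivative 2 * of_real pi * \<i> * d) (at z) \<Longrightarrow> qder f z = d"
  by (simp add: qder_def DERIV_imp_deriv)

lemma has_field_derivative_qder:
  assumes "f holomorphic_on uhp" "z \<in> uhp"
  shows "(f has_field_derivative 2 * of_real pi * \<i> * qder f z) (at z)"
  using holomorphic_derivI[OF assms(1) open_uhp assms(2)] by (simp add: qder_def)

lemma qder_holomorphic [holomorphic_intros]: "f holomorphic_on uhp \<Longrightarrow> qder f holomorphic_on uhp"
  unfolding qder_def[abs_def] by (intro holomorphic_intros open_uhp) auto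

lemma has_field_derivative_cong_uhp:
  assumes "\<And>z. z \<in> uhp \<Longrightarrow> f z = g z" "z \<in> uhp"
  shows "(f has_field_derivative d) (at z) \<longleftrightarrow> (g has_field_derivative d) (at z)"
proof -
  have "eventually (\<lambda>z. z \<in> uhp) (nhds z)" using open_uhp assms(2) by (rule eventually_nhds_in_open)
  then have "eventually (\<lambda>z. f z = g z) (nhds z)" by eventually_elim (use assms in auto)
  then show ?thesis by (intro DERIV_cong_ev refl)
qed

lemma qder_cong:
  assumes "\<And>z. z \<in> uhp \<Longrightarrow> f z = g z" "z \<in> uhp"
  shows "qder f z = qder g z"
proof -
  have "eventually (\<lambda>z. z \<in> uhp) (nhds z)" using open_uhp assms(2) by (rule eventually_nhds_in_open)
  then have "eventually (\<lambda>z. f z = g z) (nhds z)" by eventually_elim (use assms in auto)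
  then show ?thesis unfolding qder_def by (simp add: deriv_cong_ev)
qed

lemma qder_diff:
  assumes "f holomorphic_on uhp" "g holomorphic_on uhp" "z \<in> uhp"
  shows "qder (\<lambda>z. f z - g z) z = qder f z - qder g z"
  by (rule qder_eqI) (auto intro!: derivative_eq_intros has_field_derivative_qder assms simp: algebra_simps)

lemma qder_mult:
  assumes "f holomorphic_on uhp" "g holomorphic_on uhp" "z \<in> uhp"
  shows "qder (\<lambda>z. f z * g z) z = qder f z * g z + f z * qder g z"
  by (rule qder_eqI) (auto intro!: derivative_eq_intros has_field_derivative_qder assms simp: algebra_simps)

lemma qder_power:
  assumes "f holomorphic_on uhp" "z \<in> uhp"
  shows "qder (\<lambda>z. f z ^ n) z = of_nat n * f z ^ (n - 1) * qder f z"
  by (rule qder_eqI) (auto intro!: derivative_eq_intros has_field_derivative_qder assms simp: algebra_simps)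

lemma qder_cmult:
  assumes "f holomorphic_on uhp" "z \<in> uhp"
  shows "qder (\<lambda>z. c * f z) z = c * qder f z"
  by (rule qder_eqI) (auto intro!: derivative_eq_intros has_field_derivative_qder assms simp: algebra_simps)

lemma qder_const: "qder (\<lambda>z. c) z = 0"
  by (simp add: qder_def)

lemma qder_sum:
  assumes "\<And>i. i \<in> I \<Longrightarrow> f i holomorphic_on uhp" "z \<in> uhp"
  shows "qder (\<lambda>z. \<Sum>i\<in>I. f i z) z = (\<Sum>i\<in>I. qder (f i) z)"
  by (rule qder_eqI) (auto intro!: derivative_eq_intros has_field_derivative_qder assms
      simp: sum_distrib_left)

lemma qder_0_imp_constant:
  assumes f: "f holomorphic_on uhp" and 0: "\<And>z. z \<in> uhp \<Longrightarrow> qder f z = 0"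
  shows "\<exists>c. \<forall>z\<in>uhp. f z = c"
proof -
  have "(f has_field_derivative 0) (at z)" if "z \<in> uhp" for z
    using has_field_derivative_qder[OF f that] 0[OF that] by simp
  then have "\<And>z. z \<in> uhp \<Longrightarrow> (f has_field_derivative 0) (at z within uhp)"
    using has_field_derivative_at_within by blast
  then show ?thesis using has_field_derivative_zero_constant[OF convex_uhp] by metis
qed

lemma linear_ode_solution:
  assumes f: "f holomorphic_on uhp" and h: "h holomorphic_on uhp"
    and ode: "\<And>z. z \<in> uhp \<Longrightarrow> qder f z = h z * f z"
  obtains c e where "\<And>z. z \<in> uhp \<Longrightarrow> f z = c * exp (e z)"
proof -
  obtain e where e: "\<And>z. z \<in> uhp \<Longrightarrow> (e has_field_derivative h z) (at z within uhp)"
    using holomorphic_convex_primitive'[OF convex_uhp open_uhp h] by blast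
  define E where "E z = 2 * of_real pi * \<i> * e z" for z
  have E': "(E has_field_derivative 2 * of_real pi * \<i> * h z) (at z)" if "z \<in> uhp" for z
    unfolding E_def using e[OF that] at_within_open[OF that open_uhp]
    by (auto intro!: derivative_eq_intros)
  have "((\<lambda>z. f z * exp (- E z)) has_field_derivative 0) (at z within uhp)" if "z \<in> uhp" for z
    by (rule has_field_derivative_at_within)
      (use ode[OF that] in \<open>auto intro!: derivative_eq_intros has_field_derivative_qder[OF f that] E'[OF that] simp: algebra_simps\<close>)
  from has_field_derivative_zero_constant[OF convex_uhp this]
  obtain c where c: "\<And>z. z \<in> uhp \<Longrightarrow> f z * exp (- E z) = c"
    by blast
  then have "f z = c * exp (E z)" if "z \<in> uhp" for z
    using c[OF that] by (simp add: exp_minus divide_simps)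
  then show ?thesis by (rule that)
qed

text \<open>A constant times an exponential vanishes everywhere or nowhere. Each use turns one known
  zero into identical vanishing: for the Wronskian, for the inversion law of \<open>Delta\<close>,
  and for forms of weight 2.\<close>

lemma linear_ode_zero:
  assumes "f holomorphic_on uhp" "h holomorphic_on uhp"
    and "\<And>z. z \<in> uhp \<Longrightarrow> qder f z = h z * f z"
    and "w \<in> uhp" "f w = 0" "z \<in> uhp"
  shows "f z = 0"
  by (rule linear_ode_solution[OF assms(1-3)]) (use assms(4-6) in auto)

section \<open>Expansions in \<open>q\<close>\<close>

text \<open>The factor \<open>q^l\<close> is written as \<open>ee (l * z)\<close>, which is
  single-valued on the half-plane for real \<open>l\<close>. Since \<open>\<phi> 0\<close> may be
  zero, \<open>l\<close> is only a lower bound for the order at the cusp. Values of \<open>f\<close>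
  off \<open>uhp\<close> are left free.\<close>

definition qser :: "real \<Rightarrow> (complex \<Rightarrow> complex) \<Rightarrow> (complex \<Rightarrow> complex) \<Rightarrow> bool" where
  "qser l \<phi> f \<longleftrightarrow> \<phi> holomorphic_on ball 0 1 \<and> (\<forall>z\<in>uhp. f z = ee (of_real l * z) * \<phi> (ee z))"

lemma qserD: "qser l \<phi> f \<Longrightarrow> z \<in> uhp \<Longrightarrow> f z = ee (of_real l * z) * \<phi> (ee z)"
  by (simp add: qser_def)

lemma qser_cong: "qser l \<phi> f \<Longrightarrow> (\<And>z. z \<in> uhp \<Longrightarrow> f z = g z) \<Longrightarrow> qser l \<phi> g"
  by (simp add: qser_def)

lemma qser_holomorphic: "qser l \<phi> f \<Longrightarrow> f holomorphic_on uhp"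
proof -
  assume f: "qser l \<phi> f"
  then have "\<phi> \<circ> ee holomorphic_on uhp"
    unfolding qser_def using ee_in_ball by (intro holomorphic_on_compose_gen[of _ _ _ "ball 0 1"] holomorphic_intros) auto
  then have "(\<lambda>z. ee (of_real l * z) * (\<phi> \<circ> ee) z) holomorphic_on uhp"
    by (intro holomorphic_intros)
  then show ?thesis by (rule holomorphic_transform) (use f in \<open>simp add: qser_def\<close>)
qed

lemma qser_const: "qser 0 (\<lambda>q. c) (\<lambda>z. c)"
  by (simp add: qser_def)

lemma qser_zero: "qser l (\<lambda>q. 0) (\<lambda>z. 0)"
  by (simp add: qser_def)

lemma qser_add: "qser l \<phi> f \<Longrightarrow> qser l \<psi> g \<Longrightarrow> qser l (\<lambda>q. \<phi> q + \<psi> q) (\<lambda>z. f z + g z)"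
  by (auto simp: qser_def algebra_simps intro!: holomorphic_intros)

lemma qser_diff: "qser l \<phi> f \<Longrightarrow> qser l \<psi> g \<Longrightarrow> qser l (\<lambda>q. \<phi> q - \<psi> q) (\<lambda>z. f z - g z)"
  by (auto simp: qser_def algebra_simps intro!: holomorphic_intros)

lemma qser_mult: "qser k \<phi> f \<Longrightarrow> qser l \<psi> g \<Longrightarrow> qser (k + l) (\<lambda>q. \<phi> q * \<psi> q) (\<lambda>z. f z * g z)"
  by (auto simp: qser_def algebra_simps ee_add intro!: holomorphic_intros)

lemma qser_mult0: "qser 0 \<phi> f \<Longrightarrow> qser l \<psi> g \<Longrightarrow> qser l (\<lambda>q. \<phi> q * \<psi> q) (\<lambda>z. f z * g z)"
  using qser_mult[of 0 \<phi> f l] by simp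

lemma qser_cmult: "qser l \<phi> f \<Longrightarrow> qser l (\<lambda>q. c * \<phi> q) (\<lambda>z. c * f z)"
  using qser_mult0[OF qser_const] .

lemma qser_divide:
  assumes "qser k \<phi> f" "qser l \<psi> g" "\<And>q. q \<in> ball 0 1 \<Longrightarrow> \<psi> q \<noteq> 0"
  shows "qser (k - l) (\<lambda>q. \<phi> q / \<psi> q) (\<lambda>z. f z / g z)"
  using assms by (auto simp: qser_def left_diff_distrib ee_diff intro!: holomorphic_intros)

lemma qser_power: "qser l \<phi> f \<Longrightarrow> qser (of_nat n * l) (\<lambda>q. \<phi> q ^ n) (\<lambda>z. f z ^ n)"
proof (induction n)
  case 0
  then show ?case using qser_const[of 1] by simp
next
  case (Suc n)
  then show ?case using qser_mult[OF Suc(2) Suc(1)[OF Suc(2)]] by (simp add: algebra_simps)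
qed

lemma qser_sum:
  "(\<And>i. i \<in> I \<Longrightarrow> qser l (\<phi> i) (f i)) \<Longrightarrow> qser l (\<lambda>q. \<Sum>i\<in>I. \<phi> i q) (\<lambda>z. \<Sum>i\<in>I. f i z)"
  by (induction I rule: infinite_finite_induct) (auto simp: qser_zero intro!: qser_add)

lemma qser_prod:
  "finite I \<Longrightarrow> (\<And>i. i \<in> I \<Longrightarrow> qser (l i) (\<phi> i) (f i)) \<Longrightarrow>
    qser (\<Sum>i\<in>I. l i) (\<lambda>q. \<Prod>i\<in>I. \<phi> i q) (\<lambda>z. \<Prod>i\<in>I. f i z)"
  by (induction I rule: finite_induct) (auto simp: qser_const intro!: qser_mult)

text \<open>The exponent stays and the constant term is multiplied by \<open>l\<close>; iterating
  this produces the powers of \<open>l\<close> that fill the Vandermonde matrix.\<close>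

lemma qser_qder:
  assumes f: "qser l \<phi> f"
  shows "qser l (\<lambda>q. of_real l * \<phi> q + q * deriv \<phi> q) (qder f)"
  unfolding qser_def
proof
  show "(\<lambda>q. of_real l * \<phi> q + q * deriv \<phi> q) holomorphic_on ball 0 1"
    using f by (auto simp: qser_def intro!: holomorphic_intros)
  show "\<forall>z\<in>uhp. qder f z = ee (of_real l * z) * (of_real l * \<phi> (ee z) + ee z * deriv \<phi> (ee z))"
  proof
    fix z assume z: "z \<in> uhp"
    have \<phi>: "(\<phi> has_field_derivative deriv \<phi> (ee z)) (at (ee z))"
      using f ee_in_ball[OF z] unfolding qser_def by (intro holomorphic_derivI[of _ "ball 0 1"]) auto
    have "((\<lambda>z. \<phi> (ee z)) has_field_derivative deriv \<phi> (ee z) * (2 * of_real pi * \<i> * 1 * ee z)) (at z)"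
      by (rule DERIV_chain2[where f = \<phi> and g = ee, OF \<phi>]) (rule ee_has_field_derivative[OF DERIV_ident])
    then have "((\<lambda>z. ee (of_real l * z) * \<phi> (ee z)) has_field_derivative
        2 * of_real pi * \<i> * (ee (of_real l * z) * (of_real l * \<phi> (ee z) + ee z * deriv \<phi> (ee z)))) (at z)"
      by (auto intro!: derivative_eq_intros simp: algebra_simps)
    then have "(f has_field_derivative
        2 * of_real pi * \<i> * (ee (of_real l * z) * (of_real l * \<phi> (ee z) + ee z * deriv \<phi> (ee z)))) (at z)"
      using has_field_derivative_cong_uhp[OF qserD[OF f] z] by simp
    then show "qder f z = ee (of_real l * z) * (of_real l * \<phi> (ee z) + ee z * deriv \<phi> (ee z))"
      by (rule qder_eqI)
  qed
qed

lemma qser_shift: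
  assumes f: "qser l \<phi> f" and 0: "\<phi> 0 = 0"
  obtains \<psi> where "qser (l + 1) \<psi> f"
proof -
  have "\<phi> holomorphic_on ball 0 1" using f by (simp add: qser_def)
  then obtain \<psi> where \<psi>: "\<psi> holomorphic_on ball 0 1" "\<And>z. norm z < 1 \<Longrightarrow> \<phi> z = z * \<psi> z"
    using Schwarz3 0 by blast
  have "qser (l + 1) \<psi> f"
    using f ee_in_ball by (auto simp: qser_def \<psi> ring_distribs ee_add)
  then show ?thesis by (rule that)
qed

lemma qser_tendsto:
  assumes f: "qser 0 \<phi> f" and e: "e > 0"
  obtains Y where "\<And>z. z \<in> uhp \<Longrightarrow> Im z > Y \<Longrightarrow> norm (f z - \<phi> 0) < e"
proof -
  have "isCont \<phi> 0"
    using f by (intro continuous_on_interior[of "ball 0 1"]) (auto simp: qser_def holomorphic_on_imp_continuous_on)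
  then obtain d where d: "d > 0" "\<And>q. norm q < d \<Longrightarrow> norm (\<phi> q - \<phi> 0) < e"
    using e unfolding continuous_at_eps_delta by (auto simp: dist_norm)
  show ?thesis
  proof (rule that)
    fix z assume z: "z \<in> uhp" "Im z > - ln d / (2 * pi)"
    then have "- (2 * pi * Im z) < ln d" by (simp add: field_simps)
    then have "exp (- (2 * pi * Im z)) < exp (ln d)" by (simp only: exp_less_mono)
    then have "norm (ee z) < d" using d(1) by (simp add: norm_ee)
    then show "norm (f z - \<phi> 0) < e" using d(2) qserD[OF f z(1)] by simp
  qed
qed

text \<open>For exponent 0 the constant term is the limit of \<open>f\<close> as Im z tends to
  infinity. Comparing constant terms in this way is the only uniqueness of expansions that the proof
  uses.\<close>

lemma qser_value_unique:
  assumes "qser 0 \<phi> f" "qser 0 \<psi> f"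
  shows "\<phi> 0 = \<psi> 0"
proof (rule ccontr)
  assume "\<phi> 0 \<noteq> \<psi> 0"
  then have e: "norm (\<phi> 0 - \<psi> 0) / 2 > 0" by simp
  obtain Y where Y: "\<And>z. z \<in> uhp \<Longrightarrow> Im z > Y \<Longrightarrow> norm (f z - \<phi> 0) < norm (\<phi> 0 - \<psi> 0) / 2"
    using qser_tendsto[OF assms(1) e] by metis
  obtain X where X: "\<And>z. z \<in> uhp \<Longrightarrow> Im z > X \<Longrightarrow> norm (f z - \<psi> 0) < norm (\<phi> 0 - \<psi> 0) / 2"
    using qser_tendsto[OF assms(2) e] by metis
  define z where "z = Complex 0 (max 0 (max X Y) + 1)"
  have "z \<in> uhp" "Im z > Y" "Im z > X" by (auto simp: z_def uhp_def)
  with X Y have "norm (f z - \<phi> 0) < norm (\<phi> 0 - \<psi> 0) / 2" "norm (f z - \<psi> 0) < norm (\<phi> 0 - \<psi> 0) / 2"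
    by auto
  then show False using norm_triangle_ineq4[of "f z - \<psi> 0" "f z - \<phi> 0"] by simp
qed

lemma qser_eq_imp_value_eq:
  assumes "qser 0 \<phi> f" "qser 0 \<psi> g" "\<And>z. z \<in> uhp \<Longrightarrow> f z = g z"
  shows "\<phi> 0 = \<psi> 0"
  using assms qser_cong qser_value_unique by metis

lemma qser_bounded:
  assumes f: "qser l \<phi> f" and l: "l \<ge> 0"
  obtains C where "\<And>z. Im z \<ge> 1 \<Longrightarrow> norm (f z) \<le> C"
proof -
  have "exp (- 2 * pi) < 1" by simp
  then have sub: "cball 0 (exp (- 2 * pi)) \<subseteq> (ball 0 1 :: complex set)"
    by (auto simp del: exp_less_one_iff)
  have "compact (\<phi> ` cball 0 (exp (- 2 * pi)))"
    using f sub by (intro compact_continuous_image holomorphic_on_imp_continuous_on)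
      (auto simp: qser_def intro: holomorphic_on_subset)
  then obtain C where C: "\<And>q. norm q \<le> exp (- 2 * pi) \<Longrightarrow> norm (\<phi> q) \<le> C"
    by (fastforce dest!: compact_imp_bounded simp: bounded_iff)
  have "norm (f z) \<le> C" if z: "Im z \<ge> 1" for z
  proof -
    have "z \<in> uhp" using z by (simp add: uhp_def)
    have "norm (ee (of_real l * z)) \<le> 1" using l z by (simp add: norm_ee)
    moreover have "norm (\<phi> (ee z)) \<le> C" using z by (intro C) (simp add: norm_ee)
    ultimately have "norm (ee (of_real l * z)) * norm (\<phi> (ee z)) \<le> 1 * C"
      by (intro mult_mono) auto
    then show ?thesis using qserD[OF f \<open>z \<in> uhp\<close>] by (simp add: norm_mult)
  qed
  then show ?thesis by (rule that)
qed

lemma bounded_imp_moderate_growth: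
  assumes "\<And>z. Im z \<ge> 1 \<Longrightarrow> norm (f z) \<le> C"
  shows "moderate_growth f"
  unfolding moderate_growth_def
proof (intro exI allI impI)
  fix x y :: real assume y: "max 1 C < y"
  then have "norm (f (Complex x y)) \<le> C" by (intro assms) auto
  also have "\<dots> \<le> y powr 1" using y by simp
  finally show "norm (f (Complex x y)) \<le> y powr 1" .
qed

lemma qser_moderate_growth:
  assumes "qser l \<phi> f" "l \<ge> 0"
  shows "moderate_growth f"
  by (rule qser_bounded[OF assms]) (rule bounded_imp_moderate_growth)

text \<open>A quasiperiodic function descends to the punctured disc, where it is holomorphic because off
  either of two complementary cuts it is given by a branch of the logarithm; since \<open>l < 1\<close>, the growth
  bound makes the singularity at \<open>0\<close> removable.\<close>
lemma qser_of_quasiperiodic: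
  assumes f: "f holomorphic_on uhp" and per: "\<And>z. z \<in> uhp \<Longrightarrow> f (z + 1) = ee (of_real l) * f z"
    and l: "l < 1" and growth: "moderate_growth f"
  obtains \<phi> where "qser l \<phi> f"
proof -
  define h where "h z = ee (- (of_real l * z)) * f z" for z
  have h_hol: "h holomorphic_on uhp" unfolding h_def by (intro holomorphic_intros f)
  have h1: "h (z + 1) = h z" if "z \<in> uhp" for z
    using per[OF that] by (simp add: h_def ring_distribs ee_add ee_diff ee_minus)
  have hn: "h (z + of_nat n) = h z" if "z \<in> uhp" for z n
  proof (induction n)
    case (Suc n)
    then show ?case using h1[of "z + of_nat n"] that by (simp add: uhp_def algebra_simps)
  qed simp
  have hi: "h (z + of_int n) = h z" if "z \<in> uhp" for z n
  proof (cases "n \<ge> 0")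
    case True then show ?thesis using hn[OF that, of "nat n"] by simp
  next
    case False then show ?thesis using hn[of "z + of_int n" "nat (- n)"] that by (simp add: uhp_def)
  qed
  have h_eq: "h w = h z" if "w \<in> uhp" "z \<in> uhp" "ee w = ee z" for w z
    using that hi by (auto simp: ee_eq_iff)
  define D where "D = ball (0::complex) 1 - {0}"
  define L1 where "L1 q = Ln q / (2 * of_real pi * \<i>)" for q
  \<comment> \<open>Another logarithm of \<open>q\<close>, as exp(i pi) = -1; its cut lies along the
    positive real axis, opposite to that of \<open>L1\<close>.\<close>
  define L2 where "L2 q = (Ln (- q) + \<i> * of_real pi) / (2 * of_real pi * \<i>)" for q
  have L1: "ee (L1 q) = q" if "q \<in> D" for q using that by (simp add: D_def L1_def ee_Ln)
  have L2: "ee (L2 q) = q" if "q \<in> D" for q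
    using that by (simp add: D_def L2_def ee_eq exp_add)
  have uhp_iff: "z \<in> uhp \<longleftrightarrow> norm (ee z) < 1" for z
    by (simp add: norm_ee uhp_def zero_less_mult_iff)
  have L1u: "L1 q \<in> uhp" and L2u: "L2 q \<in> uhp" if "q \<in> D" for q
    using that L1[OF that] L2[OF that] by (simp_all add: uhp_iff D_def)
  define \<psi> where "\<psi> q = h (L1 q)" for q
  have \<psi>2: "\<psi> q = h (L2 q)" if "q \<in> D" for q
    unfolding \<psi>_def using that by (intro h_eq L1u L2u) (simp_all add: L1 L2)
  have "h \<circ> L1 holomorphic_on (D - \<real>\<^sub>\<le>\<^sub>0)"
    by (rule holomorphic_on_compose_gen[OF _ h_hol])
      (auto simp: L1_def[abs_def] intro!: holomorphic_intros L1u[unfolded L1_def])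
  then have hol1: "\<psi> holomorphic_on (D - \<real>\<^sub>\<le>\<^sub>0)"
    by (rule holomorphic_transform) (simp add: \<psi>_def)
  have "h \<circ> L2 holomorphic_on (D - \<real>\<^sub>\<ge>\<^sub>0)"
    by (rule holomorphic_on_compose_gen[OF _ h_hol])
      (auto simp: L2_def[abs_def] complex_nonpos_Reals_iff complex_nonneg_Reals_iff
         intro!: holomorphic_intros L2u[unfolded L2_def])
  then have hol2: "\<psi> holomorphic_on (D - \<real>\<^sub>\<ge>\<^sub>0)"
    by (rule holomorphic_transform) (simp add: \<psi>2)
  have "\<psi> holomorphic_on ((D - \<real>\<^sub>\<le>\<^sub>0) \<union> (D - \<real>\<^sub>\<ge>\<^sub>0))"
    by (rule holomorphic_on_Un[OF hol1 hol2]) (auto simp: D_def intro!: open_Diff)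
  moreover have "(D - \<real>\<^sub>\<le>\<^sub>0) \<union> (D - \<real>\<^sub>\<ge>\<^sub>0) = D"
    by (auto simp: D_def complex_nonpos_Reals_iff complex_nonneg_Reals_iff complex_eq_iff)
  ultimately have \<psi>_hol: "\<psi> holomorphic_on (ball 0 1 - {0})" by (simp add: D_def)
  obtain N c where Nc: "\<And>x y. y > c \<Longrightarrow> norm (f (Complex x y)) \<le> y powr N"
    using growth unfolding moderate_growth_def by blast
  \<comment> \<open>The bound for \<open>q * \<psi> q\<close> at height \<open>y\<close>: the factor
    \<open>q\<close> gives exp(-2 pi y), the normalization in \<open>h\<close> gives exp(2 pi l y),
    and moderate growth gives \<open>y powr N\<close>.\<close>
  define u where "u = (\<lambda>y::real. exp (- (2 * pi * (1 - l)) * y) * y powr N)"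
  have u: "(u \<longlongrightarrow> 0) at_top" unfolding u_def using l by real_asymp
  have "filterlim (\<lambda>q::complex. norm q) (at_right 0) (at 0)"
    unfolding filterlim_at by (auto simp: eventually_at_filter intro!: tendsto_eq_intros)
  moreover have Y: "filterlim (\<lambda>r::real. - ln r / (2 * pi)) at_top (at_right 0)" by real_asymp
  ultimately have Y: "filterlim (\<lambda>q::complex. - ln (norm q) / (2 * pi)) at_top (at 0)"
    using filterlim_compose[of "\<lambda>r::real. - ln r / (2 * pi)" at_top "at_right 0" "\<lambda>q::complex. norm q" "at 0"]
    by simp
  have lim: "((\<lambda>q::complex. u (- ln (norm q) / (2 * pi))) \<longlongrightarrow> 0) (at 0)"
    by (rule filterlim_compose[OF u Y])
  have "((\<lambda>q. (q - 0) * \<psi> q) \<longlongrightarrow> 0) (at 0)"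
  proof (rule Lim_null_comparison[OF _ lim])
    have ev1: "eventually (\<lambda>q::complex. - ln (norm q) / (2 * pi) > c) (at 0)"
      using Y by (auto simp: filterlim_at_top_dense)
    have ev2: "eventually (\<lambda>q::complex. q \<in> D) (at 0)"
      unfolding D_def using eventually_at_in_open[of "ball 0 1" "0::complex"] by simp
    show "eventually (\<lambda>q. norm ((q - 0) * \<psi> q) \<le> u (- ln (norm q) / (2 * pi))) (at 0)"
      using ev1 ev2
    proof eventually_elim
      case (elim q)
      define z where "z = L1 q"
      define y where "y = Im z"
      have z: "ee z = q" "z \<in> uhp" using elim L1 L1u by (auto simp: z_def)
      have q: "norm q = exp (- (2 * pi * y))" using z(1) norm_ee[of z] by (simp add: y_def)
      then have y: "y = - ln (norm q) / (2 * pi)" by simp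
      have "norm (f z) \<le> y powr N" using Nc[of y "Re z"] elim(1) unfolding y[symmetric] by (simp add: y_def)
      have "norm ((q - 0) * \<psi> q) = norm q * (exp (2 * pi * (l * y)) * norm (f z))"
        by (simp add: \<psi>_def h_def norm_mult norm_ee flip: z_def) (simp add: y_def)
      also have "\<dots> \<le> norm q * (exp (2 * pi * (l * y)) * y powr N)"
        using \<open>norm (f z) \<le> y powr N\<close> by (intro mult_left_mono) auto
      also have "norm q * exp (2 * pi * (l * y)) = exp (- (2 * pi * (1 - l)) * y)"
        unfolding q exp_add[symmetric] by (simp add: algebra_simps)
      then have "norm q * (exp (2 * pi * (l * y)) * y powr N) = u y"
        by (simp only: u_def mult.assoc[symmetric])
      finally show ?case by (simp add: y)
    qed
  qed
  then obtain \<phi> where \<phi>: "\<phi> holomorphic_on ball 0 1" "\<And>q. q \<in> D \<Longrightarrow> \<phi> q = \<psi> q"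
    using holomorphic_on_extend_lim[OF \<psi>_hol] by (auto simp: D_def)
  have "qser l \<phi> f"
    unfolding qser_def
  proof (intro conjI ballI)
    fix z assume z: "z \<in> uhp"
    then have D: "ee z \<in> D" using ee_in_ball by (simp add: D_def)
    have "\<phi> (ee z) = h z" unfolding \<phi>(2)[OF D] \<psi>_def using D z by (intro h_eq L1u) (simp_all add: L1)
    then show "f z = ee (of_real l * z) * \<phi> (ee z)"
      by (simp add: h_def ee_minus)
  qed (rule \<phi>)
  then show ?thesis by (rule that)
qed

section \<open>The eta function\<close>

definition euler_prod :: "complex \<Rightarrow> complex" where
  "euler_prod q = prodinf (\<lambda>n. 1 - q ^ Suc n)"

lemma euler_prod_convergent: "norm (q::complex) < 1 \<Longrightarrow> convergent_prod (\<lambda>n. 1 - q ^ Suc n)"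
proof -
  assume q: "norm (q::complex) < 1"
  have "summable (\<lambda>n. norm q ^ Suc n)" using q by (subst summable_Suc_iff) (simp add: summable_geometric)
  then have "summable (\<lambda>n. norm (1 - q ^ Suc n - 1))" by (simp add: norm_power norm_mult del: summable_Suc_iff)
  then have "abs_convergent_prod (\<lambda>n. 1 - q ^ Suc n)"
    unfolding abs_convergent_prod_conv_summable .
  then show ?thesis by (rule abs_convergent_prod_imp_convergent_prod)
qed

lemma euler_prod_nonzero: "q \<in> ball 0 1 \<Longrightarrow> euler_prod q \<noteq> 0"
  unfolding euler_prod_def
proof (rule prodinf_nonzero)
  assume q: "q \<in> ball 0 1"
  show "convergent_prod (\<lambda>n. 1 - q ^ Suc n)" using q by (intro euler_prod_convergent) simp
  fix n
  have "norm (q ^ Suc n) < 1" using q power_Suc_less_one[of "norm q" n]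
    by (cases "q = 0") (auto simp: norm_power norm_mult)
  then show "1 - q ^ Suc n \<noteq> 0" by auto
qed

lemma euler_prod_0: "euler_prod 0 = 1"
  by (simp add: euler_prod_def)

text \<open>On a closed disc inside the unit disc the n-th factor differs from 1 by at most
  \<open>r ^ Suc n\<close> with a fixed \<open>r < 1\<close>, so the partial products converge
  uniformly there.\<close>

lemma euler_prod_holomorphic: "euler_prod holomorphic_on ball 0 1"
proof (rule holomorphic_uniform_sequence[OF open_ball])
  fix N show "(\<lambda>q. \<Prod>n<N. 1 - q ^ Suc n) holomorphic_on ball (0::complex) 1"
    by (intro holomorphic_intros)
next
  fix q :: complex assume "q \<in> ball 0 1"
  then obtain d where d: "d > 0" "cball q d \<subseteq> ball 0 1"
    using open_contains_cball[of "ball (0::complex) 1"] by blast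
  then obtain r where r: "r < 1" "r \<ge> 0" "\<And>w. w \<in> cball q d \<Longrightarrow> norm w \<le> r"
  proof -
    have "compact (norm ` cball q d)" by (intro compact_continuous_image continuous_intros compact_cball)
    moreover have "norm ` cball q d \<noteq> {}" using d by auto
    ultimately obtain m where "m \<in> norm ` cball q d" "\<And>t. t \<in> norm ` cball q d \<Longrightarrow> t \<le> m"
      using compact_attains_sup by metis
    then show ?thesis using d(2) by (intro that[of m]) auto
  qed
  have "uniformly_convergent_on (cball q d) (\<lambda>N w. \<Prod>n<N. 1 - w ^ Suc n)"
  proof (rule uniformly_convergent_on_prod')
    show "uniformly_convergent_on (cball q d) (\<lambda>N w. \<Sum>n<N. norm (1 - w ^ Suc n - 1))"
    proof (rule Weierstrass_m_test')
      fix n w assume "w \<in> cball q d"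
      then have "norm w ^ Suc n \<le> r ^ Suc n" using r by (intro power_mono) auto
      then show "norm (norm (1 - w ^ Suc n - 1)) \<le> r ^ Suc n" by (simp add: norm_power norm_mult)
    next
      show "summable (\<lambda>n. r ^ Suc n)" using r by (subst summable_Suc_iff) (simp add: summable_geometric)
    qed
  qed (auto intro!: continuous_intros)
  then obtain g where g: "uniform_limit (cball q d) (\<lambda>N w. \<Prod>n<N. 1 - w ^ Suc n) g sequentially"
    by (auto simp: uniformly_convergent_on_def)
  have "g w = euler_prod w" if w: "w \<in> cball q d" for w
  proof -
    have "(\<lambda>N. \<Prod>n<N. 1 - w ^ Suc n) \<longlonglongrightarrow> g w" using tendsto_uniform_limitI[OF g w] .
    moreover have "(\<lambda>N. \<Prod>n\<le>N. 1 - w ^ Suc n) \<longlonglongrightarrow> euler_prod w"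
      unfolding euler_prod_def using w d(2) by (intro convergent_prod_LIMSEQ euler_prod_convergent) auto
    then have "(\<lambda>N. \<Prod>n<N. 1 - w ^ Suc n) \<longlonglongrightarrow> euler_prod w"
      by (simp only: LIMSEQ_lessThan_iff_atMost)
    ultimately show ?thesis by (rule LIMSEQ_unique)
  qed
  then have "uniform_limit (cball q d) (\<lambda>N w. \<Prod>n<N. 1 - w ^ Suc n) euler_prod sequentially"
    using g by (subst uniform_limit_cong'[where g = "\<lambda>N w. \<Prod>n<N. 1 - w ^ Suc n" and i = g]) auto
  then show "\<exists>d>0. cball q d \<subseteq> ball 0 1 \<and>
      uniform_limit (cball q d) (\<lambda>N w. \<Prod>n<N. 1 - w ^ Suc n) euler_prod sequentially"
    using d by blast
qed

lemma eta_qser: "qser (1/24) euler_prod eta"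
  using euler_prod_holomorphic by (simp add: qser_def eta_def euler_prod_def)

lemma eta_nonzero: "z \<in> uhp \<Longrightarrow> eta z \<noteq> 0"
  using qserD[OF eta_qser] euler_prod_nonzero ee_in_ball by simp

lemma Pfun_eq: "Pfun z = - 2 * (qder eta z / eta z)"
proof -
  have "\<i> / of_real pi = - 2 / (2 * of_real pi * \<i>)" by (simp add: field_simps)
  then show ?thesis by (simp add: Pfun_def qder_def)
qed

text \<open>The value -1/12 is -2 times the exponent 1/24 of eta; classically P is -1/12 times the
  Eisenstein series of weight 2.\<close>

lemma Pfun_qser:
  obtains p where "qser 0 p Pfun" "p 0 = - 1 / 12"
proof
  show "qser 0 (\<lambda>q. - 2 * ((of_real (1/24) * euler_prod q + q * deriv euler_prod q) / euler_prod q)) Pfun"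
    unfolding Pfun_eq[abs_def]
    using qser_cmult[OF qser_divide[OF qser_qder[OF eta_qser] eta_qser euler_prod_nonzero], of "-2"] by simp
  show "- 2 * ((of_real (1/24) * euler_prod 0 + 0 * deriv euler_prod 0) / euler_prod 0) = - 1 / 12"
    by (simp add: euler_prod_0)
qed

lemma Pfun_holomorphic: "Pfun holomorphic_on uhp"
  using Pfun_qser qser_holomorphic by metis

definition Delta :: "complex \<Rightarrow> complex" where
  "Delta z = (if z \<in> uhp then eta z ^ 24 else 0)"

lemma Delta_qser: "qser 1 (\<lambda>q. euler_prod q ^ 24) Delta"
  using qser_power[OF eta_qser, of 24] by (auto simp: Delta_def intro: qser_cong)

lemma Delta_nonzero: "z \<in> uhp \<Longrightarrow> Delta z \<noteq> 0"
  by (simp add: Delta_def eta_nonzero)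

lemma qder_Delta: "z \<in> uhp \<Longrightarrow> qder Delta z = - 12 * Pfun z * Delta z"
proof -
  assume z: "z \<in> uhp"
  have "qder Delta z = qder (\<lambda>z. eta z ^ 24) z"
    using z by (intro qder_cong) (auto simp: Delta_def)
  also have "\<dots> = 24 * eta z ^ 23 * qder eta z"
    using qder_power[OF qser_holomorphic[OF eta_qser] z, of 24] by simp
  also have "\<dots> = - 12 * Pfun z * Delta z"
    using z eta_nonzero[OF z] by (simp add: Pfun_eq Delta_def power_numeral_reduce)
  finally show ?thesis .
qed

section \<open>Modular forms for the full modular group\<close>

lemma moeb_uhp_S: "z \<in> uhp \<Longrightarrow> - (1 / z) \<in> uhp"
  using moeb_in_uhp[OF Smat_SL2Z] by (simp add: moeb_Smat)

lemma uhp_nonzero: "z \<in> uhp \<Longrightarrow> z \<noteq> 0"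
  by (auto simp: uhp_def)

lemma qser0_periodic: "qser 0 \<phi> f \<Longrightarrow> z \<in> uhp \<Longrightarrow> f (z + of_int n) = f z"
proof -
  assume f: "qser 0 \<phi> f" and z: "z \<in> uhp"
  have "ee (z + of_int n) = ee z" by (auto simp: ee_eq_iff)
  then show ?thesis using qserD[OF f z] qserD[OF f, of "z + of_int n"] z by (simp add: uhp_def)
qed

text \<open>Euclid's algorithm on the first column shows that the translation and the inversion generate
  \<open>SL(2,\<int>)\<close>; the translation is taken care of by the \<open>q\<close>-expansion.\<close>
lemma modular_of_S:
  assumes f: "qser 0 \<phi> f" and S: "\<And>z. z \<in> uhp \<Longrightarrow> f (- (1 / z)) = z powi w * f z"
    and g: "g \<in> SL2Z" and z: "z \<in> uhp"
  shows "f (moeb g z) = jfac g z powi w * f z"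
  using g
proof (induction "nat \<bar>g$2$1\<bar>" arbitrary: g rule: less_induct)
  case less
  have det: "g$1$1 * g$2$2 - g$1$2 * g$2$1 = 1"
    using less.prems by (simp add: SL2Z_def det_2)
  show ?case
  proof (cases "g$2$1 = 0")
    case True
    with det have "(g$1$1 = 1 \<and> g$2$2 = 1) \<or> (g$1$1 = -1 \<and> g$2$2 = -1)"
      by (simp add: zmult_eq_1_iff)
    then show ?thesis
    proof
      assume "g$1$1 = 1 \<and> g$2$2 = 1"
      then show ?thesis
        using True qser0_periodic[OF f z] by (simp add: moeb_def jfac_def ent_a_def ent_b_def ent_c_def ent_d_def)
    next
      assume *: "g$1$1 = -1 \<and> g$2$2 = -1"
      \<comment> \<open>The matrix -1 acts trivially on the half-plane, so
        \<open>(-1) powi w * f z = f z\<close> has to hold. It comes from applying the inversion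
        twice.\<close>
      have "f z = f (- (1 / (- (1 / z))))" by simp
      also have "\<dots> = (- (1 / z)) powi w * (z powi w * f z)"
        unfolding S[OF moeb_uhp_S[OF z]] S[OF z] ..
      also have "\<dots> = (- (1 / z) * z) powi w * f z"
        by (simp only: power_int_mult_distrib mult.assoc)
      also have "- (1 / z) * z = - 1" using uhp_nonzero[OF z] by simp
      finally have m1: "(- 1) powi w * f z = f z" ..
      have "moeb g z = z + of_int (- g$1$2)" "jfac g z = -1"
        using * True by (simp_all add: moeb_def jfac_def ent_a_def ent_b_def ent_c_def ent_d_def)
      then show ?thesis using m1 qser0_periodic[OF f z, of "- g$1$2"] by simp
    qed
  next
    case False
    \<comment> \<open>One Euclidean step: \<open>h\<close> is the product of \<open>Smat\<close>,
      the n-th power of \<open>Tmat\<close> and \<open>g\<close>. This \<open>n\<close> turns the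
      upper left entry into its remainder modulo the lower left one, and \<open>Smat\<close> moves
      that remainder down.\<close>
    define n where "n = - (g$1$1 div g$2$1)"
    define h :: "int^2^2" where
      "h = vector [vector [- g$2$1, - g$2$2], vector [g$1$1 + n * g$2$1, g$1$2 + n * g$2$2]]"
    have h21: "h$2$1 = g$1$1 mod g$2$1"
      by (simp add: h_def n_def minus_div_mult_eq_mod)
    have "\<bar>h$2$1\<bar> < \<bar>g$2$1\<bar>" using False h21 abs_mod_less by simp
    moreover have h: "h \<in> SL2Z"
      using det by (simp add: SL2Z_def det_2 h_def algebra_simps)
    ultimately have fh: "f (moeb h z) = jfac h z powi w * f z" using less.hyps[of h] by simp
    define y where "y = moeb g z + of_int n"
    have y: "y \<in> uhp" using moeb_in_uhp[OF less.prems z] by (simp add: y_def uhp_def)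
    have J: "jfac g z \<noteq> 0" using jfac_nonzero[OF less.prems z] .
    have yJ: "y * jfac g z = jfac h z"
    proof -
      have "moeb g z * jfac g z = ent_a g * z + ent_b g" using J by (simp add: moeb_def jfac_def)
      then have "y * jfac g z = ent_a g * z + ent_b g + of_int n * jfac g z" by (simp add: y_def ring_distribs)
      also have "\<dots> = jfac h z"
        by (simp add: jfac_def h_def ent_a_def ent_b_def ent_c_def ent_d_def algebra_simps)
      finally show ?thesis .
    qed
    have "moeb h z = - jfac g z / jfac h z"
      by (simp add: moeb_def jfac_def h_def ent_a_def ent_b_def ent_c_def ent_d_def)
    also have "\<dots> = - (1 / y)" using J uhp_nonzero[OF y] by (simp flip: yJ)
    finally have "f (moeb h z) = y powi w * f y" using S[OF y] by simp
    also have "f y = f (moeb g z)" unfolding y_def using qser0_periodic[OF f moeb_in_uhp[OF less.prems z]] .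
    finally have "y powi w * f (moeb g z) = jfac h z powi w * f z" unfolding fh ..
    also have "\<dots> = y powi w * (jfac g z powi w * f z)"
      by (simp add: power_int_mult_distrib mult.assoc flip: yJ)
    finally have "y powi w * f (moeb g z) = y powi w * (jfac g z powi w * f z)" .
    moreover have "y powi w \<noteq> 0" using uhp_nonzero[OF y] by simp
    ultimately show ?thesis by (metis mult_left_cancel)
  qed
qed

section \<open>Closure properties of the spaces of modular forms\<close>

lemma MkI:
  assumes "\<And>z. z \<notin> uhp \<Longrightarrow> f z = 0" "qser 0 \<phi> f"
    and "\<And>z. z \<in> uhp \<Longrightarrow> f (- (1 / z)) = z powi w * f z"
  shows "f \<in> Mk w"
  unfolding Mk_def
  using assms(1) qser_holomorphic[OF assms(2)] qser_moderate_growth[OF assms(2)] modular_of_S[OF assms(2,3)]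
  by (auto simp: jfac_def)

lemma Mk_off: "f \<in> Mk w \<Longrightarrow> z \<notin> uhp \<Longrightarrow> f z = 0"
  by (simp add: Mk_def)

lemma Mk_modular: "f \<in> Mk w \<Longrightarrow> g \<in> SL2Z \<Longrightarrow> z \<in> uhp \<Longrightarrow> f (moeb g z) = jfac g z powi w * f z"
  by (simp add: Mk_def jfac_def)

lemma Mk_S: "f \<in> Mk w \<Longrightarrow> z \<in> uhp \<Longrightarrow> f (- (1 / z)) = z powi w * f z"
  using Mk_modular[OF _ Smat_SL2Z] by (simp add: moeb_Smat jfac_Smat)

lemma Mk_qser:
  assumes "f \<in> Mk w"
  obtains \<phi> where "qser 0 \<phi> f"
proof (rule qser_of_quasiperiodic[of f 0])
  show "f (z + 1) = ee (of_real 0) * f z" if "z \<in> uhp" for z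
    using Mk_modular[OF assms Tmat_SL2Z that] by (simp add: moeb_Tmat jfac_Tmat)
qed (use assms in \<open>auto simp: Mk_def\<close>)

lemma Mk_holomorphic: "f \<in> Mk w \<Longrightarrow> f holomorphic_on uhp"
  by (simp add: Mk_def)

lemma Mk_zero: "(\<lambda>z. 0) \<in> Mk w"
  by (rule MkI[OF _ qser_const]) auto

lemma Mk_add: "f \<in> Mk w \<Longrightarrow> g \<in> Mk w \<Longrightarrow> (\<lambda>z. f z + g z) \<in> Mk w"
  by (rule Mk_qser[of f w], assumption, rule Mk_qser[of g w], assumption, rule MkI[OF _ qser_add])
    (auto simp: Mk_off Mk_S ring_distribs)

lemma Mk_mult:
  assumes "f \<in> Mk w" "g \<in> Mk v"
  shows "(\<lambda>z. f z * g z) \<in> Mk (w + v)"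
  by (rule Mk_qser[OF assms(1)], rule Mk_qser[OF assms(2)], rule MkI[OF _ qser_mult0])
    (use assms in \<open>auto simp: Mk_off[of f w] Mk_S[of f w] Mk_S[of g v] power_int_add uhp_nonzero\<close>)

lemma Mk_cmult: "f \<in> Mk w \<Longrightarrow> (\<lambda>z. c * f z) \<in> Mk w"
  by (rule Mk_qser[of f w], assumption, rule MkI[OF _ qser_cmult]) (auto simp: Mk_off Mk_S mult.left_commute)

lemma Mk_diff: "f \<in> Mk w \<Longrightarrow> g \<in> Mk w \<Longrightarrow> (\<lambda>z. f z - g z) \<in> Mk w"
  using Mk_add[OF _ Mk_cmult[of g w "-1"], of f] by simp

lemma Mk_sum: "(\<And>i. i \<in> I \<Longrightarrow> f i \<in> Mk w) \<Longrightarrow> (\<lambda>z. \<Sum>i\<in>I. f i z) \<in> Mk w"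
  by (induction I rule: infinite_finite_induct) (auto simp: Mk_zero intro!: Mk_add)

text \<open>The unit of the graded ring in the encoding by functions vanishing off
  \<open>uhp\<close>. It accompanies powers because a zeroth power would be 1 off \<open>uhp\<close>
  as well.\<close>

definition Mone :: "complex \<Rightarrow> complex" where
  "Mone z = (if z \<in> uhp then 1 else 0)"

lemma Mone_qser: "qser 0 (\<lambda>q. 1) Mone"
  by (simp add: qser_def Mone_def)

lemma Mone_Mk: "Mone \<in> Mk 0"
  by (rule MkI[OF _ Mone_qser]) (auto simp: Mone_def moeb_uhp_S)

lemma Mk_power:
  assumes "f \<in> Mk w"
  shows "(\<lambda>z. Mone z * f z ^ n) \<in> Mk (of_nat n * w)"
proof (induction n)
  case 0
  then show ?case using Mone_Mk by simp
next
  case (Suc n)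
  then show ?case using Mk_mult[OF assms Suc] by (simp add: algebra_simps)
qed

text \<open>Two inversions give the identity map but the automorphy factor
  \<open>(-1) powi w\<close>.\<close>

lemma Mk_odd:
  assumes f: "f \<in> Mk w" and w: "odd w"
  shows "f z = 0"
proof (cases "z \<in> uhp")
  case True
  have "f z = f (- (1 / (- (1 / z))))" by simp
  also have "\<dots> = (- (1 / z)) powi w * (z powi w * f z)"
    unfolding Mk_S[OF f moeb_uhp_S[OF True]] Mk_S[OF f True] ..
  also have "\<dots> = (- (1 / z) * z) powi w * f z"
    by (simp only: power_int_mult_distrib mult.assoc)
  also have "- (1 / z) * z = - 1" using uhp_nonzero[OF True] by simp
  also have "(- 1 :: complex) powi w = - 1" using w by simp
  finally show ?thesis by simp
qed (use Mk_off f in auto)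

text \<open>The inversion at least doubles an imaginary part below \<open>1/2\<close> once \<open>\<bar>Re z\<bar> \<le> 1/2\<close>.\<close>
lemma reduce_to_strip:
  assumes f: "qser 0 \<phi> f" and S: "\<And>z. z \<in> uhp \<Longrightarrow> f (- (1 / z)) = f z" and z: "z \<in> uhp"
  obtains w where "Im w \<ge> 1/2" "\<bar>Re w\<bar> \<le> 1/2" "f w = f z"
proof -
  have *: "\<exists>w. Im w \<ge> 1/2 \<and> \<bar>Re w\<bar> \<le> 1/2 \<and> f w = f z" if "Im z \<ge> (1/2) ^ Suc n" for n z
    using that
  proof (induction n arbitrary: z)
    case 0
    then have z: "z \<in> uhp" by (simp add: uhp_def)
    show ?case
      using 0 qser0_periodic[OF f z, of "- round (Re z)"] of_int_round_abs_le[of "Re z"]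
      by (intro exI[of _ "z + of_int (- round (Re z))"]) (auto simp: abs_minus_commute)
  next
    case (Suc n)
    have "0 < (1/2::real) ^ Suc (Suc n)" by simp
    with Suc.prems have z: "z \<in> uhp" unfolding uhp_def by (simp only: mem_Collect_eq)
    define y where "y = z + of_int (- round (Re z))"
    have y: "y \<in> uhp" "\<bar>Re y\<bar> \<le> 1/2" "Im y = Im z" "f y = f z"
      using z qser0_periodic[OF f z, of "- round (Re z)"] of_int_round_abs_le[of "Re z"]
      by (auto simp: abs_minus_commute y_def uhp_def)
    show ?case
    proof (cases "Im y \<ge> 1/2")
      case True
      then show ?thesis using y by blast
    next
      case False
      have "(Re y)\<^sup>2 \<le> (1/2)\<^sup>2" "(Im y)\<^sup>2 \<le> (1/2)\<^sup>2"
        using y False by (auto simp: abs_le_square_iff[symmetric] uhp_def)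
      then have le: "(cmod y)\<^sup>2 \<le> 1/2" unfolding cmod_power2 by (simp add: power2_eq_square)
      have "cmod y > 0" using uhp_nonzero[OF y(1)] by simp
      then have pos: "(cmod y)\<^sup>2 > 0" by simp
      have "Im (- (1 / y)) = Im y / (cmod y)\<^sup>2"
        using Im_moeb[OF Smat_SL2Z y(1)] by (simp add: moeb_Smat jfac_Smat)
      also have "Im y / (cmod y)\<^sup>2 \<ge> Im y / (1/2)"
        using le pos y(1) by (intro divide_left_mono) (auto simp: uhp_def)
      finally have "Im (- (1 / y)) \<ge> 2 * Im z" using y by simp
      with Suc.prems have "Im (- (1 / y)) \<ge> (1/2) ^ Suc n" by simp
      from Suc.IH[OF this] show ?thesis using S[OF y(1)] y(4) by simp
    qed
  qed
  have "Im z > 0" using z by (simp add: uhp_def)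
  then obtain n where "(1/2) ^ n < Im z" using real_arch_pow_inv[of "Im z" "1/2"] by auto
  moreover have "(1/2::real) ^ Suc n \<le> (1/2) ^ n" by simp
  ultimately have "Im z \<ge> (1/2) ^ Suc n" by linarith
  from *[OF this] show ?thesis using that by blast
qed

text \<open>Subtracting the value at the cusp gives \<open>h\<close> tending to 0 there. Every orbit
  meets the strip with Im at least 1/2, and high up in it \<open>h\<close> is small, so the maximum
  of the modulus over a compact box is one over the whole half-plane. The maximum principle makes
  \<open>h\<close> constant, and the limit 0 contradicts \<open>h z0\<close> being non-zero.\<close>

lemma Mk_0_constant:
  assumes f: "f \<in> Mk 0" and \<phi>: "qser 0 \<phi> f" and z0: "z0 \<in> uhp"
  shows "f z0 = \<phi> 0"
proof (rule ccontr)
  assume ne: "f z0 \<noteq> \<phi> 0"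
  define h where "h z = f z - \<phi> 0" for z
  have h: "qser 0 (\<lambda>q. \<phi> q - \<phi> 0) h" unfolding h_def by (rule qser_diff[OF \<phi> qser_const])
  have hS: "h (- (1 / z)) = h z" if "z \<in> uhp" for z using Mk_S[OF f that] by (simp add: h_def)
  have h0: "norm (h z0) > 0" using ne by (simp add: h_def)
  obtain Y where Y: "\<And>z. z \<in> uhp \<Longrightarrow> Im z > Y \<Longrightarrow> norm (h z) < norm (h z0)"
    using qser_tendsto[OF h h0] by auto
  define K where "K = cbox (Complex (-1/2) (1/2)) (Complex (1/2) Y)"
  have K: "z \<in> K \<longleftrightarrow> \<bar>Re z\<bar> \<le> 1/2 \<and> 1/2 \<le> Im z \<and> Im z \<le> Y" for z
    by (auto simp: K_def in_cbox_complex_iff)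
  obtain w0 where w0: "Im w0 \<ge> 1/2" "\<bar>Re w0\<bar> \<le> 1/2" "h w0 = h z0"
    using reduce_to_strip[OF h hS z0] .
  \<comment> \<open>A representative of \<open>z0\<close> cannot lie above height \<open>Y\<close>,
    where the modulus is strictly smaller than at \<open>z0\<close>; in particular the box is
    non-empty.\<close>
  have w0K: "w0 \<in> K" using Y[of w0] w0 by (force simp: K uhp_def)
  have "continuous_on K h"
    using qser_holomorphic[OF h]
    by (intro holomorphic_on_imp_continuous_on) (auto simp: K uhp_def intro: holomorphic_on_subset)
  then have "continuous_on K (\<lambda>z. norm (h z))" by (intro continuous_intros)
  then obtain \<xi> where \<xi>: "\<xi> \<in> K" "\<And>z. z \<in> K \<Longrightarrow> norm (h z) \<le> norm (h \<xi>)"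
    using continuous_attains_sup[of K "\<lambda>z. norm (h z)"] w0K compact_cbox K_def by blast
  have \<xi>u: "\<xi> \<in> uhp" using \<xi>(1) by (simp add: K uhp_def)
  have "norm (h z) \<le> norm (h \<xi>)" if "z \<in> uhp" for z
  proof -
    obtain w where w: "Im w \<ge> 1/2" "\<bar>Re w\<bar> \<le> 1/2" "h w = h z"
      using reduce_to_strip[OF h hS \<open>z \<in> uhp\<close>] .
    show ?thesis
    proof (cases "Im w \<le> Y")
      case True
      then show ?thesis using \<xi>(2)[of w] w by (simp add: K)
    next
      case False
      then have "norm (h w) < norm (h w0)" using Y[of w] w w0 by (simp add: uhp_def)
      also have "\<dots> \<le> norm (h \<xi>)" using \<xi>(2) w0K .
      finally show ?thesis using w by simp
    qed
  qed
  then have "h constant_on uhp"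
    by (intro maximum_modulus_principle[OF qser_holomorphic[OF h] open_uhp connected_uhp open_uhp _ \<xi>u]) auto
  then obtain C where C: "\<And>z. z \<in> uhp \<Longrightarrow> h z = C" by (auto simp: constant_on_def)
  define z where "z = Complex 0 (max 0 Y + 1)"
  have "z \<in> uhp" "Im z > Y" by (auto simp: z_def uhp_def)
  then show False using Y[of z] C[of z] C[of z0] z0 by simp
qed

text \<open>The factor q is moved into the power series, which then vanishes at 0: this form shows
  \<open>Delta\<close> to be a cusp form. The form with exponent 1 and a zero-free series serves for
  division by \<open>Delta\<close>.\<close>

lemma Delta_qser0: "qser 0 (\<lambda>q. q * euler_prod q ^ 24) Delta"
  using Delta_qser by (auto simp: qser_def intro!: holomorphic_intros)

section \<open>The Serre derivative and Moebius substitutions\<close>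

lemma qder_comp_moeb:
  assumes "f holomorphic_on uhp" "g \<in> SL2Z" "z \<in> uhp"
  shows "qder (\<lambda>z. f (moeb g z)) z = qder f (moeb g z) / (jfac g z)\<^sup>2"
proof (rule qder_eqI)
  have "((\<lambda>z. f (moeb g z)) has_field_derivative
      2 * of_real pi * \<i> * qder f (moeb g z) * inverse ((jfac g z)\<^sup>2)) (at z)"
    by (rule DERIV_chain2[where f = f and g = "moeb g", OF has_field_derivative_qder[OF assms(1) moeb_in_uhp[OF assms(2,3)]]
          moeb_has_field_derivative[OF assms(2,3)]])
  then show "((\<lambda>z. f (moeb g z)) has_field_derivative
      2 * of_real pi * \<i> * (qder f (moeb g z) / (jfac g z)\<^sup>2)) (at z)"
    by (simp add: divide_inverse mult.assoc)
qed

lemma powi_jfac_qder: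
  assumes "g \<in> SL2Z" "z \<in> uhp"
  shows "qder (\<lambda>z. jfac g z powi w) z = of_int w * ent_c g / (2 * of_real pi * \<i> * jfac g z) * jfac g z powi w"
    and "(\<lambda>z. jfac g z powi w) holomorphic_on uhp"
proof -
  have J: "jfac g z \<noteq> 0" using jfac_nonzero[OF assms] .
  have "((\<lambda>z. jfac g z powi w) has_field_derivative of_int w * jfac g z powi (w - 1) * ent_c g) (at z)"
    using J by (intro DERIV_power_int jfac_has_field_derivative) simp
  moreover have "jfac g z powi (w - 1) = jfac g z powi w / jfac g z" using J by (simp add: power_int_diff)
  ultimately show "qder (\<lambda>z. jfac g z powi w) z = of_int w * ent_c g / (2 * of_real pi * \<i> * jfac g z) * jfac g z powi w"
    using J by (intro qder_eqI) (simp add: field_simps)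
  show "(\<lambda>z. jfac g z powi w) holomorphic_on uhp"
    using jfac_nonzero[OF assms(1)] by (intro holomorphic_intros) auto
qed

lemma Dsc_eq: "z \<in> uhp \<Longrightarrow> Dsc k f z = qder f z + of_real k * Pfun z * f z"
  by (simp add: Dsc_def qder_def)

lemma Dsc_off: "z \<notin> uhp \<Longrightarrow> Dsc k f z = 0"
  by (simp add: Dsc_def)

lemma Dsc_holomorphic: "f holomorphic_on uhp \<Longrightarrow> Dsc k f holomorphic_on uhp"
proof -
  assume "f holomorphic_on uhp"
  then have "(\<lambda>z. qder f z + of_real k * Pfun z * f z) holomorphic_on uhp"
    by (intro holomorphic_intros Pfun_holomorphic)
  then show ?thesis by (rule holomorphic_transform) (simp add: Dsc_eq)
qed

lemma Dsc_qser:
  assumes p: "qser 0 p Pfun" and f: "qser l \<phi> f"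
  shows "qser l (\<lambda>q. of_real l * \<phi> q + q * deriv \<phi> q + of_real k * p q * \<phi> q) (Dsc k f)"
proof (rule qser_cong)
  show "qser l (\<lambda>q. of_real l * \<phi> q + q * deriv \<phi> q + of_real k * p q * \<phi> q)
     (\<lambda>z. qder f z + of_real k * Pfun z * f z)"
    by (intro qser_add qser_qder qser_mult0 qser_cmult p f)
qed (simp add: Dsc_eq)

text \<open>The exponents \<open>i\<close> for which \<open>Delta ^ i\<close> can be completed to
  weight \<open>2 v\<close> by one form of weight \<open>2 (v - 6 i)\<close> with constant term 1.
  The value 1 is excluded because there is no form of weight 2.\<close>

definition Mindex :: "nat \<Rightarrow> nat set" where
  "Mindex v = {i. 6 * i \<le> v \<and> v - 6 * i \<noteq> 1}"

lemma finite_Mindex: "finite (Mindex v)"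
  by (rule finite_subset[of _ "{..v}"]) (auto simp: Mindex_def)

lemma Mindex_small: "v < 6 \<Longrightarrow> Mindex v = (if v = 1 then {} else {0})"
proof -
  assume "v < 6"
  then have "i \<in> Mindex v \<longleftrightarrow> i \<in> (if v = 1 then {} else {0})" for i
    by (cases i) (auto simp: Mindex_def)
  then show ?thesis by blast
qed

text \<open>The combinatorial shadow of splitting a form into a multiple of \<open>Eis v\<close> and
  \<open>Delta\<close> times a form of weight lower by 12.\<close>

lemma Mindex_rec: "v \<ge> 6 \<Longrightarrow> Mindex v = insert 0 (Suc ` Mindex (v - 6))"
proof -
  assume v: "v \<ge> 6"
  have "i \<in> Mindex v \<longleftrightarrow> i \<in> insert 0 (Suc ` Mindex (v - 6))" for i
    using v by (cases i) (auto simp: Mindex_def)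
  then show ?thesis by blast
qed

lemma card_Mindex: "card (Mindex v) = (if v mod 6 = 1 then v div 6 else v div 6 + 1)"
proof (induction v rule: less_induct)
  case (less v)
  show ?case
  proof (cases "v < 6")
    case True
    then show ?thesis by (auto simp: Mindex_small)
  next
    case False
    then have v: "v \<ge> 6" by simp
    have "card (Mindex v) = Suc (card (Mindex (v - 6)))"
      unfolding Mindex_rec[OF v] by (subst card_insert_disjoint) (auto simp: finite_Mindex card_image)
    also have "\<dots> = Suc (if (v - 6) mod 6 = 1 then (v - 6) div 6 else (v - 6) div 6 + 1)"
      using less.IH[of "v - 6"] v by simp
    finally show ?thesis using v by (auto simp: le_div_geq le_mod_geq)
  qed
qed

text \<open>The four generators sit 0, 2, 4 and 6 above the lowest weight, so this is the
  coefficient of t^v in (1 + t + t^2 + t^3) / ((1 - t^2)(1 - t^3)). It is checked on residues modulo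
  6.\<close>

lemma sum_card_Mindex:
  "(\<Sum>j<4. if j \<le> v then card (Mindex (v - j)) else 0) = 2 * v div 3 + 1"
proof -
  have 4: "{..<4::nat} = {0, 1, 2, 3}" by auto
  define r a where "r = v mod 6" and "a = v div 6"
  have v: "v = 6 * a + r" by (simp add: r_def a_def)
  have "r < 6" by (simp add: r_def)
  then have "r = 0 \<or> r = 1 \<or> r = 2 \<or> r = 3 \<or> r = 4 \<or> r = 5" by linarith
  then show ?thesis
  \<comment> \<open>For \<open>a = 0\<close> some \<open>j\<close> may exceed \<open>v\<close> and
    contribute 0; from \<open>a = 1\<close> on all four terms are present.\<close>
  proof (cases a)
    case 0
    then show ?thesis using \<open>r = 0 \<or> _\<close> unfolding card_Mindex v 4 by (elim disjE) simp_all
  next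
    case (Suc b)
    then show ?thesis using \<open>r = 0 \<or> _\<close> unfolding card_Mindex v 4 by (elim disjE) (simp_all add: algebra_simps)
  qed
qed

text \<open>The modular behaviour of \<open>\<eta>'/\<eta>\<close> holds unconditionally, but the hypotheses of the theorem supply it
  for free: the Wronskian of a fundamental system of an MLDE is a power of \<open>\<eta>\<close>, and it transforms by
  a determinant.\<close>
locale quasimodular_Pfun =
  assumes Pfun_moeb: "\<And>g z. g \<in> SL2Z \<Longrightarrow> z \<in> uhp \<Longrightarrow>
    Pfun (moeb g z) = (jfac g z)\<^sup>2 * Pfun z - ent_c g * jfac g z / (2 * of_real pi * \<i>)"
begin

text \<open>The anomaly of P, multiplied by \<open>k\<close>, cancels the logarithmic derivative of
  the automorphy factor \<open>A\<close>. Keeping \<open>A\<close> abstract covers integral and real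
  powers; \<open>f\<close> and \<open>h\<close> may differ so that \<open>h\<close> can be a
  combination of components produced by a representation.\<close>

lemma Dsc_moeb:
  assumes g: "g \<in> SL2Z" and f: "f holomorphic_on uhp" and h: "h holomorphic_on uhp"
    and A: "A holomorphic_on uhp"
    and eq: "\<And>z. z \<in> uhp \<Longrightarrow> f (moeb g z) = A z * h z"
    and A': "\<And>z. z \<in> uhp \<Longrightarrow> qder A z = of_real k * ent_c g / (2 * of_real pi * \<i> * jfac g z) * A z"
    and z: "z \<in> uhp"
  shows "Dsc k f (moeb g z) = (jfac g z)\<^sup>2 * A z * Dsc k h z"
proof -
  have J: "jfac g z \<noteq> 0" using jfac_nonzero[OF g z] .
  have "qder f (moeb g z) / (jfac g z)\<^sup>2 = qder (\<lambda>z. f (moeb g z)) z"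
    using qder_comp_moeb[OF f g z] by simp
  also have "\<dots> = qder (\<lambda>z. A z * h z) z" using eq z by (rule qder_cong)
  also have "\<dots> = qder A z * h z + A z * qder h z" by (rule qder_mult[OF A h z])
  finally have "qder f (moeb g z) = (jfac g z)\<^sup>2 * (qder A z * h z + A z * qder h z)"
    using J by (simp add: field_simps)
  then have "Dsc k f (moeb g z) = (jfac g z)\<^sup>2 * (qder A z * h z + A z * qder h z) +
      of_real k * ((jfac g z)\<^sup>2 * Pfun z - ent_c g * jfac g z / (2 * of_real pi * \<i>)) * (A z * h z)"
    using z by (simp add: Dsc_eq moeb_in_uhp g Pfun_moeb eq)
  also have "\<dots> = (jfac g z)\<^sup>2 * A z * Dsc k h z"
    unfolding A'[OF z] Dsc_eq[OF z] using J by (simp add: field_simps power2_eq_square)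
  finally show ?thesis .
qed

lemma Dsc_Mk:
  assumes f: "f \<in> Mk w"
  shows "Dsc (of_int w) f \<in> Mk (w + 2)"
proof -
  obtain p where p: "qser 0 p Pfun" using Pfun_qser by blast
  obtain \<phi> where \<phi>: "qser 0 \<phi> f" using Mk_qser[OF f] .
  show ?thesis
  proof (rule MkI[OF _ Dsc_qser[OF p \<phi>]])
    fix z assume z: "z \<in> uhp"
    have "Dsc (of_int w) f (moeb Smat z) = (jfac Smat z)\<^sup>2 * (jfac Smat z powi w) * Dsc (of_int w) f z"
      by (rule Dsc_moeb[OF Smat_SL2Z Mk_holomorphic[OF f] Mk_holomorphic[OF f]])
        (use z Smat_SL2Z in \<open>auto simp: Mk_modular[OF f] powi_jfac_qder\<close>)
    then show "Dsc (of_int w) f (- (1 / z)) = z powi (w + 2) * Dsc (of_int w) f z"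
      using uhp_nonzero[OF z] by (simp add: moeb_Smat jfac_Smat power_int_add)
  qed (simp add: Dsc_off)
qed

text \<open>Ramanujan's identity q dE_2/dq = (E_2^2 - E_4)/12, solved for E_4 with E_2 = -12
  P.\<close>

definition E4 :: "complex \<Rightarrow> complex" where
  "E4 z = (if z \<in> uhp then 144 * ((Pfun z)\<^sup>2 + qder Pfun z) else 0)"

lemma E4_qser: obtains \<phi> where "qser 0 \<phi> E4" "\<phi> 0 = 1"
proof -
  obtain p where p: "qser 0 p Pfun" "p 0 = - 1 / 12" using Pfun_qser .
  have "qser 0 (\<lambda>q. 144 * ((p q)^2 + (of_real 0 * p q + q * deriv p q))) (\<lambda>z. 144 * ((Pfun z)^2 + qder Pfun z))"
    using qser_power[OF p(1), of 2] by (intro qser_cmult qser_add qser_qder p) simp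
  then have "qser 0 (\<lambda>q. 144 * ((p q)^2 + (of_real 0 * p q + q * deriv p q))) E4"
    by (rule qser_cong) (simp add: E4_def)
  moreover have "144 * ((p 0)^2 + (of_real 0 * p 0 + 0 * deriv p 0)) = 1" by (simp add: p power2_eq_square)
  ultimately show ?thesis by (rule that)
qed

text \<open>Differentiating the inversion law of P yields a term in P and a constant anomaly; both
  cancel against those of the square of P.\<close>

lemma E4_Mk: "E4 \<in> Mk 4"
proof -
  obtain \<phi> where \<phi>: "qser 0 \<phi> E4" using E4_qser by blast
  show ?thesis
  proof (rule MkI[OF _ \<phi>])
    fix z assume z: "z \<in> uhp"
    have PS: "Pfun (- (1 / z)) = z\<^sup>2 * Pfun z - z / (2 * of_real pi * \<i>)" if "z \<in> uhp" for z
      using Pfun_moeb[OF Smat_SL2Z that] by (simp add: moeb_Smat jfac_Smat ent_Smat)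
    have "qder Pfun (- (1 / z)) / z\<^sup>2 = qder (\<lambda>z. Pfun (- (1 / z))) z"
      using qder_comp_moeb[OF Pfun_holomorphic Smat_SL2Z z] by (simp add: moeb_Smat jfac_Smat)
    also have "\<dots> = qder (\<lambda>z. z\<^sup>2 * Pfun z - z / (2 * of_real pi * \<i>)) z" using PS z by (rule qder_cong)
    also have "\<dots> = 2 * z / (2 * of_real pi * \<i>) * Pfun z + z\<^sup>2 * qder Pfun z - 1 / (2 * of_real pi * \<i>)\<^sup>2"
      by (rule qder_eqI)
        (auto intro!: derivative_eq_intros has_field_derivative_qder[OF Pfun_holomorphic z] simp: field_simps power2_eq_square)
    finally have P': "qder Pfun (- (1 / z)) = z\<^sup>2 * (2 * z / (2 * of_real pi * \<i>) * Pfun z + z\<^sup>2 * qder Pfun z - 1 / (2 * of_real pi * \<i>)\<^sup>2)"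
      using uhp_nonzero[OF z] by (simp add: divide_eq_eq mult.commute)
    have "(z\<^sup>2 * p - z / K)\<^sup>2 + z\<^sup>2 * (2 * z / K * p + z\<^sup>2 * p' - 1 / K\<^sup>2) = z ^ 4 * (p\<^sup>2 + p')" for p p' K :: complex
      by (cases "K = 0") (simp_all add: field_simps power2_eq_square power4_eq_xxxx)
    then have "(Pfun (- (1 / z)))\<^sup>2 + qder Pfun (- (1 / z)) = z ^ 4 * ((Pfun z)\<^sup>2 + qder Pfun z)"
      unfolding PS[OF z] P' .
    then show "E4 (- (1 / z)) = z powi 4 * E4 z"
      using z moeb_uhp_S[OF z] by (simp add: E4_def)
  qed (simp add: E4_def)
qed

text \<open>Ramanujan's identity for E_4, which in terms of the Serre derivative reads D_4 E_4 =
  -E_6/3.\<close>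

definition E6 :: "complex \<Rightarrow> complex" where
  "E6 z = - 3 * Dsc 4 E4 z"

lemma E6_qser: obtains \<phi> where "qser 0 \<phi> E6" "\<phi> 0 = 1"
proof -
  obtain p where p: "qser 0 p Pfun" "p 0 = - 1 / 12" using Pfun_qser .
  obtain \<phi> where \<phi>: "qser 0 \<phi> E4" "\<phi> 0 = 1" using E4_qser .
  show ?thesis
    using that[OF qser_cmult[OF Dsc_qser[OF p(1) \<phi>(1), of 4], of "-3", folded E6_def]] p \<phi> by simp
qed

lemma E6_Mk: "E6 \<in> Mk 6"
  using Mk_cmult[OF Dsc_Mk[OF E4_Mk], of "-3"] by (simp add: E6_def[abs_def])

text \<open>Both \<open>\<Delta>(-1/z)\<close> and \<open>z\<^sup>1\<^sup>2 \<Delta>(z)\<close> solve \<open>D\<^sub>1\<^sub>2 = 0\<close>, and they agree at \<open>z = \<i>\<close>.\<close>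
lemma Delta_Mk: "Delta \<in> Mk 12"
proof (rule MkI[OF _ Delta_qser0])
  note hol = qser_holomorphic[OF Delta_qser0]
  define f where "f z = Delta (- (1 / z)) - z ^ 12 * Delta z" for z
  have "(\<lambda>z. Delta (moeb Smat z)) holomorphic_on uhp"
    using holomorphic_on_compose_gen[OF moeb_holomorphic[OF Smat_SL2Z] hol] moeb_in_uhp[OF Smat_SL2Z]
    by (auto simp: o_def)
  then have S_hol: "(\<lambda>z. Delta (- (1 / z))) holomorphic_on uhp" by (simp add: moeb_Smat)
  then have f_hol: "f holomorphic_on uhp"
    unfolding f_def[abs_def] by (intro holomorphic_intros hol)
  have ode: "qder f z = (12 / (2 * of_real pi * \<i> * z) - 12 * Pfun z) * f z" if z: "z \<in> uhp" for z
  proof -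
    have "qder Delta (- (1 / z)) / z\<^sup>2 = qder (\<lambda>z. Delta (- (1 / z))) z"
      using qder_comp_moeb[OF hol Smat_SL2Z z] by (simp add: moeb_Smat jfac_Smat)
    moreover have "Pfun (- (1 / z)) = z\<^sup>2 * Pfun z - z / (2 * of_real pi * \<i>)"
      using Pfun_moeb[OF Smat_SL2Z z] by (simp add: moeb_Smat jfac_Smat ent_Smat)
    ultimately have "qder (\<lambda>z. Delta (- (1 / z))) z = - 12 * (z\<^sup>2 * Pfun z - z / (2 * of_real pi * \<i>)) / z\<^sup>2 * Delta (- (1 / z))"
      using qder_Delta[OF moeb_uhp_S[OF z]] by simp
    also have "- 12 * (z\<^sup>2 * p - z / K) / z\<^sup>2 = 12 / (K * z) - 12 * p" for p K :: complex
      using uhp_nonzero[OF z] by (cases "K = 0") (simp_all add: field_simps power2_eq_square)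
    finally have 1: "qder (\<lambda>z. Delta (- (1 / z))) z = (12 / (2 * of_real pi * \<i> * z) - 12 * Pfun z) * Delta (- (1 / z))" .
    have "qder (\<lambda>z. z ^ 12 * Delta z) z = 12 * z ^ 11 / (2 * of_real pi * \<i>) * Delta z + z ^ 12 * qder Delta z"
      by (rule qder_eqI) (auto intro!: derivative_eq_intros has_field_derivative_qder[OF hol z] simp: field_simps)
    also have "12 * z ^ 11 / K * Delta z + z ^ 12 * qder Delta z = (12 / (K * z) - 12 * Pfun z) * (z ^ 12 * Delta z)" for K
      unfolding qder_Delta[OF z] using uhp_nonzero[OF z]
      by (cases "K = 0") (simp_all add: field_simps power_numeral_reduce)
    finally have 2: "qder (\<lambda>z. z ^ 12 * Delta z) z = (12 / (2 * of_real pi * \<i> * z) - 12 * Pfun z) * (z ^ 12 * Delta z)" .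
    have "qder f z = qder (\<lambda>z. Delta (- (1 / z))) z - qder (\<lambda>z. z ^ 12 * Delta z) z"
      unfolding f_def by (intro qder_diff holomorphic_intros S_hol hol z)
    then show ?thesis unfolding 1 2 by (simp add: f_def algebra_simps)
  qed
  have "(\<i>::complex) ^ 12 = 1" by (simp add: power_numeral_reduce)
  then have fi: "f \<i> = 0" by (simp add: f_def divide_i)
  have hol': "(\<lambda>z. 12 / (2 * of_real pi * \<i> * z) - 12 * Pfun z) holomorphic_on uhp"
    using uhp_nonzero by (intro holomorphic_intros Pfun_holomorphic) auto
  have "f z = 0" if "z \<in> uhp" for z
    by (rule linear_ode_zero[OF f_hol hol' ode i_in_uhp fi that])
  then show "Delta (- (1 / z)) = z powi 12 * Delta z" if "z \<in> uhp" for z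
    using that by (simp add: f_def)
qed (simp add: Delta_def)

text \<open>The product of \<open>f ^ 12\<close> and \<open>Delta ^ n\<close> with
  \<open>n = -w\<close> has weight 0 and vanishes at the cusp, hence is 0; and \<open>Delta\<close>
  has no zeros.\<close>

lemma Mk_neg:
  assumes f: "f \<in> Mk w" and w: "w < 0"
  shows "f z = 0"
proof (cases "z \<in> uhp")
  case True
  define n where "n = nat (- w)"
  have n: "n > 0" "of_nat n = - w" using w by (simp_all add: n_def)
  obtain \<phi> where \<phi>: "qser 0 \<phi> f" using Mk_qser[OF f] .
  define h where "h z = (Mone z * f z ^ 12) * (Mone z * Delta z ^ n)" for z
  have "h \<in> Mk 0"
    using Mk_mult[OF Mk_power[OF f, of 12] Mk_power[OF Delta_Mk, of n]] n by (simp add: h_def[abs_def])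
  moreover have "qser 0 (\<lambda>q. (1 * \<phi> q ^ 12) * (1 * (q * euler_prod q ^ 24) ^ n)) h"
    unfolding h_def[abs_def]
    using qser_power[OF \<phi>, of 12] qser_power[OF Delta_qser0, of n] by (intro qser_mult0 Mone_qser) auto
  ultimately have "h z = 0" using Mk_0_constant[OF _ _ True] n by force
  then show ?thesis using True Delta_nonzero[OF True] by (simp add: h_def Mone_def)
qed (use f Mk_off in auto)

text \<open>\<open>Delta\<close> is q times a zero-free series and has no zeros in the half-plane,
  so the quotient is holomorphic everywhere, including the cusp.\<close>

lemma Mk_cusp:
  assumes f: "f \<in> Mk w" and \<phi>: "qser 0 \<phi> f" "\<phi> 0 = 0"
  obtains g where "g \<in> Mk (w - 12)" "\<And>z. f z = Delta z * g z"
proof -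
  obtain \<psi> where \<psi>: "qser 1 \<psi> f" using qser_shift[OF \<phi>] by auto
  define g where "g z = f z / Delta z" for z
  have "qser (1 - 1) (\<lambda>q. \<psi> q / euler_prod q ^ 24) g"
    unfolding g_def[abs_def] by (rule qser_divide[OF \<psi> Delta_qser]) (simp add: euler_prod_nonzero)
  then have g: "qser 0 (\<lambda>q. \<psi> q / euler_prod q ^ 24) g" by simp
  show ?thesis
  proof (rule that)
    show "g \<in> Mk (w - 12)"
    proof (rule MkI[OF _ g])
      fix z assume z: "z \<in> uhp"
      show "g (- (1 / z)) = z powi (w - 12) * g z"
        unfolding g_def Mk_S[OF f z] Mk_S[OF Delta_Mk z] using uhp_nonzero[OF z] by (simp add: power_int_diff)
    qed (simp add: g_def Mk_off[OF f])
    show "f z = Delta z * g z" for z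
      using Delta_nonzero[of z] Mk_off[OF f, of z] by (cases "z \<in> uhp") (auto simp: g_def)
  qed
qed

lemma Mk_cusp_decomp:
  assumes f: "f \<in> Mk w" and E: "E \<in> Mk w" "qser 0 \<epsilon> E" "\<epsilon> 0 = 1"
  obtains a g where "g \<in> Mk (w - 12)" "\<And>z. f z = a * E z + Delta z * g z"
proof -
  obtain \<phi> where \<phi>: "qser 0 \<phi> f" using Mk_qser[OF f] .
  have "qser 0 (\<lambda>q. \<phi> q - \<phi> 0 * \<epsilon> q) (\<lambda>z. f z - \<phi> 0 * E z)"
    by (intro qser_diff qser_cmult \<phi> E)
  from Mk_cusp[OF Mk_diff[OF f Mk_cmult[OF E(1)]] this]
  obtain g where g: "g \<in> Mk (w - 12)" "\<And>z. f z - \<phi> 0 * E z = Delta z * g z"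
    using E(3) by auto
  show ?thesis by (rule that[OF g(1), of "\<phi> 0"]) (simp add: g(2)[symmetric])
qed

lemma Mk_4: "f \<in> Mk 4 \<Longrightarrow> \<exists>a. \<forall>z. f z = a * E4 z"
proof -
  assume f: "f \<in> Mk 4"
  obtain \<epsilon> where "qser 0 \<epsilon> E4" "\<epsilon> 0 = 1" using E4_qser .
  from Mk_cusp_decomp[OF f E4_Mk this] obtain a g where
    "g \<in> Mk (4 - 12)" "\<And>z. f z = a * E4 z + Delta z * g z" by metis
  then show ?thesis using Mk_neg[of g] by (intro exI[of _ a]) auto
qed

text \<open>If \<open>f\<close> does not vanish at \<open>\<infinity>\<close>, then \<open>D\<^sub>2 f\<close> is a multiple of \<open>f\<^sup>2\<close>, since both have weight 4; as
  \<open>f(\<i>) = 0\<close>, this linear differential equation forces \<open>f = 0\<close>.\<close>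
lemma Mk_2:
  assumes f: "f \<in> Mk 2"
  shows "f z = 0"
proof (cases "z \<in> uhp")
  case True
  obtain \<phi> where \<phi>: "qser 0 \<phi> f" using Mk_qser[OF f] .
  show ?thesis
  proof (cases "\<phi> 0 = 0")
    case True
    from Mk_cusp[OF f \<phi> this] obtain g where "g \<in> Mk (2 - 12)" "\<And>z. f z = Delta z * g z" by blast
    then show ?thesis using Mk_neg[of g] by simp
  next
    case False
    obtain \<epsilon> where \<epsilon>: "qser 0 \<epsilon> E4" "\<epsilon> 0 = 1" using E4_qser .
    have "(\<lambda>z. f z * f z) \<in> Mk 4" using Mk_mult[OF f f] by simp
    from Mk_4[OF this] obtain a where a: "\<And>z. f z * f z = a * E4 z" by blast
    have "\<phi> 0 * \<phi> 0 = a * \<epsilon> 0"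
      by (rule qser_eq_imp_value_eq[OF qser_mult0[OF \<phi> \<phi>] qser_cmult[OF \<epsilon>(1)]]) (rule a)
    then have a0: "a \<noteq> 0" using \<epsilon> False by auto
    have "Dsc 2 f \<in> Mk 4" using Dsc_Mk[OF f] by simp
    from Mk_4[OF this] obtain b where b: "\<And>z. Dsc 2 f z = b * E4 z" by blast
    have ode: "qder f z = (b / a * f z - 2 * Pfun z) * f z" if z: "z \<in> uhp" for z
    proof -
      have "E4 z = f z * f z / a" using a[of z] a0 by simp
      then show ?thesis using b[of z] Dsc_eq[OF z, of 2 f] by (simp add: algebra_simps)
    qed
    have "f \<i> = f (- (1 / \<i>))" by (simp add: divide_i)
    also have "\<dots> = - f \<i>" using Mk_S[OF f i_in_uhp] by simp
    finally have fi: "f \<i> = 0" by simp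
    have hol:  "(\<lambda>z. b / a * f z - 2 * Pfun z) holomorphic_on uhp"
      by (intro holomorphic_intros Mk_holomorphic[OF f] Pfun_holomorphic)
    show ?thesis
      by (rule linear_ode_zero[OF Mk_holomorphic[OF f] hol ode i_in_uhp fi \<open>z \<in> uhp\<close>])
  qed
qed (use f Mk_off in auto)

text \<open>A monomial of weight \<open>2 v\<close> with constant term 1, containing
  \<open>E6\<close> at most once. At \<open>v = 1\<close> truncated subtraction makes it
  \<open>E6\<close>, of the wrong weight, so that value is excluded in
  \<open>Eis_Mk\<close>.\<close>

definition Eis :: "nat \<Rightarrow> complex \<Rightarrow> complex" where
  "Eis v z = (if even v then Mone z * E4 z ^ (v div 2) else E6 z * (Mone z * E4 z ^ ((v - 3) div 2)))"

lemma Eis_Mk: "v \<noteq> 1 \<Longrightarrow> Eis v \<in> Mk (2 * int v)"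
proof (cases "even v")
  case True
  then show ?thesis using Mk_power[OF E4_Mk, of "v div 2"] unfolding Eis_def[abs_def] by (auto elim!: evenE simp: mult.commute)
next
  case False
  moreover assume "v \<noteq> 1"
  ultimately obtain k where "v = 2 * k + 1" "k \<noteq> 0" by (auto elim!: oddE)
  then obtain u where u: "v = 2 * u + 3" by (cases k) auto
  then show ?thesis using Mk_mult[OF E6_Mk Mk_power[OF E4_Mk, of u]] unfolding Eis_def[abs_def] by (simp add: algebra_simps)
qed

lemma Eis_qser: obtains \<phi> where "qser 0 \<phi> (Eis v)" "\<phi> 0 = 1"
proof -
  obtain a where a: "qser 0 a E4" "a 0 = 1" using E4_qser .
  obtain b where b: "qser 0 b E6" "b 0 = 1" using E6_qser .
  have E4p: "qser 0 (\<lambda>q. 1 * a q ^ n) (\<lambda>z. Mone z * E4 z ^ n)" for n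
    using qser_power[OF a(1), of n] by (intro qser_mult0 Mone_qser) simp
  show ?thesis
  proof (cases "even v")
    case True
    then show ?thesis using that[of "\<lambda>q. 1 * a q ^ (v div 2)"] E4p a unfolding Eis_def[abs_def] by simp
  next
    case False
    then show ?thesis using that[OF qser_cong[OF qser_mult0[OF b(1) E4p[of "(v - 3) div 2"]]]] a b
      by (simp add: Eis_def)
  qed
qed

definition Mbasis :: "nat \<Rightarrow> nat \<Rightarrow> complex \<Rightarrow> complex" where
  "Mbasis v i z = Delta z ^ i * Eis (v - 6 * i) z"

lemma sum_Mindex_rec:
  assumes "v \<ge> 6"
  shows "(\<Sum>i\<in>Mindex v. c i * Mbasis v i z) = c 0 * Eis v z + Delta z * (\<Sum>i\<in>Mindex (v - 6). c (Suc i) * Mbasis (v - 6) i z)"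
proof -
  have "(\<Sum>i\<in>Mindex v. c i * Mbasis v i z) = c 0 * Mbasis v 0 z + (\<Sum>i\<in>Suc ` Mindex (v - 6). c i * Mbasis v i z)"
    unfolding Mindex_rec[OF assms] by (subst sum.insert) (auto simp: finite_Mindex)
  also have "(\<Sum>i\<in>Suc ` Mindex (v - 6). c i * Mbasis v i z) = (\<Sum>i\<in>Mindex (v - 6). c (Suc i) * Mbasis v (Suc i) z)"
    by (subst sum.reindex) auto
  finally show ?thesis
    by (simp add: Mbasis_def sum_distrib_left mult_ac)
qed

lemma Mbasis_Mk: "i \<in> Mindex v \<Longrightarrow> Mbasis v i \<in> Mk (2 * int v)"
proof -
  assume i: "i \<in> Mindex v"
  then have "(\<lambda>z. (Mone z * Delta z ^ i) * Eis (v - 6 * i) z) \<in> Mk (of_nat i * 12 + 2 * int (v - 6 * i))"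
    by (intro Mk_mult Mk_power Delta_Mk Eis_Mk) (auto simp: Mindex_def)
  moreover have "(Mone z * Delta z ^ i) * Eis (v - 6 * i) z = Mbasis v i z" for z
    by (auto simp: Mbasis_def Mone_def Eis_def E6_def Dsc_off)
  moreover have "of_nat i * 12 + 2 * int (v - 6 * i) = 2 * int v" using i by (auto simp: Mindex_def of_nat_diff)
  ultimately show ?thesis by simp
qed

text \<open>Removing a multiple of \<open>Eis v\<close> leaves a cusp form, and dividing by
  \<open>Delta\<close> lowers \<open>v\<close> by 6. Below 6 the quotient has negative weight and
  vanishes.\<close>

lemma Mk_span:
  assumes "f \<in> Mk (2 * int v)"
  shows "\<exists>c. \<forall>z. f z = (\<Sum>i\<in>Mindex v. c i * Mbasis v i z)"
  using assms
proof (induction v arbitrary: f rule: less_induct)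
  case (less v)
  show ?case
  proof (cases "v = 1")
    case True
    then show ?thesis using Mk_2 less.prems by (simp add: Mindex_small)
  next
    case False
    obtain \<epsilon> where \<epsilon>: "qser 0 \<epsilon> (Eis v)" "\<epsilon> 0 = 1" using Eis_qser .
    from Mk_cusp_decomp[OF less.prems Eis_Mk[OF False] \<epsilon>]
    obtain a g where g: "g \<in> Mk (2 * int v - 12)" and a: "\<And>z. f z = a * Eis v z + Delta z * g z" by metis
    show ?thesis
    proof (cases "v < 6")
      case True
      then show ?thesis using a Mk_neg[OF g] False
        by (intro exI[of _ "\<lambda>_. a"]) (auto simp: Mindex_small Mbasis_def)
    next
      case v: False
      have "g \<in> Mk (2 * int (v - 6))" using g v by (simp add: of_nat_diff algebra_simps)
      then obtain c where c: "\<forall>z. g z = (\<Sum>i\<in>Mindex (v - 6). c i * Mbasis (v - 6) i z)"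
        using less.IH[of "v - 6" g] v by auto
      show ?thesis
        using v a c by (intro exI[of _ "case_nat a c"]) (simp add: sum_Mindex_rec)
    qed
  qed
qed

text \<open>The constant term sees only the summand without \<open>Delta\<close>, so
  \<open>c 0 = 0\<close>; the rest is divisible by \<open>Delta\<close> and the induction applies to
  the quotient.\<close>

lemma Mbasis_independent:
  assumes "\<And>z. z \<in> uhp \<Longrightarrow> (\<Sum>i\<in>Mindex v. c i * Mbasis v i z) = 0" "i \<in> Mindex v"
  shows "c i = 0"
  using assms
proof (induction v arbitrary: c i rule: less_induct)
  case (less v)
  obtain \<epsilon> where \<epsilon>: "qser 0 \<epsilon> (Eis v)" "\<epsilon> 0 = 1" using Eis_qser .
  show ?case
  proof (cases "v < 6")
    case True
    then have "v \<noteq> 1" "i = 0" using less.prems(2) by (auto simp: Mindex_small split: if_splits)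
    then have "c 0 * Eis v z = 0" if "z \<in> uhp" for z
      using less.prems(1)[OF that] True by (simp add: Mindex_small Mbasis_def)
    then have "c 0 * \<epsilon> 0 = 0" by (intro qser_eq_imp_value_eq[OF qser_cmult[OF \<epsilon>(1)] qser_const])
    then show ?thesis using \<epsilon> \<open>i = 0\<close> by simp
  next
    case False
    then have v: "v \<ge> 6" by simp
    define g where "g z = (\<Sum>i\<in>Mindex (v - 6). c (Suc i) * Mbasis (v - 6) i z)" for z
    have "g \<in> Mk (2 * int (v - 6))" unfolding g_def[abs_def] by (intro Mk_sum Mk_cmult Mbasis_Mk)
    then obtain \<gamma> where \<gamma>: "qser 0 \<gamma> g" using Mk_qser by blast
    have eq: "c 0 * Eis v z + Delta z * g z = 0" if "z \<in> uhp" for z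
      using less.prems(1)[OF that] unfolding sum_Mindex_rec[OF v] g_def .
    have "c 0 * \<epsilon> 0 + (0 * euler_prod 0 ^ 24) * \<gamma> 0 = 0"
      using qser_eq_imp_value_eq[OF qser_add[OF qser_cmult[OF \<epsilon>(1)] qser_mult0[OF Delta_qser0 \<gamma>]] qser_const] eq by blast
    then have c0: "c 0 = 0" using \<epsilon> by simp
    have "g z = 0" if "z \<in> uhp" for z using eq[OF that] c0 Delta_nonzero[OF that] by simp
    then have "c (Suc j) = 0" if "j \<in> Mindex (v - 6)" for j
      using less.IH[of "v - 6" "\<lambda>i. c (Suc i)" j] v that by (simp add: g_def)
    then show ?thesis using less.prems(2) c0 unfolding Mindex_rec[OF v] by auto
  qed
qed

end

section \<open>Determinants of matrices of functions\<close>

lemma has_field_derivative_det: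
  fixes A :: "'a::real_normed_field \<Rightarrow> 'a^'n^'n"
  assumes "\<And>i j. ((\<lambda>z. A z $ i $ j) has_field_derivative A' $ i $ j) (at z)"
  shows "((\<lambda>z. det (A z)) has_field_derivative (\<Sum>i\<in>UNIV. det (\<chi> r. if r = i then A' $ r else A z $ r))) (at z)"
proof -
  have "((\<lambda>z. det (A z)) has_field_derivative
      (\<Sum>p | p permutes UNIV. of_int (sign p) * (\<Sum>i\<in>UNIV. A' $ i $ p i * (\<Prod>r\<in>UNIV - {i}. A z $ r $ p r)))) (at z)"
    unfolding det_def by (intro DERIV_sum DERIV_cmult has_field_derivative_prod assms)
  also have "(\<Sum>p | p permutes UNIV. of_int (sign p) * (\<Sum>i\<in>UNIV. A' $ i $ p i * (\<Prod>r\<in>UNIV - {i}. A z $ r $ p r)))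
     = (\<Sum>i\<in>UNIV. \<Sum>p | p permutes UNIV. of_int (sign p) * (A' $ i $ p i * (\<Prod>r\<in>UNIV - {i}. A z $ r $ p r)))"
    unfolding sum_distrib_left by (rule sum.swap)
  also have "\<dots> = (\<Sum>i\<in>UNIV. det (\<chi> r. if r = i then A' $ r else A z $ r))"
  proof (intro sum.cong refl)
    fix i :: 'n
    have "A' $ i $ p i * (\<Prod>r\<in>UNIV - {i}. A z $ r $ p r) = (\<Prod>r\<in>UNIV. (\<chi> r. if r = i then A' $ r else A z $ r) $ r $ p r)" for p
      by (subst prod.remove[of UNIV i]) (auto intro!: prod.cong)
    then show "(\<Sum>p | p permutes UNIV. of_int (sign p) * (A' $ i $ p i * (\<Prod>r\<in>UNIV - {i}. A z $ r $ p r))) =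
        det (\<chi> r. if r = i then A' $ r else A z $ r)"
      unfolding det_def by simp
  qed
  finally show ?thesis .
qed

text \<open>Liouville's formula. Replacing row i by row i of the product and expanding it over the
  rows of \<open>A z\<close>, all terms but one repeat a row, and the remaining one is the diagonal
  entry of \<open>C\<close> times the determinant.\<close>

lemma has_field_derivative_det_linear_system:
  fixes A :: "'a::real_normed_field \<Rightarrow> 'a^'n^'n"
  assumes "\<And>i j. ((\<lambda>z. A z $ i $ j) has_field_derivative (C ** A z) $ i $ j) (at z)"
  shows "((\<lambda>z. det (A z)) has_field_derivative trace C * det (A z)) (at z)"
proof -
  have "det (\<chi> r. if r = i then (C ** A z) $ r else A z $ r) = C $ i $ i * det (A z)" for i
  proof -
    have row: "(C ** A z) $ r = (\<Sum>l\<in>UNIV. C $ r $ l *s A z $ l)" for r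
      by (simp add: vec_eq_iff matrix_matrix_mult_def sum_component)
    have "det (\<chi> r. if r = i then (C ** A z) $ r else A z $ r)
        = (\<Sum>l\<in>UNIV. det (\<chi> r. if r = i then C $ r $ l *s A z $ l else A z $ r))"
      unfolding row by (rule det_linear_row_sum) simp
    also have "\<dots> = (\<Sum>l\<in>UNIV. if l = i then C $ i $ i * det (A z) else 0)"
    proof (intro sum.cong refl)
      fix l
      have "det (\<chi> r. if r = i then C $ r $ l *s A z $ l else A z $ r)
          = det (\<chi> r. if r = i then C $ i $ l *s A z $ l else A z $ r)"
        by (rule arg_cong[of _ _ det]) (simp add: vec_eq_iff)
      also have "\<dots> = C $ i $ l * det (\<chi> r. if r = i then A z $ l else A z $ r)"
        by (rule det_row_mul)
      also have "det (\<chi> r. if r = i then A z $ l else A z $ r) = (if l = i then det (A z) else 0)"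
      proof (cases "l = i")
        case True
        then show ?thesis by (auto intro!: arg_cong[of _ _ det] simp: vec_eq_iff)
      next
        case False
        then show ?thesis by (auto intro!: det_identical_rows[of i l] simp: row_def vec_eq_iff)
      qed
      finally show "det (\<chi> r. if r = i then C $ r $ l *s A z $ l else A z $ r) =
          (if l = i then C $ i $ i * det (A z) else 0)" by simp
    qed
    finally show ?thesis by simp
  qed
  then show ?thesis
    using has_field_derivative_det[of A "C ** A z" z, OF assms] by (simp add: trace_def sum_distrib_right)
qed

text \<open>The exponent depends on the row alone, so every term of the Leibniz formula has the same
  total exponent.\<close>

lemma qser_det:
  assumes "\<And>i j. qser (l i) (\<phi> i j) (\<lambda>z. A z $ i $ j)"
  shows "qser (\<Sum>i\<in>UNIV. l i) (\<lambda>q. det (\<chi> i j. \<phi> i j q)) (\<lambda>z. det (A z))"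
  unfolding det_def by (intro qser_sum qser_cmult) (auto intro!: qser_prod assms)

lemma holomorphic_on_det:
  assumes "\<And>i j. (\<lambda>z. A z $ i $ j) holomorphic_on S"
  shows "(\<lambda>z. det (A z)) holomorphic_on S"
  unfolding det_def by (intro holomorphic_intros assms)

section \<open>Triangularity of iterated first order operators\<close>

text \<open>The coefficients of \<open>qder\<^sup>l h\<close> in \<open>u\<^sub>n\<close>, where \<open>u\<^sub>0 = c h\<close> and \<open>u\<^sub>n\<^sub>+\<^sub>1 = \<alpha> qder u\<^sub>n + \<beta>\<^sub>n u\<^sub>n\<close>.\<close>
fun opcoeff :: "(complex \<Rightarrow> complex) \<Rightarrow> (nat \<Rightarrow> complex \<Rightarrow> complex) \<Rightarrow> (complex \<Rightarrow> complex) \<Rightarrow>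
    nat \<Rightarrow> nat \<Rightarrow> complex \<Rightarrow> complex" where
  "opcoeff \<alpha> \<beta> c 0 l = (\<lambda>z. if l = 0 then c z else 0)"
| "opcoeff \<alpha> \<beta> c (Suc n) l = (\<lambda>z. \<alpha> z * (qder (opcoeff \<alpha> \<beta> c n l) z
      + (case l of 0 \<Rightarrow> 0 | Suc l' \<Rightarrow> opcoeff \<alpha> \<beta> c n l' z)) + \<beta> n z * opcoeff \<alpha> \<beta> c n l z)"

lemma opcoeff_above: "n < l \<Longrightarrow> opcoeff \<alpha> \<beta> c n l = (\<lambda>z. 0)"
proof (induction n arbitrary: l)
  case (Suc n)
  then obtain l' where "l = Suc l'" "n < l'" by (cases l) auto
  then have "opcoeff \<alpha> \<beta> c n l = (\<lambda>z. 0)" "opcoeff \<alpha> \<beta> c n l' = (\<lambda>z. 0)"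
    using Suc.IH by auto
  then show ?case using \<open>l = Suc l'\<close> by (simp add: qder_const)
qed auto

lemma opcoeff_diag: "opcoeff \<alpha> \<beta> c n n z = \<alpha> z ^ n * c z"
  by (induction n arbitrary: z) (auto simp: opcoeff_above qder_const)

lemma funpow_qder_holomorphic: "f holomorphic_on uhp \<Longrightarrow> (qder ^^ n) f holomorphic_on uhp"
  by (induction n) (auto intro: qder_holomorphic)

context
  fixes \<alpha> c :: "complex \<Rightarrow> complex" and \<beta> :: "nat \<Rightarrow> complex \<Rightarrow> complex"
  assumes \<alpha>: "\<alpha> holomorphic_on uhp" and \<beta>: "\<And>n. \<beta> n holomorphic_on uhp" and c: "c holomorphic_on uhp"
begin

lemma opcoeff_holomorphic: "opcoeff \<alpha> \<beta> c n l holomorphic_on uhp"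
proof (induction n arbitrary: l)
  case 0
  then show ?case using c by (cases "l = 0") (auto intro!: holomorphic_intros)
next
  case (Suc n)
  then show ?case using \<alpha> \<beta> by (cases l) (auto intro!: holomorphic_intros)
qed

lemma opcoeff_expansion:
  assumes h: "h holomorphic_on uhp" and u: "\<And>n. u n holomorphic_on uhp"
    and u0: "\<And>z. z \<in> uhp \<Longrightarrow> u 0 z = c z * h z"
    and uS: "\<And>n z. z \<in> uhp \<Longrightarrow> u (Suc n) z = \<alpha> z * qder (u n) z + \<beta> n z * u n z"
    and "n < N" "z \<in> uhp"
  shows "u n z = (\<Sum>l<N. opcoeff \<alpha> \<beta> c n l z * (qder ^^ l) h z)"
  using assms(5,6)
proof (induction n arbitrary: z)
  case 0
  then have "(\<Sum>l<N. opcoeff \<alpha> \<beta> c 0 l z * (qder ^^ l) h z) = (\<Sum>l<N. if l = 0 then c z * h z else 0)"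
    by (intro sum.cong) auto
  then show ?case using u0[OF 0(2)] 0(1) by (simp add: sum.delta)
next
  case (Suc n)
  note z = Suc.prems(2)
  obtain N' where N: "N = Suc N'" using Suc.prems(1) by (cases N) auto
  let ?c = "opcoeff \<alpha> \<beta> c n"
  have "qder (u n) z = qder (\<lambda>z. \<Sum>l<N. ?c l z * (qder ^^ l) h z) z"
    using Suc.IH Suc.prems(1) by (intro qder_cong z) auto
  also have "\<dots> = (\<Sum>l<N. qder (\<lambda>z. ?c l z * (qder ^^ l) h z) z)"
    by (intro qder_sum z holomorphic_intros opcoeff_holomorphic funpow_qder_holomorphic h)
  also have "\<dots> = (\<Sum>l<N. qder (?c l) z * (qder ^^ l) h z + ?c l z * (qder ^^ Suc l) h z)"
    by (intro sum.cong refl) (simp add: qder_mult opcoeff_holomorphic funpow_qder_holomorphic h z)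
  also have "\<dots> = (\<Sum>l<N. qder (?c l) z * (qder ^^ l) h z) + (\<Sum>l<N. ?c l z * (qder ^^ Suc l) h z)"
    by (rule sum.distrib)
  also have "(\<Sum>l<N. ?c l z * (qder ^^ Suc l) h z) = (\<Sum>l<N. (case l of 0 \<Rightarrow> 0 | Suc l' \<Rightarrow> ?c l' z) * (qder ^^ l) h z)"
  proof -
    \<comment> \<open>The sum keeps a fixed length \<open>N\<close> so that all orders share one
      coefficient matrix. The shift in \<open>l\<close> would overflow at the last index, where the
      coefficient vanishes by triangularity.\<close>
    have "?c N' = (\<lambda>z. 0)" using Suc.prems(1) N by (intro opcoeff_above) simp
    then show ?thesis
      unfolding N by (subst sum.lessThan_Suc_shift[where n = N']) simp
  qed
  finally have "\<alpha> z * qder (u n) z + \<beta> n z * u n z =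
      (\<Sum>l<N. opcoeff \<alpha> \<beta> c (Suc n) l z * (qder ^^ l) h z)"
    using Suc.IH[OF _ z] Suc.prems(1)
    by (simp add: sum_distrib_left sum.distrib[symmetric] algebra_simps)
  then show ?case using uS[OF z] by simp
qed

end

text \<open>Numbering of the four columns compatible with the order of the type \<open>4\<close>, in which \<open>4 = 0\<close>.\<close>
definition idx :: "4 \<Rightarrow> nat" where
  "idx j = (if j = 1 then 1 else if j = 2 then 2 else if j = 3 then 3 else 0)"

lemma idx_simps [simp]: "idx 1 = 1" "idx 2 = 2" "idx 3 = 3" "idx 4 = 0"
  by (simp_all add: idx_def)

lemma idx_less_iff: "idx i < idx j \<longleftrightarrow> i < j"
  using exhaust_4[of i] exhaust_4[of j] unfolding idx_def
  by (auto simp: less_bit0_def bit0.Rep_1 bit0.Rep_numeral)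

lemma idx_less_4: "idx j < 4"
  by (simp add: idx_def)

lemma idx_eq_iff [simp]: "idx i = idx j \<longleftrightarrow> i = j"
  using exhaust_4[of i] exhaust_4[of j] by auto

lemma bij_betw_idx: "bij_betw idx UNIV {..<4}"
proof -
  have "inj idx" by (simp add: inj_def)
  moreover have "idx ` UNIV = {..<4}"
    unfolding UNIV_4 by (auto simp: idx_def)
  ultimately show ?thesis by (simp add: bij_betw_def)
qed

lemma sum_idx: "(\<Sum>j\<in>UNIV. f (idx j)) = (\<Sum>l<4. f l)"
  by (rule sum.reindex_bij_betw[OF bij_betw_idx])

lemma ex_idx: "l < 4 \<Longrightarrow> \<exists>j. l = idx j"
  using bij_betw_idx unfolding bij_betw_def by (metis imageE lessThan_iff)

text \<open>A kernel vector lists the coefficients of a polynomial of degree at most 3 with four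
  distinct roots. Its constant coefficient is \<open>c$4\<close>, since column 4 carries the power
  0.\<close>

lemma vandermonde_det_nonzero:
  fixes x :: "4 \<Rightarrow> complex"
  assumes "inj x"
  shows "det (\<chi> i j. x i ^ idx j) \<noteq> 0"
proof -
  let ?V = "(\<chi> i j. x i ^ idx j) :: complex^4^4"
  have "c = 0" if "?V *v c = 0" for c
  proof -
    define p where "p = [:c$4, c$1, c$2, c$3:]"
    have "poly p (x i) = (?V *v c) $ i" for i
      by (simp add: p_def matrix_vector_mult_def sum_4 power2_eq_square power3_eq_cube algebra_simps)
    then have roots: "range x \<subseteq> {t. poly p t = 0}" using that by auto
    have "p = 0"
    proof (rule ccontr)
      assume p: "p \<noteq> 0"
      have "card (range x) \<le> card {t. poly p t = 0}"
        using roots poly_roots_finite[OF p] by (intro card_mono)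
      also have "\<dots> \<le> degree p" by (rule card_poly_roots_bound[OF p])
      also have "\<dots> \<le> 3" by (simp add: p_def)
      finally show False using card_image[OF assms] by simp
    qed
    then show "c = 0" by (simp add: p_def vec_eq_iff forall_4)
  qed
  then have "invertible ?V"
    using matrix_left_invertible_ker[of ?V] invertible_left_inverse by blast
  then show ?thesis by (simp add: invertible_det_nz)
qed

section \<open>Automorphy factors of real weight\<close>

lemma autf_eq: "autf k g z = jfac g z powr of_real k"
  by (simp add: autf_def jfac_def)

text \<open>The principal branch is harmless: if c is non-zero then cz+d has non-zero imaginary part
  and avoids the cut; if c = 0 the factor is constant, even when d = -1 lies on the cut.\<close>

lemma autf_derivative:
  assumes g: "g \<in> SL2Z" and z: "z \<in> uhp"
  shows "(autf k g has_field_derivative of_real k * ent_c g / jfac g z * autf k g z) (at z)"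
proof (cases "g$2$1 = 0")
  case True
  then have "autf k g = (\<lambda>z. ent_d g powr of_real k)" "ent_c g = 0"
    by (auto simp: autf_def ent_c_def)
  then show ?thesis by (auto intro!: derivative_eq_intros)
next
  case False
  have "Im (jfac g z) = of_int (g$2$1) * Im z" by (simp add: jfac_def ent_c_def ent_d_def)
  then have "jfac g z \<notin> \<real>\<^sub>\<le>\<^sub>0" using False z by (auto simp: complex_nonpos_Reals_iff uhp_def)
  then have "((\<lambda>z. jfac g z powr of_real k) has_field_derivative
      of_real k * jfac g z powr (of_real k - 1) * ent_c g) (at z)"
    by (intro DERIV_chain2[where f = "\<lambda>x. x powr of_real k" and g = "jfac g"] has_field_derivative_powr jfac_has_field_derivative)
  also have "jfac g z powr (of_real k - 1) = jfac g z powr of_real k / jfac g z"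
    using jfac_nonzero[OF g z] by (simp add: powr_diff)
  finally show ?thesis
    unfolding autf_eq[abs_def] by (simp add: field_simps)
qed

lemma autf_holomorphic: "g \<in> SL2Z \<Longrightarrow> autf k g holomorphic_on uhp"
  using autf_derivative holomorphic_on_open[OF open_uhp] by blast

lemma qder_autf:
  assumes "g \<in> SL2Z" "z \<in> uhp"
  shows "qder (autf k g) z = of_real k * ent_c g / (2 * of_real pi * \<i> * jfac g z) * autf k g z"
  by (rule qder_eqI) (use autf_derivative[OF assms, of k] in \<open>simp add: field_simps\<close>)

lemma autf_nonzero: "g \<in> SL2Z \<Longrightarrow> z \<in> uhp \<Longrightarrow> autf k g z \<noteq> 0"
  by (simp add: autf_eq jfac_nonzero)

lemma autf_add_int:
  assumes "g \<in> SL2Z" "z \<in> uhp"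
  shows "autf (k + real_of_int n) g z = jfac g z powi n * autf k g z"
  using jfac_nonzero[OF assms] by (simp add: autf_eq powr_add complex_powr_of_int)

lemma slash_eq_iff:
  assumes "g \<in> SL2Z" "z \<in> uhp" "ups g \<noteq> 0"
  shows "slash k ups F g z = v \<longleftrightarrow> F (moeb g z) = (ups g * autf k g z) *s v"
proof -
  have "ups g * autf k g z \<noteq> 0" using assms autf_nonzero by simp
  then have "(inverse (ups g) * inverse (autf k g z)) *s w = v \<longleftrightarrow> w = (ups g * autf k g z) *s v" for w
    by (auto simp: vec_eq_iff field_simps)
  then show ?thesis by (simp add: slash_def)
qed

section \<open>The Wronskian of an MLDE\<close>

lemma Dscpow_holomorphic: "f holomorphic_on uhp \<Longrightarrow> Dscpow n k f holomorphic_on uhp"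
  by (induction n) (auto intro: Dsc_holomorphic)

lemma qder_Dscpow:
  "z \<in> uhp \<Longrightarrow> qder (Dscpow n k f) z = Dscpow (Suc n) k f z - (of_real k + 2 * of_nat n) * Pfun z * Dscpow n k f z"
  by (simp add: Dsc_eq)

lemma Dscpow_qser_ex: "\<exists>\<phi>. qser l \<phi> f \<Longrightarrow> \<exists>\<phi>. qser l \<phi> (Dscpow n k f)"
proof (induction n)
  case (Suc n)
  then obtain \<phi> where \<phi>: "qser l \<phi> (Dscpow n k f)" by blast
  obtain p where "qser 0 p Pfun" using Pfun_qser by blast
  from Dsc_qser[OF this \<phi>, of "k + 2 * real n"] show ?case by auto
qed simp

lemma Dpow_component: "Dpow n k F z $ i = Dscpow n k (\<lambda>w. F w $ i) z"
proof (induction n arbitrary: z)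
  case (Suc n)
  then show ?case by (simp add: Dvec_def)
qed simp

lemma Dscpow_linear:
  assumes "\<And>i. i \<in> I \<Longrightarrow> f i holomorphic_on uhp"
    and "\<And>z. z \<in> uhp \<Longrightarrow> g z = (\<Sum>i\<in>I. c i * f i z)" and "z \<in> uhp"
  shows "Dscpow n k g z = (\<Sum>i\<in>I. c i * Dscpow n k (f i) z)"
  using assms(3)
proof (induction n arbitrary: z)
  case 0
  then show ?case using assms(2) by simp
next
  case (Suc n)
  have "qder (Dscpow n k g) z = qder (\<lambda>z. \<Sum>i\<in>I. c i * Dscpow n k (f i) z) z"
    using Suc by (intro qder_cong) auto
  also have "\<dots> = (\<Sum>i\<in>I. qder (\<lambda>z. c i * Dscpow n k (f i) z) z)"
    using assms(1) Suc.prems by (intro qder_sum) (auto intro!: holomorphic_intros Dscpow_holomorphic)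
  also have "\<dots> = (\<Sum>i\<in>I. c i * qder (Dscpow n k (f i)) z)"
    using assms(1) Suc.prems by (intro sum.cong refl qder_cmult) (auto intro!: Dscpow_holomorphic)
  finally show ?case
    using Suc.IH[OF Suc.prems] Suc.prems
    by (simp add: Dsc_eq sum_distrib_left sum.distrib algebra_simps)
qed

lemma funpow_qder_linear:
  assumes "\<And>i. i \<in> I \<Longrightarrow> f i holomorphic_on uhp" and "z \<in> uhp"
  shows "(qder ^^ n) (\<lambda>z. \<Sum>i\<in>I. c i * f i z) z = (\<Sum>i\<in>I. c i * (qder ^^ n) (f i) z)"
  using assms(2)
proof (induction n arbitrary: z)
  case (Suc n)
  have "(qder ^^ Suc n) (\<lambda>z. \<Sum>i\<in>I. c i * f i z) z = qder (\<lambda>z. \<Sum>i\<in>I. c i * (qder ^^ n) (f i) z) z"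
    using Suc by (auto intro!: qder_cong)
  also have "\<dots> = (\<Sum>i\<in>I. qder (\<lambda>z. c i * (qder ^^ n) (f i) z) z)"
    using assms(1) Suc.prems by (intro qder_sum) (auto intro!: holomorphic_intros funpow_qder_holomorphic)
  also have "\<dots> = (\<Sum>i\<in>I. c i * qder ((qder ^^ n) (f i)) z)"
    using assms(1) Suc.prems by (intro sum.cong refl qder_cmult) (auto intro!: funpow_qder_holomorphic)
  finally show ?case by simp
qed simp

lemma funpow_qder_qser:
  "qser l \<phi> f \<Longrightarrow> \<exists>\<psi>. qser l \<psi> ((qder ^^ n) f) \<and> \<psi> 0 = of_real l ^ n * \<phi> 0"
proof (induction n)
  case (Suc n)
  then obtain \<psi> where "qser l \<psi> ((qder ^^ n) f)" "\<psi> 0 = of_real l ^ n * \<phi> 0" by blast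
  from qser_qder[OF this(1)] this(2) show ?case
    by (intro exI[of _ "\<lambda>q. of_real l * \<psi> q + q * deriv \<psi> q"]) simp
qed auto

text \<open>Companion matrix of an MLDE with respect to \<open>f, D f, D\<^sup>2 f, D\<^sup>3 f\<close>.\<close>
definition companion :: "real \<Rightarrow> (complex \<Rightarrow> complex) \<Rightarrow> (complex \<Rightarrow> complex) \<Rightarrow> (complex \<Rightarrow> complex)
    \<Rightarrow> complex \<Rightarrow> complex^4^4" where
  "companion k M4 M6 M8 z = (\<chi> i l. (if idx l = Suc (idx i) then 1 else 0)
      - (if l = i then (of_real k + 2 * of_nat (idx i)) * Pfun z else 0)
      - (if i = 3 then (if l = 4 then M8 z else if l = 1 then M6 z else if l = 2 then M4 z else 0) else 0))"

text \<open>The diagonal entries are \<open>-(k + 2 j) P\<close> for j from 0 to 3; the coefficients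
  of the equation stay off the diagonal because the third derivative is absent from it.\<close>

lemma trace_companion: "trace (companion k M4 M6 M8 z) = - (4 * of_real k + 12) * Pfun z"
  by (simp add: trace_def companion_def sum_4 algebra_simps)

lemma qder_mlde_solution:
  assumes f: "f \<in> mlde4_solutions k M4 M6 M8" and z: "z \<in> uhp"
  shows "qder (Dscpow (idx i) k f) z = (\<Sum>l\<in>UNIV. companion k M4 M6 M8 z $ i $ l * Dscpow (idx l) k f z)"
proof -
  have D4: "Dscpow 4 k f z = - M4 z * Dscpow 2 k f z - M6 z * Dscpow 1 k f z - M8 z * f z"
  proof -
    have "mlde4 k M4 M6 M8 f z = 0" using f z by (simp add: mlde4_solutions_def)
    moreover have "Dscpow 4 k f z = mlde4 k M4 M6 M8 f z - M4 z * Dscpow 2 k f z - M6 z * Dscpow 1 k f z - M8 z * f z"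
      by (simp add: mlde4_def del: Dscpow.simps)
    ultimately show ?thesis by simp
  qed
  have D0: "Dscpow 0 k f = f" by simp
  show ?thesis
    using exhaust_4[of i] D4
    by (elim disjE) (simp_all add: qder_Dscpow[OF z] qder_Dscpow[OF z, of 0 k f, unfolded D0] companion_def sum_4 D0 eval_nat_numeral del: Dscpow.simps)
qed

text \<open>D commutes with the constant matrix \<open>rho\<close>, and each component of
  \<open>rho *v G z\<close> is a combination of components of \<open>G\<close>; the square of
  \<open>jfac\<close> raises the weight by 2.\<close>

lemma Dvec_moeb:
  assumes "quasimodular_Pfun" and g: "g \<in> SL2Z"
    and hol: "\<And>i. (\<lambda>z. G z $ i) holomorphic_on uhp"
    and eq: "\<And>z. z \<in> uhp \<Longrightarrow> G (moeb g z) = (u * autf k g z) *s (rho *v G z)"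
    and z: "z \<in> uhp"
  shows "Dvec k G (moeb g z) = (u * autf (k + 2) g z) *s (rho *v Dvec k G z)"
proof -
  interpret quasimodular_Pfun by fact
  have "Dsc k (\<lambda>w. G w $ i) (moeb g z) = u * autf (k + 2) g z * (\<Sum>j\<in>UNIV. rho $ i $ j * Dsc k (\<lambda>w. G w $ j) z)" for i
  proof -
    define h where "h z = (\<Sum>j\<in>UNIV. rho $ i $ j * G z $ j)" for z
    have h: "h holomorphic_on uhp" unfolding h_def by (intro holomorphic_intros hol)
    have "Dsc k (\<lambda>w. G w $ i) (moeb g z) = (jfac g z)\<^sup>2 * (u * autf k g z) * Dsc k h z"
    proof (rule Dsc_moeb[OF g hol h _ _ _ z])
      show "G (moeb g z) $ i = u * autf k g z * h z" if "z \<in> uhp" for z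
        using eq[OF that] by (simp add: h_def matrix_vector_mult_def)
      show "(\<lambda>z. u * autf k g z) holomorphic_on uhp" by (intro holomorphic_intros autf_holomorphic g)
      show "qder (\<lambda>z. u * autf k g z) z = of_real k * ent_c g / (2 * of_real pi * \<i> * jfac g z) * (u * autf k g z)" if "z \<in> uhp" for z
        using qder_cmult[OF autf_holomorphic[OF g] that] qder_autf[OF g that] by simp
    qed
    also have "Dsc k h z = (\<Sum>j\<in>UNIV. rho $ i $ j * Dsc k (\<lambda>w. G w $ j) z)"
      using Dscpow_linear[of UNIV "\<lambda>j w. G w $ j" h "\<lambda>j. rho $ i $ j" z 1 k] hol z by (simp add: h_def)
    also have "(jfac g z)\<^sup>2 * (u * autf k g z) = u * autf (k + 2) g z"
      using autf_add_int[OF g z, of k 2] by simp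
    finally show ?thesis .
  qed
  then show ?thesis by (simp add: vec_eq_iff Dvec_def matrix_vector_mult_def)
qed

locale mlde_system =
  fixes F :: "complex \<Rightarrow> complex^4" and lam :: "4 \<Rightarrow> real" and k :: real
    and ups :: "int^2^2 \<Rightarrow> complex" and rho :: "int^2^2 \<Rightarrow> complex^4^4"
    and M4 M6 M8 :: "complex \<Rightarrow> complex"
  assumes k_eq: "k = 3 * (\<Sum>j\<in>UNIV. lam j) - 3"
    and lam_nonneg: "\<And>j. 0 \<le> lam j" and lam_less_1: "\<And>j. lam j < 1" and lam_inj: "inj lam"
    and ups_nonzero: "\<And>g. g \<in> SL2Z \<Longrightarrow> ups g \<noteq> 0"
    and M4: "M4 \<in> Mk 4" and M6: "M6 \<in> Mk 6" and M8: "M8 \<in> Mk 8"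
    and solution: "\<And>j. (\<lambda>z. F z $ j) \<in> mlde4_solutions k M4 M6 M8"
    and expansion: "\<And>j. \<exists>\<phi>. qser (lam j) \<phi> (\<lambda>z. F z $ j) \<and> \<phi> 0 = 1"
    and F_moeb: "\<And>g z. g \<in> SL2Z \<Longrightarrow> z \<in> uhp \<Longrightarrow> F (moeb g z) = (ups g * autf k g z) *s (rho g *v F z)"
begin

lemma F_holomorphic: "(\<lambda>z. F z $ j) holomorphic_on uhp"
  using solution by (simp add: mlde4_solutions_def)

lemma F_off: "z \<notin> uhp \<Longrightarrow> F z = 0"
  using solution by (simp add: mlde4_solutions_def vec_eq_iff)

text \<open>Distinct non-negative numbers cannot all be 0. Positivity allows division by
  \<open>4 k + 12\<close>, which is 12 times this sum, when P is isolated in the Wronskian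
  identity.\<close>

lemma lam_sum_pos: "(\<Sum>j\<in>UNIV. lam j) > 0"
proof (rule ccontr)
  assume "\<not> ?thesis"
  then have "(\<Sum>j\<in>UNIV. lam j) = 0" using sum_nonneg[of UNIV lam] lam_nonneg by fastforce
  then have "lam 1 = 0" "lam 2 = 0" using lam_nonneg by (simp_all add: sum_nonneg_eq_0_iff)
  then show False using injD[OF lam_inj, of 1 2] by simp
qed

text \<open>Rows are orders of differentiation, so that the companion matrix acts from the
  left.\<close>

definition wmat :: "complex \<Rightarrow> complex^4^4" where
  "wmat z = (\<chi> j i. Dscpow (idx j) k (\<lambda>w. F w $ i) z)"

text \<open>Rows are components of \<open>F\<close>, so that \<open>rho g\<close> acts from the left
  and the cusp exponent depends only on the row.\<close>

definition omat :: "complex \<Rightarrow> complex^4^4" where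
  "omat z = (\<chi> i j. (qder ^^ idx j) (\<lambda>w. F w $ i) z)"

lemma wmat_holomorphic: "(\<lambda>z. wmat z $ j $ i) holomorphic_on uhp"
  by (simp add: wmat_def Dscpow_holomorphic F_holomorphic)

lemma transpose_wmat_mult: "transpose (wmat z) *v v = (\<Sum>j\<in>UNIV. v $ j *s Dpow (idx j) k F z)"
  by (simp add: vec_eq_iff matrix_vector_mult_def transpose_def wmat_def Dpow_component sum_component mult.commute)

text \<open>Each iterate of D equals the iterate of \<open>qder\<close> of the same order plus lower
  ones, so the transition matrix is triangular with diagonal 1.\<close>

lemma det_wmat_eq:
  assumes z: "z \<in> uhp"
  shows "det (wmat z) = det (omat z)"
proof -
  define c where "c = opcoeff (\<lambda>z. 1) (\<lambda>n z. (of_real k + 2 * of_nat n) * Pfun z) (\<lambda>z. 1)"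
  define U :: "complex^4^4" where "U = (\<chi> l j. c (idx j) (idx l) z)"
  have "transpose (wmat z) = omat z ** U"
  proof -
    have "Dscpow (idx j) k (\<lambda>w. F w $ i) z = (\<Sum>l\<in>UNIV. omat z $ i $ l * U $ l $ j)" for i j
    proof -
      have "Dscpow (idx j) k (\<lambda>w. F w $ i) z = (\<Sum>l<4. c (idx j) l z * (qder ^^ l) (\<lambda>w. F w $ i) z)"
        unfolding c_def
        by (rule opcoeff_expansion[where u = "\<lambda>n. Dscpow n k (\<lambda>w. F w $ i)"])
          (auto intro!: holomorphic_intros Pfun_holomorphic F_holomorphic Dscpow_holomorphic simp: z idx_less_4 Dsc_eq)
      also have "\<dots> = (\<Sum>l\<in>UNIV. c (idx j) (idx l) z * (qder ^^ idx l) (\<lambda>w. F w $ i) z)"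
        by (rule sum_idx[symmetric])
      finally show ?thesis by (simp add: omat_def U_def mult.commute)
    qed
    then show ?thesis by (simp add: vec_eq_iff transpose_def wmat_def matrix_matrix_mult_def)
  qed
  then have "det (wmat z) = det (omat z) * det U" using det_mul det_transpose by metis
  also have "det U = (\<Prod>j\<in>UNIV. U $ j $ j)"
    by (rule det_upperdiagonal) (simp add: U_def c_def opcoeff_above idx_less_iff)
  also have "\<dots> = 1" by (simp add: U_def c_def opcoeff_diag)
  finally show ?thesis by simp
qed

text \<open>Only the chain rule enters, no property of P. Pulling back along \<open>g\<close> makes
  the iterated derivatives triangular with diagonal entries \<open>A z\<close> times powers of the
  square of \<open>jfac\<close>; the exponent 12 is 2 (0 + 1 + 2 + 3).\<close>

lemma det_omat_moeb:
  assumes g: "g \<in> SL2Z" and z: "z \<in> uhp"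
  shows "det (omat (moeb g z)) = det (rho g) * ((ups g * autf k g z) ^ 4 * jfac g z ^ 12) * det (omat z)"
proof -
  define A where "A z = ups g * autf k g z" for z
  have A: "A holomorphic_on uhp" unfolding A_def by (intro holomorphic_intros autf_holomorphic g)
  define c where "c = opcoeff (\<lambda>z. (jfac g z)\<^sup>2) (\<lambda>n z. 0) A"
  define U :: "complex^4^4" where "U = (\<chi> l j. c (idx j) (idx l) z)"
  have "omat (moeb g z) = rho g ** omat z ** U"
  proof -
    have "(qder ^^ idx j) (\<lambda>w. F w $ i) (moeb g z) = (\<Sum>l\<in>UNIV. (rho g ** omat z) $ i $ l * U $ l $ j)" for i j
    proof -
      define h where "h z = (\<Sum>m\<in>UNIV. rho g $ i $ m * F z $ m)" for z
      have h: "h holomorphic_on uhp" unfolding h_def by (intro holomorphic_intros F_holomorphic)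
      let ?u = "\<lambda>n z. (qder ^^ n) (\<lambda>w. F w $ i) (moeb g z)"
      have u: "?u n holomorphic_on uhp" for n
        using holomorphic_on_compose_gen[OF moeb_holomorphic[OF g] funpow_qder_holomorphic[OF F_holomorphic]]
          moeb_in_uhp[OF g] by (auto simp: o_def)
      have "?u (idx j) z = (\<Sum>l<4. c (idx j) l z * (qder ^^ l) h z)"
        unfolding c_def
      proof (rule opcoeff_expansion[OF _ _ A h u])
        show "?u 0 z = A z * h z" if "z \<in> uhp" for z
          using F_moeb[OF g that] by (simp add: A_def h_def matrix_vector_mult_def)
        show "?u (Suc n) z = (jfac g z)\<^sup>2 * qder (?u n) z + 0 * ?u n z" if "z \<in> uhp" for n z
          using qder_comp_moeb[OF funpow_qder_holomorphic[OF F_holomorphic] g that, of n i] jfac_nonzero[OF g that]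
          by simp
      qed (auto intro!: holomorphic_intros simp: z idx_less_4)
      also have "\<dots> = (\<Sum>l\<in>UNIV. c (idx j) (idx l) z * (qder ^^ idx l) h z)"
        by (rule sum_idx[symmetric])
      also have "\<dots> = (\<Sum>l\<in>UNIV. (rho g ** omat z) $ i $ l * U $ l $ j)"
        unfolding h_def[abs_def]
        by (intro sum.cong refl, subst funpow_qder_linear)
          (simp_all add: F_holomorphic z U_def omat_def matrix_matrix_mult_def mult.commute)
      finally show ?thesis .
    qed
    then show ?thesis by (simp add: vec_eq_iff omat_def matrix_matrix_mult_def)
  qed
  then have "det (omat (moeb g z)) = det (rho g) * det U * det (omat z)" by (simp add: det_mul)
  also have "det U = (\<Prod>j\<in>UNIV. U $ j $ j)"
    by (rule det_upperdiagonal) (simp add: U_def c_def opcoeff_above idx_less_iff)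
  also have "\<dots> = (\<Prod>j\<in>UNIV. ((jfac g z)\<^sup>2) ^ idx j * A z)"
    by (simp add: U_def c_def opcoeff_diag)
  also have "\<dots> = A z ^ 4 * jfac g z ^ 12"
    unfolding UNIV_4 by (simp add: power_mult[symmetric]) (simp add: power_numeral_reduce)
  finally show ?thesis by (simp add: A_def)
qed

lemma qder_det_wmat:
  assumes z: "z \<in> uhp"
  shows "qder (\<lambda>z. det (wmat z)) z = - (4 * of_real k + 12) * Pfun z * det (wmat z)"
proof (rule qder_eqI)
  let ?K = "2 * of_real pi * \<i>"
  define C :: "complex^4^4" where "C = (\<chi> i l. ?K * companion k M4 M6 M8 z $ i $ l)"
  have "((\<lambda>z. wmat z $ j $ i) has_field_derivative (C ** wmat z) $ j $ i) (at z)" for i j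
  proof -
    have "((\<lambda>z. wmat z $ j $ i) has_field_derivative ?K * qder (\<lambda>z. wmat z $ j $ i) z) (at z)"
      by (rule has_field_derivative_qder[OF wmat_holomorphic z])
    also have "qder (\<lambda>z. wmat z $ j $ i) z = (companion k M4 M6 M8 z ** wmat z) $ j $ i"
      using qder_mlde_solution[OF solution z] by (simp add: wmat_def matrix_matrix_mult_def)
    finally show ?thesis by (simp add: C_def matrix_matrix_mult_def sum_distrib_left mult.assoc)
  qed
  then have "((\<lambda>z. det (wmat z)) has_field_derivative trace C * det (wmat z)) (at z)"
    by (rule has_field_derivative_det_linear_system)
  also have "trace C = ?K * trace (companion k M4 M6 M8 z)"
    by (simp add: trace_def C_def sum_distrib_left)
  finally show "((\<lambda>z. det (wmat z)) has_field_derivative ?K * (- (4 * of_real k + 12) * Pfun z * det (wmat z))) (at z)"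
    by (simp add: trace_companion mult.assoc)
qed

lemma det_wmat_holomorphic: "(\<lambda>z. det (wmat z)) holomorphic_on uhp"
  by (intro holomorphic_on_det wmat_holomorphic)

lemma det_wmat_qser:
  obtains \<omega> where "qser (\<Sum>j\<in>UNIV. lam j) \<omega> (\<lambda>z. det (wmat z))" "\<omega> 0 \<noteq> 0"
proof -
  have "\<exists>\<phi>. qser (lam i) \<phi> (\<lambda>z. omat z $ i $ j) \<and> \<phi> 0 = of_real (lam i) ^ idx j" for i j
    using expansion[of i] funpow_qder_qser[of "lam i" _ "\<lambda>z. F z $ i" "idx j"] by (fastforce simp: omat_def)
  then obtain \<phi> where \<phi>: "\<And>i j. qser (lam i) (\<phi> i j) (\<lambda>z. omat z $ i $ j)" "\<And>i j. \<phi> i j 0 = of_real (lam i) ^ idx j"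
    by metis
  have "qser (\<Sum>j\<in>UNIV. lam j) (\<lambda>q. det (\<chi> i j. \<phi> i j q)) (\<lambda>z. det (omat z))"
    by (rule qser_det[OF \<phi>(1)])
  then have "qser (\<Sum>j\<in>UNIV. lam j) (\<lambda>q. det (\<chi> i j. \<phi> i j q)) (\<lambda>z. det (wmat z))"
    by (rule qser_cong) (simp add: det_wmat_eq)
  moreover have "det (\<chi> i j. \<phi> i j 0) \<noteq> 0"
    unfolding \<phi>(2) using lam_inj by (intro vandermonde_det_nonzero) (simp add: inj_def)
  ultimately show ?thesis by (rule that)
qed

lemma det_wmat_nonzero:
  assumes "w \<in> uhp"
  shows "det (wmat w) \<noteq> 0"
proof
  assume 0: "det (wmat w) = 0"
  obtain \<omega> where \<omega>: "qser (\<Sum>j\<in>UNIV. lam j) \<omega> (\<lambda>z. det (wmat z))" "\<omega> 0 \<noteq> 0"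
    using det_wmat_qser .
  have h: "(\<lambda>z. - (4 * of_real k + 12) * Pfun z) holomorphic_on uhp"
    by (intro holomorphic_intros Pfun_holomorphic)
  have "det (wmat z) = 0" if "z \<in> uhp" for z
    by (rule linear_ode_zero[OF det_wmat_holomorphic h qder_det_wmat assms 0 that])
  \<comment> \<open>For the zero function the exponent can be replaced by 0, and then its constant
    term is forced to be 0.\<close>
  then have "qser 0 \<omega> (\<lambda>z. 0)" using \<omega>(1) by (simp add: qser_def)
  then show False using qser_value_unique[OF _ qser_const] \<omega>(2) by metis
qed

sublocale quasimodular_Pfun
proof
  fix g z assume g: "g \<in> SL2Z" and z: "z \<in> uhp"
  let ?K = "2 * of_real pi * \<i>"
  define W where "W z = det (wmat z)" for z
  define B where "B z = det (rho g) * ((ups g * autf k g z) ^ 4 * jfac g z ^ 12)" for z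
  \<comment> \<open>Here \<open>4 k\<close> comes from the fourth power of \<open>autf\<close> and
    12 from \<open>jfac ^ 12\<close>. It is the constant of Abel's formula again, so it cancels from
    the comparison.\<close>
  define \<kappa> :: complex where "\<kappa> = 4 * of_real k + 12"
  have J: "jfac g z \<noteq> 0" using jfac_nonzero[OF g z] .
  have W: "W holomorphic_on uhp" "\<And>z. z \<in> uhp \<Longrightarrow> W z \<noteq> 0"
    using det_wmat_holomorphic det_wmat_nonzero by (simp_all add: W_def[abs_def])
  have W_moeb: "W (moeb g z) = B z * W z" if "z \<in> uhp" for z
    using det_omat_moeb[OF g that] that by (simp add: W_def B_def det_wmat_eq moeb_in_uhp[OF g])
  have B_hol: "B holomorphic_on uhp" unfolding B_def by (intro holomorphic_intros autf_holomorphic g)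
  \<comment> \<open>Non-vanishing of \<open>det (rho g)\<close> is not assumed in the locale; it
    follows from the Wronskian being non-zero at both points.\<close>
  have B0: "B z \<noteq> 0" using W_moeb[OF z] W(2)[OF moeb_in_uhp[OF g z]] by auto
  have B': "qder B z = \<kappa> * ent_c g / (?K * jfac g z) * B z"
  proof (rule qder_eqI)
    have "((\<lambda>z. det (rho g) * ((ups g * autf k g z) ^ 4 * jfac g z ^ 12)) has_field_derivative
        \<kappa> * ent_c g / jfac g z * (det (rho g) * ((ups g * autf k g z) ^ 4 * jfac g z ^ 12))) (at z)"
    proof -
      have log: "((\<lambda>z. f z ^ n) has_field_derivative of_nat n * d * f z ^ n) (at z)"
        if "(f has_field_derivative d * f z) (at z)" for f n and d z :: complex
        by (rule derivative_eq_intros that refl)+ (cases n; simp)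
      have "((\<lambda>z. ups g * autf k g z) has_field_derivative of_real k * ent_c g / jfac g z * (ups g * autf k g z)) (at z)"
        using DERIV_cmult[OF autf_derivative[OF g z], of "ups g" k] by (simp add: mult_ac)
      note 1 = log[OF this, of 4]
      have "(jfac g has_field_derivative ent_c g / jfac g z * jfac g z) (at z)"
        using jfac_has_field_derivative J by simp
      note 2 = log[OF this, of 12]
      show ?thesis
        by (rule DERIV_cong[OF DERIV_cmult[OF DERIV_mult[OF 1 2]]]) (simp add: \<kappa>_def add_divide_distrib algebra_simps)
    qed
    then show "(B has_field_derivative ?K * (\<kappa> * ent_c g / (?K * jfac g z) * B z)) (at z)"
      unfolding B_def[abs_def] by (simp add: divide_simps)
  qed
  have \<kappa>: "\<kappa> = 12 * complex_of_real (\<Sum>j\<in>UNIV. lam j)" by (simp add: \<kappa>_def k_eq)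
  have \<kappa>0: "\<kappa> \<noteq> 0" unfolding \<kappa> using lam_sum_pos by (simp del: of_real_sum)
  have qW: "qder W z = - \<kappa> * Pfun z * W z" if "z \<in> uhp" for z
    using qder_det_wmat[OF that] unfolding W_def[abs_def] \<kappa>_def .
  have "qder W (moeb g z) / (jfac g z)\<^sup>2 = qder (\<lambda>z. W (moeb g z)) z"
    using qder_comp_moeb[OF W(1) g z] by simp
  also have "\<dots> = qder (\<lambda>z. B z * W z) z" using W_moeb z by (rule qder_cong)
  also have "\<dots> = qder B z * W z + B z * qder W z" by (rule qder_mult[OF B_hol W(1) z])
  finally have "- \<kappa> * Pfun (moeb g z) * (B z * W z) / (jfac g z)\<^sup>2 =
      \<kappa> * ent_c g / (?K * jfac g z) * B z * W z - B z * (\<kappa> * Pfun z * W z)"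
    unfolding qW[OF z] qW[OF moeb_in_uhp[OF g z]] W_moeb[OF z] B' by simp
  then have "(\<kappa> * (B z * W z)) * (- Pfun (moeb g z) / (jfac g z)\<^sup>2) =
      (\<kappa> * (B z * W z)) * (ent_c g / (?K * jfac g z) - Pfun z)"
    by (simp add: right_diff_distrib mult_ac)
  moreover have "\<kappa> * (B z * W z) \<noteq> 0" using \<kappa>0 B0 W(2)[OF z] by simp
  ultimately have "- Pfun (moeb g z) / (jfac g z)\<^sup>2 = ent_c g / (?K * jfac g z) - Pfun z"
    by (metis mult_left_cancel)
  then have "Pfun (moeb g z) = (jfac g z)\<^sup>2 * (Pfun z - ent_c g / (?K * jfac g z))"
    using J by (simp add: divide_eq_eq minus_equation_iff) (simp add: algebra_simps)
  also have "\<dots> = (jfac g z)\<^sup>2 * Pfun z - ent_c g * jfac g z / ?K"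
    using J by (simp add: field_simps power2_eq_square)
  finally show "Pfun (moeb g z) = (jfac g z)\<^sup>2 * Pfun z - ent_c g * jfac g z / ?K" .
qed

end

section \<open>Finite sums of homogeneous elements\<close>

text \<open>One notion for the three sums in play: over integer weights of scalar forms, over
  integer shifts of \<open>k\<close>, and over natural numbers for the even shifts.\<close>

definition gsum :: "('i \<Rightarrow> ('x \<Rightarrow> 'y::ab_group_add) set) \<Rightarrow> ('x \<Rightarrow> 'y) set" where
  "gsum V = {f. \<exists>S G. finite S \<and> (\<forall>n\<in>S. G n \<in> V n) \<and> f = (\<lambda>z. \<Sum>n\<in>S. G n z)}"

lemma Mring_eq_gsum: "Mring = gsum Mk"
  by (simp add: Mring_def gsum_def)

lemma Hsum_eq_gsum: "Hsum k rho ups = gsum (\<lambda>n. Hk (k + real_of_int n) rho ups)"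
  by (simp add: Hsum_def gsum_def)

lemma gsumE:
  assumes "f \<in> gsum V"
  obtains S G where "finite S" "\<forall>n\<in>S. G n \<in> V n" "\<forall>z. f z = (\<Sum>n\<in>S. G n z)"
proof -
  from assms obtain S G where "finite S" "\<forall>n\<in>S. G n \<in> V n" "f = (\<lambda>z. \<Sum>n\<in>S. G n z)"
    unfolding gsum_def by blast
  then show ?thesis using that[of S G] by simp
qed

lemma gsum_homogeneous: "f \<in> V n \<Longrightarrow> f \<in> gsum V"
  unfolding gsum_def by (intro CollectI exI[of _ "{n}"] exI[of _ "\<lambda>_. f"]) auto

lemma gsum_zero: "(\<lambda>z. 0) \<in> gsum V"
  unfolding gsum_def by (intro CollectI exI[of _ "{}"]) auto

context
  fixes V :: "'i \<Rightarrow> ('x \<Rightarrow> 'y::ab_group_add) set"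
  assumes zero: "\<And>n. (\<lambda>z. 0) \<in> V n"
    and add: "\<And>n f g. f \<in> V n \<Longrightarrow> g \<in> V n \<Longrightarrow> (\<lambda>z. f z + g z) \<in> V n"
begin

lemma gsum_add:
  assumes "f \<in> gsum V" "g \<in> gsum V"
  shows "(\<lambda>z. f z + g z) \<in> gsum V"
proof -
  obtain S F where F0: "finite S" "\<forall>n\<in>S. F n \<in> V n" "\<forall>z. f z = (\<Sum>n\<in>S. F n z)"
    using assms(1) by (rule gsumE)
  note F = F0(1) F0(2,3)[rule_format]
  obtain T G where G0: "finite T" "\<forall>n\<in>T. G n \<in> V n" "\<forall>z. g z = (\<Sum>n\<in>T. G n z)"
    using assms(2) by (rule gsumE)
  note G = G0(1) G0(2,3)[rule_format]
  define H where "H n z = (if n \<in> S then F n z else 0) + (if n \<in> T then G n z else 0)" for n z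
  have "H n \<in> V n" for n
  proof -
    have "(\<lambda>z. if n \<in> S then F n z else 0) \<in> V n" by (cases "n \<in> S") (use F(2) zero in simp_all)
    moreover have "(\<lambda>z. if n \<in> T then G n z else 0) \<in> V n" by (cases "n \<in> T") (use G(2) zero in simp_all)
    ultimately show ?thesis unfolding H_def[abs_def] by (rule add)
  qed
  moreover have "f z + g z = (\<Sum>n\<in>S \<union> T. H n z)" for z
  proof -
    have "(\<Sum>n\<in>S \<union> T. if n \<in> S then F n z else 0) = f z"
      unfolding F(3) using F(1) G(1) by (intro sum.mono_neutral_cong_right) auto
    moreover have "(\<Sum>n\<in>S \<union> T. if n \<in> T then G n z else 0) = g z"
      unfolding G(3) using F(1) G(1) by (intro sum.mono_neutral_cong_right) auto
    ultimately show ?thesis by (simp add: H_def sum.distrib)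
  qed
  ultimately show ?thesis
    unfolding gsum_def using F(1) G(1) by (intro CollectI exI[of _ "S \<union> T"] exI[of _ H]) auto
qed

lemma gsum_sum: "(\<And>i. i \<in> I \<Longrightarrow> f i \<in> gsum V) \<Longrightarrow> (\<lambda>z. \<Sum>i\<in>I. f i z) \<in> gsum V"
proof (induction I rule: infinite_finite_induct)
  case (insert i I)
  have "(\<lambda>z. f i z + (\<Sum>i\<in>I. f i z)) \<in> gsum V"
    by (rule gsum_add) (use insert in simp_all)
  then show ?case using insert by simp
qed (simp_all add: gsum_zero)

end

lemma Mring_sum:
  assumes "\<And>i. i \<in> I \<Longrightarrow> f i \<in> Mring"
  shows "(\<lambda>z. \<Sum>i\<in>I. f i z) \<in> Mring"
  using gsum_sum[where V = Mk and f = f and I = I, OF Mk_zero Mk_add assms[unfolded Mring_eq_gsum]]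
  unfolding Mring_eq_gsum .

lemma Mk_imp_Mring: "f \<in> Mk w \<Longrightarrow> f \<in> Mring"
  unfolding Mring_eq_gsum by (rule gsum_homogeneous)

lemma Mring_off:
  assumes "f \<in> Mring" "z \<notin> uhp"
  shows "f z = 0"
proof -
  obtain S G where "\<forall>w\<in>S. G w \<in> Mk w" "\<forall>z. f z = (\<Sum>w\<in>S. G w z)"
    using assms(1) unfolding Mring_eq_gsum by (rule gsumE)
  then have "f z = (\<Sum>w\<in>S. G w z)" "\<forall>w\<in>S. G w z = 0" using assms(2) Mk_off by blast+
  then show ?thesis by simp
qed

lemma vector_space_vec_fun: "vector_space (\<lambda>(c::complex) (F::complex \<Rightarrow> complex^'n). (\<lambda>z. c *s F z))"
  by unfold_locales (auto simp: fun_eq_iff vec_eq_iff algebra_simps)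

text \<open>Stated for an indexed family because the basis to come is indexed by pairs. Independence
  of the family already makes it injective: two equal members would admit the coefficients 1 and
  -1.\<close>

lemma cdim_eq_card_family:
  fixes b :: "'i \<Rightarrow> complex \<Rightarrow> complex^'n"
  assumes fin: "finite I" and mem: "\<And>i. i \<in> I \<Longrightarrow> b i \<in> V"
    and span: "\<And>G. G \<in> V \<Longrightarrow> \<exists>c. G = (\<lambda>z. \<Sum>i\<in>I. c i *s b i z)"
    and indep: "\<And>c i. (\<And>z. (\<Sum>i\<in>I. c i *s b i z) = 0) \<Longrightarrow> i \<in> I \<Longrightarrow> c i = 0"
  shows "cdim V = card I"
proof -
  interpret vector_space "\<lambda>(c::complex) (F::complex \<Rightarrow> complex^'n). (\<lambda>z. c *s F z)"
    by (rule vector_space_vec_fun)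
  have sum_apply: "(\<Sum>x\<in>A. (\<lambda>z. u x *s h x z)) z = (\<Sum>x\<in>A. u x *s h x z)"
    for A :: "'a set" and u :: "'a \<Rightarrow> complex" and h :: "'a \<Rightarrow> complex \<Rightarrow> complex^'n" and z
    by (induction A rule: infinite_finite_induct) auto
  have inj: "inj_on b I"
  proof (rule inj_onI, rule ccontr)
    fix i j assume ij: "i \<in> I" "j \<in> I" "b i = b j" "i \<noteq> j"
    define c :: "'i \<Rightarrow> complex" where "c l = (if l = i then 1 else if l = j then -1 else 0)" for l
    have "(\<Sum>l\<in>I. c l *s b l z) = (\<Sum>l\<in>{i, j}. c l *s b l z)" for z
      using ij fin by (intro sum.mono_neutral_right) (auto simp: c_def)
    also have "\<dots> z = 0" for z using ij by (simp add: c_def)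
    finally have "c i = 0" using indep ij(1) by blast
    then show False by (simp add: c_def)
  qed
  have "dim V = card I"
  proof (rule dim_unique)
    show "b ` I \<subseteq> V" using mem by auto
    show "V \<subseteq> span (b ` I)"
    proof
      fix G assume "G \<in> V"
      then obtain c where "G = (\<lambda>z. \<Sum>i\<in>I. c i *s b i z)" using assms(3) by blast
      then have "G = (\<Sum>i\<in>I. (\<lambda>z. c i *s b i z))" by (simp add: fun_eq_iff sum_apply)
      then show "G \<in> span (b ` I)" by (simp only:) (intro span_sum span_scale span_base imageI)
    qed
    show "independent (b ` I)"
    proof (rule independent_if_scalars_zero)
      fix u x assume 0: "(\<Sum>x\<in>b ` I. (\<lambda>z. u x *s x z)) = 0" and x: "x \<in> b ` I"
      then obtain i where i: "i \<in> I" "x = b i" by blast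
      have "(\<Sum>i\<in>I. u (b i) *s b i z) = 0" for z
        using fun_cong[OF 0, of z] inj by (simp add: sum.reindex sum_apply)
      then show "u x = 0" using indep[of "\<lambda>i. u (b i)" i] i by simp
    qed (use fin in simp)
    show "card (b ` I) = card I" using inj by (rule card_image)
  qed
  then show ?thesis by (simp add: cdim_def)
qed

section \<open>The module of vector valued modular forms\<close>

lemma matrix_vector_mult_sum:
  fixes A :: "'a::comm_ring_1^'n^'m"
  shows "A *v (\<Sum>j\<in>S. c j *s X j) = (\<Sum>j\<in>S. c j *s (A *v X j))"
proof -
  have "(\<Sum>m\<in>UNIV. A $ i $ m * (\<Sum>j\<in>S. c j * X j $ m)) = (\<Sum>j\<in>S. c j * (\<Sum>m\<in>UNIV. A $ i $ m * X j $ m))" for i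
    unfolding sum_distrib_left by (subst sum.swap) (simp add: mult.left_commute)
  then show ?thesis by (simp add: vec_eq_iff matrix_vector_mult_def sum_component)
qed

lemma cramer_exists: "det A \<noteq> 0 \<Longrightarrow> \<exists>x. A *v x = b" for A :: "'a::field^'n^'n"
  by (simp add: cramer)

lemma cramer_unique:
  fixes A :: "'a::field^'n^'n"
  assumes "det A \<noteq> 0" "A *v x = A *v y"
  shows "x = y"
  using iffD1[OF cramer[OF assms(1)] assms(2)] iffD1[OF cramer[OF assms(1)] refl, of y] by simp

lemma matrix_vector_mult_smult: "A *v (c *s x) = c *s (A *v x)" for A :: "'a::comm_ring_1^'n^'m"
  using matrix_vector_mult_sum[of A "\<lambda>_. c" "\<lambda>_. x" "{()}"] by simp

lemma qser_translate: "qser l \<phi> f \<Longrightarrow> z \<in> uhp \<Longrightarrow> f (z + 1) = ee (of_real l) * f z"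
  by (simp add: qser_def uhp_def ring_distribs ee_add)

lemma Hk_moeb:
  assumes "G \<in> Hk k rho ups" "g \<in> SL2Z" "z \<in> uhp" "ups g \<noteq> 0"
  shows "G (moeb g z) = (ups g * autf k g z) *s (rho g *v G z)"
proof -
  have "slash k ups G g z = rho g *v G z" using assms by (simp add: Hk_def)
  then show ?thesis using slash_eq_iff[of g z ups k G "rho g *v G z"] assms by blast
qed

lemma moderate_growth_component: "moderate_growth G \<Longrightarrow> moderate_growth (\<lambda>z. G z $ i)"
proof -
  assume "moderate_growth G"
  then obtain N c where b: "\<And>x y. y > c \<Longrightarrow> norm (G (Complex x y)) \<le> y powr N"
    unfolding moderate_growth_def by blast
  show ?thesis
    unfolding moderate_growth_def
  proof (intro exI allI impI)
    fix x y assume "c < y"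
    then have "norm (G (Complex x y)) \<le> y powr N" by (rule b)
    then show "norm (G (Complex x y) $ i) \<le> y powr N"
      using Finite_Cartesian_Product.norm_nth_le[of "G (Complex x y)" i] by linarith
  qed
qed

section \<open>Vector valued forms in the basis of iterated derivatives\<close>

context mlde_system
begin

abbreviation V :: "int \<Rightarrow> (complex \<Rightarrow> complex^4) set" where
  "V n \<equiv> Hk (k + real_of_int n) rho ups"

lemma F_qser: "\<exists>\<phi>. qser (lam i) \<phi> (\<lambda>z. F z $ i)"
  using expansion by blast

lemma Dpow_qser: "\<exists>\<phi>. qser (lam i) \<phi> (\<lambda>z. Dpow n k F z $ i)"
  using Dscpow_qser_ex[OF F_qser] by (simp add: Dpow_component)

lemma Dpow_off: "z \<notin> uhp \<Longrightarrow> Dpow n k F z = 0"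
  by (cases n) (auto simp: F_off vec_eq_iff Dvec_def Dsc_off)

lemma Dpow_moeb:
  assumes g: "g \<in> SL2Z" and z: "z \<in> uhp"
  shows "Dpow n k F (moeb g z) = (ups g * autf (k + 2 * real n) g z) *s (rho g *v Dpow n k F z)"
  using z
proof (induction n arbitrary: z)
  case 0
  then show ?case using F_moeb[OF g] by simp
next
  case (Suc n)
  have "(\<lambda>z. Dpow n k F z $ i) holomorphic_on uhp" for i
    using Dpow_qser qser_holomorphic by blast
  from Dvec_moeb[OF quasimodular_Pfun_axioms g this Suc.IH Suc.prems]
  show ?case by (simp add: algebra_simps)
qed

text \<open>Expansions with non-negative exponents are bounded for Im z at least 1, which yields
  moderate growth.\<close>

lemma HkI:
  assumes off: "\<And>z. z \<notin> uhp \<Longrightarrow> G z = 0" and q: "\<And>i. \<exists>\<phi>. qser (lam i) \<phi> (\<lambda>z. G z $ i)"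
    and moeb: "\<And>g z. g \<in> SL2Z \<Longrightarrow> z \<in> uhp \<Longrightarrow> G (moeb g z) = (ups g * autf l g z) *s (rho g *v G z)"
  shows "G \<in> Hk l rho ups"
proof -
  have "\<exists>C. \<forall>z. Im z \<ge> 1 \<longrightarrow> norm (G z $ i) \<le> C" for i
    using q[of i] qser_bounded[of "lam i" _ "\<lambda>z. G z $ i"] lam_nonneg by metis
  then obtain C where C: "\<And>i z. Im z \<ge> 1 \<Longrightarrow> norm (G z $ i) \<le> C i" by metis
  have "norm (G z) \<le> (\<Sum>i\<in>UNIV. C i)" if "Im z \<ge> 1" for z
  proof -
    have "norm (G z) \<le> (\<Sum>i\<in>UNIV. norm (G z $ i))"
      unfolding norm_vec_def by (rule L2_set_le_sum) simp
    also have "\<dots> \<le> (\<Sum>i\<in>UNIV. C i)" using C that by (intro sum_mono) auto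
    finally show ?thesis .
  qed
  then have "moderate_growth G" by (rule bounded_imp_moderate_growth)
  then show ?thesis
    unfolding Hk_def using off q moeb qser_holomorphic slash_eq_iff ups_nonzero by blast
qed

lemma Dpow_Hk: "Dpow n k F \<in> V (2 * int n)"
  by (rule HkI) (auto simp: Dpow_off Dpow_qser Dpow_moeb)

lemma wmat_mult_cancel:
  assumes "z \<in> uhp" "transpose (wmat z) *v x = transpose (wmat z) *v y"
  shows "x = y"
proof -
  have "det (transpose (wmat z)) \<noteq> 0" using det_wmat_nonzero[OF assms(1)] by simp
  then show ?thesis using assms(2) by (rule cramer_unique)
qed

text \<open>Independence at each single point. The coefficients may thus be values of functions,
  which gives freeness over \<open>Mring\<close> as well as linear independence over the
  constants.\<close>

lemma Dpow_independent:
  assumes "z \<in> uhp" "(\<Sum>j<4. c j *s Dpow j k F z) = 0" "j < 4"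
  shows "c j = 0"
proof -
  define x :: "complex^4" where "x = (\<chi> j. c (idx j))"
  have "transpose (wmat z) *v x = (\<Sum>j<4. c j *s Dpow j k F z)"
    unfolding transpose_wmat_mult x_def by (simp add: sum_idx[of "\<lambda>j. c j *s Dpow j k F z"])
  then have "x = 0" using wmat_mult_cancel[OF assms(1), of x 0] assms(2) by simp
  moreover obtain i where "j = idx i" using ex_idx assms(3) by blast
  ultimately show ?thesis by (simp add: x_def vec_eq_iff)
qed

text \<open>So \<open>ups Tmat\<close> times \<open>rho Tmat\<close> is diagonal. The values of the
  first four iterates at the point i span the space, and the i-th component of each is multiplied by
  \<open>ee (lam i)\<close> under translation.\<close>

lemma rho_T: "ups Tmat * (rho Tmat *v v) $ i = ee (of_real (lam i)) * v $ i"
proof -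
  let ?P = "transpose (wmat \<i>)"
  have P: "det ?P \<noteq> 0" using det_wmat_nonzero[OF i_in_uhp] by simp
  obtain c where c: "?P *v c = v" using cramer_exists[OF P, of v] by (elim exE)
  have X: "ups Tmat * (rho Tmat *v Dpow n k F \<i>) $ i = ee (of_real (lam i)) * Dpow n k F \<i> $ i" for n
  proof -
    have "autf (k + 2 * real n) Tmat \<i> = 1" by (simp add: autf_eq jfac_Tmat)
    then have "ups Tmat * (rho Tmat *v Dpow n k F \<i>) $ i = Dpow n k F (\<i> + 1) $ i"
      using Dpow_moeb[OF Tmat_SL2Z i_in_uhp, of n] by (simp add: moeb_Tmat)
    also have "\<dots> = ee (of_real (lam i)) * Dpow n k F \<i> $ i"
      using Dpow_qser[of i n] qser_translate[OF _ i_in_uhp] by blast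
    finally show ?thesis .
  qed
  have "ups Tmat * (rho Tmat *v v) $ i = (\<Sum>j\<in>UNIV. c $ j * (ups Tmat * (rho Tmat *v Dpow (idx j) k F \<i>) $ i))"
    unfolding c[symmetric] transpose_wmat_mult matrix_vector_mult_sum
    by (simp add: sum_component sum_distrib_left mult.left_commute)
  also have "\<dots> = ee (of_real (lam i)) * (?P *v c) $ i"
    unfolding X transpose_wmat_mult by (simp add: sum_component sum_distrib_left mult.left_commute)
  finally show ?thesis using c by simp
qed

text \<open>By \<open>rho_T\<close> any element is quasiperiodic with the same multipliers as
  \<open>F\<close>, and its growth excludes negative powers because
  \<open>lam i < 1\<close>.\<close>

lemma Hk_qser:
  assumes G: "G \<in> V n"
  shows "\<exists>\<phi>. qser (lam i) \<phi> (\<lambda>z. G z $ i)"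
proof -
  have "G (z + 1) $ i = ee (of_real (lam i)) * G z $ i" if "z \<in> uhp" for z
    using Hk_moeb[OF G Tmat_SL2Z that] ups_nonzero[OF Tmat_SL2Z] rho_T[of "G z" i]
    by (simp add: moeb_Tmat autf_eq jfac_Tmat)
  moreover have "(\<lambda>z. G z $ i) holomorphic_on uhp" "moderate_growth (\<lambda>z. G z $ i)"
    using G moderate_growth_component by (auto simp: Hk_def)
  ultimately show ?thesis using qser_of_quasiperiodic[of "\<lambda>z. G z $ i" "lam i"] lam_less_1 by metis
qed

lemma Hk_off: "G \<in> V n \<Longrightarrow> z \<notin> uhp \<Longrightarrow> G z = 0"
  by (simp add: Hk_def)

lemma Hk_zero: "(\<lambda>z. 0) \<in> V n"
  by (rule HkI) (auto intro: qser_zero)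

lemma Hk_add:
  assumes "G \<in> V n" "H \<in> V n"
  shows "(\<lambda>z. G z + H z) \<in> V n"
proof (rule HkI)
  show "\<exists>\<phi>. qser (lam i) \<phi> (\<lambda>z. (G z + H z) $ i)" for i
  proof -
    obtain \<phi> \<psi> where "qser (lam i) \<phi> (\<lambda>z. G z $ i)" "qser (lam i) \<psi> (\<lambda>z. H z $ i)"
      using Hk_qser[OF assms(1)] Hk_qser[OF assms(2)] by blast
    from qser_add[OF this] show ?thesis by auto
  qed
  show "G (moeb g z) + H (moeb g z) = (ups g * autf (k + real_of_int n) g z) *s (rho g *v (G z + H z))"
    if "g \<in> SL2Z" "z \<in> uhp" for g z
    using that assms by (simp add: Hk_moeb ups_nonzero matrix_vector_right_distrib vector_add_ldistrib)
qed (simp add: Hk_off[OF assms(1)] Hk_off[OF assms(2)])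

lemma Mk_smult_Hk:
  assumes f: "f \<in> Mk w" and G: "G \<in> V n"
  shows "(\<lambda>z. f z *s G z) \<in> V (w + n)"
proof (rule HkI)
  show "\<exists>\<phi>. qser (lam i) \<phi> (\<lambda>z. (f z *s G z) $ i)" for i
  proof -
    obtain \<phi> where \<phi>: "qser 0 \<phi> f" using Mk_qser[OF f] .
    obtain \<psi> where "qser (lam i) \<psi> (\<lambda>z. G z $ i)" using Hk_qser[OF G] by blast
    from qser_mult0[OF \<phi> this] show ?thesis by auto
  qed
  show "f (moeb g z) *s G (moeb g z) = (ups g * autf (k + real_of_int (w + n)) g z) *s (rho g *v (f z *s G z))"
    if "g \<in> SL2Z" "z \<in> uhp" for g z
  proof -
    have "autf (k + real_of_int (w + n)) g z = jfac g z powi w * autf (k + real_of_int n) g z"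
      using that jfac_nonzero[OF that] autf_add_int[OF that, of k "w + n"] autf_add_int[OF that, of k n]
      by (simp add: power_int_add)
    then show ?thesis
      using that by (simp add: Hk_moeb[OF G] ups_nonzero Mk_modular[OF f] matrix_vector_mult_smult mult_ac)
  qed
qed (simp add: Mk_off[OF f])

lemma det_wmat_qser_nonvanishing:
  obtains \<omega> where "qser (\<Sum>j\<in>UNIV. lam j) \<omega> (\<lambda>z. det (wmat z))" "\<And>q. q \<in> ball 0 1 \<Longrightarrow> \<omega> q \<noteq> 0"
proof -
  obtain \<omega> where \<omega>: "qser (\<Sum>j\<in>UNIV. lam j) \<omega> (\<lambda>z. det (wmat z))" "\<omega> 0 \<noteq> 0"
    using det_wmat_qser .
  have "\<omega> q \<noteq> 0" if "q \<in> ball 0 1" for q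
  proof (cases "q = 0")
    case False
    moreover have "norm q < 1" using that by simp
    ultimately obtain z where "z \<in> uhp" "ee z = q" by (rule ee_onto_punctured_disc)
    then show ?thesis using qserD[OF \<omega>(1), of z] det_wmat_nonzero[of z] by auto
  qed (use \<omega> in simp)
  then show ?thesis using \<omega>(1) that by blast
qed

text \<open>Cramer's rule: the numerators are \<open>O(q\<^sup>\<lambda>)\<close> and the Wronskian is \<open>q\<^sup>\<lambda>\<close> times a unit, where
  \<open>\<lambda> = \<lambda>\<^sub>1 + \<dots> + \<lambda>\<^sub>4\<close>, so the coordinates stay holomorphic at the cusp.\<close>
lemma Hk_decomposition:
  assumes G: "G \<in> V n"
  obtains M where "\<And>j. j < 4 \<Longrightarrow> M j \<in> Mk (n - 2 * int j)" "\<And>z. G z = (\<Sum>j<4. M j z *s Dpow j k F z)"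
proof -
  define c :: "complex \<Rightarrow> complex^4" where
    "c z = (\<chi> j. det (\<chi> i l. if l = j then G z $ i else transpose (wmat z) $ i $ l) / det (wmat z))" for z
  have c: "transpose (wmat z) *v c z = G z" if "z \<in> uhp" for z
    using cramer[of "transpose (wmat z)" "c z" "G z"] det_wmat_nonzero[OF that] by (simp add: c_def)
  define m where "m j z = (if z \<in> uhp then c z $ j else 0)" for j z
  have m_qser: "\<exists>\<phi>. qser 0 \<phi> (m j)" for j
  proof -
    define A where "A z = (\<chi> i l. if l = j then G z $ i else transpose (wmat z) $ i $ l)" for z
    have "\<exists>\<phi>. qser (lam i) \<phi> (\<lambda>z. A z $ i $ l)" for i l
      using Hk_qser[OF G, of i] Dpow_qser[of i "idx l"]
      by (cases "l = j") (simp_all add: A_def transpose_def wmat_def Dpow_component)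
    then obtain \<phi> where "\<And>i l. qser (lam i) (\<phi> i l) (\<lambda>z. A z $ i $ l)" by metis
    then have A: "qser (\<Sum>j\<in>UNIV. lam j) (\<lambda>q. det (\<chi> i l. \<phi> i l q)) (\<lambda>z. det (A z))" by (rule qser_det)
    obtain \<omega> where \<omega>: "qser (\<Sum>j\<in>UNIV. lam j) \<omega> (\<lambda>z. det (wmat z))" "\<And>q. q \<in> ball 0 1 \<Longrightarrow> \<omega> q \<noteq> 0"
      using det_wmat_qser_nonvanishing by blast
    from qser_divide[OF A \<omega>] have "qser 0 (\<lambda>q. det (\<chi> i l. \<phi> i l q) / \<omega> q) (\<lambda>z. det (A z) / det (wmat z))"
      by simp
    then have "qser 0 (\<lambda>q. det (\<chi> i l. \<phi> i l q) / \<omega> q) (m j)"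
      by (rule qser_cong) (simp add: m_def c_def A_def)
    then show ?thesis by blast
  qed
  have m_Mk: "m j \<in> Mk (n - 2 * int (idx j))" for j
  proof -
    obtain \<phi> where \<phi>: "qser 0 \<phi> (m j)" using m_qser by blast
    show ?thesis
    proof (rule MkI[OF _ \<phi>])
      fix z assume z: "z \<in> uhp"
      let ?z = "moeb Smat z" and ?u = "ups Smat"
      have z': "?z \<in> uhp" using moeb_in_uhp[OF Smat_SL2Z z] .
      have J: "jfac Smat z \<noteq> 0" using jfac_nonzero[OF Smat_SL2Z z] .
      \<comment> \<open>The value that \<open>c\<close> must take at the inverted point if its j-th
        coordinate is to have weight \<open>n - 2 * int (idx j)\<close>. Both vectors solve the same
        invertible linear system there.\<close>
      define N :: "complex^4" where "N = (\<chi> j. jfac Smat z powi (n - 2 * int (idx j)) * c z $ j)"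
      have "transpose (wmat ?z) *v N = (\<Sum>j\<in>UNIV. N $ j *s
          ((?u * autf (k + 2 * real (idx j)) Smat z) *s (rho Smat *v Dpow (idx j) k F z)))"
        unfolding transpose_wmat_mult Dpow_moeb[OF Smat_SL2Z z] ..
      also have "\<dots> = (\<Sum>j\<in>UNIV. (?u * autf (k + real_of_int n) Smat z * c z $ j) *s (rho Smat *v Dpow (idx j) k F z))"
      proof (intro sum.cong refl)
        fix j
        have "autf (k + 2 * real (idx j)) Smat z = jfac Smat z powi (2 * int (idx j)) * autf k Smat z"
          using autf_add_int[OF Smat_SL2Z z, of k "2 * int (idx j)"] by simp
        moreover have "jfac Smat z powi (n - 2 * int (idx j)) * jfac Smat z powi (2 * int (idx j)) = jfac Smat z powi n"
          using J by (simp flip: power_int_add)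
        ultimately have "N $ j * (?u * autf (k + 2 * real (idx j)) Smat z) = ?u * autf (k + real_of_int n) Smat z * c z $ j"
          using autf_add_int[OF Smat_SL2Z z, of k n] by (simp add: N_def)
        then show "N $ j *s ((?u * autf (k + 2 * real (idx j)) Smat z) *s (rho Smat *v Dpow (idx j) k F z)) =
            (?u * autf (k + real_of_int n) Smat z * c z $ j) *s (rho Smat *v Dpow (idx j) k F z)"
          by (simp add: vector_smult_assoc)
      qed
      also have "\<dots> = (?u * autf (k + real_of_int n) Smat z) *s (rho Smat *v (transpose (wmat z) *v c z))"
        unfolding transpose_wmat_mult matrix_vector_mult_sum
        by (simp add: vec_eq_iff sum_component sum_distrib_left mult.assoc)
      also have "\<dots> = transpose (wmat ?z) *v c ?z"
        using Hk_moeb[OF G Smat_SL2Z z] ups_nonzero[OF Smat_SL2Z] c[OF z] c[OF z'] by simp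
      finally have "N = c ?z" by (rule wmat_mult_cancel[OF z'])
      then have "c ?z $ j = N $ j" by simp
      then show "m j (- (1 / z)) = z powi (n - 2 * int (idx j)) * m j z"
        using z z' by (simp add: m_def N_def moeb_Smat jfac_Smat)
    qed (simp add: m_def)
  qed
  define M where "M l = m (inv idx l)" for l
  have M: "M (idx j) = m j" for j by (simp add: M_def inv_f_f inj_def)
  show ?thesis
  proof (rule that)
    show "M j \<in> Mk (n - 2 * int j)" if "j < 4" for j
      using ex_idx[OF that] m_Mk M by metis
    show "G z = (\<Sum>j<4. M j z *s Dpow j k F z)" for z
    proof (cases "z \<in> uhp")
      case True
      have "(\<Sum>j<4. M j z *s Dpow j k F z) = (\<Sum>j\<in>UNIV. m j z *s Dpow (idx j) k F z)"
        using sum_idx[of "\<lambda>j. M j z *s Dpow j k F z"] by (simp add: M)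
      also have "\<dots> = G z" using c[OF True, unfolded transpose_wmat_mult] True by (simp add: m_def)
      finally show ?thesis ..
    qed (simp add: Dpow_off Hk_off[OF G])
  qed
qed

lemma Hk_trivial:
  assumes G: "G \<in> V n" and n: "n < 0 \<or> odd n"
  shows "G z = 0"
proof -
  obtain M where M: "\<And>j. j < 4 \<Longrightarrow> M j \<in> Mk (n - 2 * int j)" "\<And>z. G z = (\<Sum>j<4. M j z *s Dpow j k F z)"
    using Hk_decomposition[OF G] by blast
  have "M j z = 0" if "j < 4" for j
    using n Mk_neg[OF M(1)[OF that]] Mk_odd[OF M(1)[OF that]] by auto
  then show ?thesis by (simp add: M(2))
qed

lemma Hsum_sum:
  assumes "\<And>i. i \<in> I \<Longrightarrow> f i \<in> Hsum k rho ups"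
  shows "(\<lambda>z. \<Sum>i\<in>I. f i z) \<in> Hsum k rho ups"
  using gsum_sum[where V = V and f = f and I = I, OF Hk_zero Hk_add assms[unfolded Hsum_eq_gsum]]
  unfolding Hsum_eq_gsum .

lemma Hk_imp_Hsum: "G \<in> V n \<Longrightarrow> G \<in> Hsum k rho ups"
  unfolding Hsum_eq_gsum by (rule gsum_homogeneous)

lemma Mring_smult_Dpow:
  assumes "f \<in> Mring"
  shows "(\<lambda>z. f z *s Dpow j k F z) \<in> Hsum k rho ups"
proof -
  obtain S G where G0: "finite S" "\<forall>w\<in>S. G w \<in> Mk w" "\<forall>z. f z = (\<Sum>w\<in>S. G w z)"
    using assms unfolding Mring_eq_gsum by (rule gsumE)
  note G = G0(1) G0(2,3)[rule_format]
  have "(\<lambda>z. \<Sum>w\<in>S. G w z *s Dpow j k F z) \<in> Hsum k rho ups"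
    using G(2) by (intro Hsum_sum Hk_imp_Hsum[OF Mk_smult_Hk[OF _ Dpow_Hk]]) auto
  moreover have "f z *s Dpow j k F z = (\<Sum>w\<in>S. G w z *s Dpow j k F z)" for z
    by (simp add: G(3) vec_eq_iff sum_component sum_distrib_right)
  ultimately show ?thesis by simp
qed

lemma Hsum_decomposition:
  assumes "G \<in> Hsum k rho ups"
  shows "\<exists>M. (\<forall>j<4. M j \<in> Mring) \<and> G = (\<lambda>z. \<Sum>j<4. M j z *s Dpow j k F z)"
proof -
  obtain S H where H0: "finite S" "\<forall>n\<in>S. H n \<in> V n" "\<forall>z. G z = (\<Sum>n\<in>S. H n z)"
    using assms unfolding Hsum_eq_gsum by (rule gsumE)
  note H = H0(2,3)[rule_format]
  have "\<exists>M. (\<forall>j<4. M j \<in> Mring) \<and> (\<forall>z. H n z = (\<Sum>j<4. M j z *s Dpow j k F z))" if "n \<in> S" for n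
  proof -
    have "H n \<in> V n" using that by (rule H(1))
    then obtain M where "\<And>j. j < 4 \<Longrightarrow> M j \<in> Mk (n - 2 * int j)" "\<And>z. H n z = (\<Sum>j<4. M j z *s Dpow j k F z)"
      by (rule Hk_decomposition) blast
    then show ?thesis using Mk_imp_Mring by (intro exI[of _ M]) blast
  qed
  then have "\<forall>n\<in>S. \<exists>M. (\<forall>j<4. M j \<in> Mring) \<and> (\<forall>z. H n z = (\<Sum>j<4. M j z *s Dpow j k F z))"
    by blast
  from bchoice[OF this] obtain M where M: "\<And>n j. n \<in> S \<Longrightarrow> j < 4 \<Longrightarrow> M n j \<in> Mring"
    "\<And>n z. n \<in> S \<Longrightarrow> H n z = (\<Sum>j<4. M n j z *s Dpow j k F z)"
    by blast
  have "G z = (\<Sum>j<4. (\<Sum>n\<in>S. M n j z) *s Dpow j k F z)" for z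
  proof -
    have "G z = (\<Sum>n\<in>S. \<Sum>j<4. M n j z *s Dpow j k F z)"
      unfolding H(2) by (intro sum.cong refl M(2))
    also have "\<dots> = (\<Sum>j<4. \<Sum>n\<in>S. M n j z *s Dpow j k F z)" by (rule sum.swap)
    finally show ?thesis by (simp add: vec_eq_iff sum_component sum_distrib_right)
  qed
  then show ?thesis
    using M(1) by (intro exI[of _ "\<lambda>j z. \<Sum>n\<in>S. M n j z"]) (auto intro!: Mring_sum)
qed

lemma Hsum_eq_cyclic:
  "Hsum k rho ups = {G. \<exists>n M. (\<forall>j<n. M j \<in> Mring) \<and> G = (\<lambda>z. \<Sum>j<n. M j z *s Dpow j k F z)}"
proof (intro equalityI subsetI)
  fix G assume "G \<in> Hsum k rho ups"
  then show "G \<in> {G. \<exists>n M. (\<forall>j<n. M j \<in> Mring) \<and> G = (\<lambda>z. \<Sum>j<n. M j z *s Dpow j k F z)}"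
    using Hsum_decomposition by blast
next
  fix G assume "G \<in> {G. \<exists>n M. (\<forall>j<n. M j \<in> Mring) \<and> G = (\<lambda>z. \<Sum>j<n. M j z *s Dpow j k F z)}"
  then show "G \<in> Hsum k rho ups" by (auto intro!: Hsum_sum Mring_smult_Dpow)
qed

lemma Hsum_eq_nonnegative_even:
  "Hsum k rho ups = gsum (\<lambda>n::nat. Hk (k + 2 * real n) rho ups)"
proof (intro equalityI subsetI)
  have V: "Hk (k + 2 * real n) rho ups = V (2 * int n)" for n by simp
  let ?V = "\<lambda>n::nat. Hk (k + 2 * real n) rho ups"
  have zero: "(\<lambda>z. 0) \<in> ?V n" for n unfolding V by (rule Hk_zero)
  have add: "(\<lambda>z. f z + g z) \<in> ?V n" if "f \<in> ?V n" "g \<in> ?V n" for f g n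
    using that unfolding V by (rule Hk_add)
  fix G
  {
    assume "G \<in> Hsum k rho ups"
    then obtain S H where H0: "finite S" "\<forall>n\<in>S. H n \<in> V n" "\<forall>z. G z = (\<Sum>n\<in>S. H n z)"
      unfolding Hsum_eq_gsum by (rule gsumE)
    note H = H0(2,3)[rule_format]
    have "H n \<in> gsum ?V" if n: "n \<in> S" for n
    proof (cases "n < 0 \<or> odd n")
      case True
      have "H n \<in> V n" using n by (rule H(1))
      from Hk_trivial[OF this True] have "H n = (\<lambda>z. 0)" by (rule ext)
      then show ?thesis using gsum_zero by simp
    next
      case False
      then obtain m where "n = 2 * m" "0 \<le> m" by (auto elim!: evenE)
      then have "H n \<in> ?V (nat m)" using H(1)[OF n] by simp
      then show ?thesis by (rule gsum_homogeneous[where V = ?V])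
    qed
    from gsum_sum[where V = ?V and f = H and I = S, OF zero add this]
    have "(\<lambda>z. \<Sum>n\<in>S. H n z) \<in> gsum ?V" .
    then show "G \<in> gsum ?V" by (simp add: H(2)[symmetric])
  next
    assume "G \<in> gsum ?V"
    then obtain S H where H0: "finite S" "\<forall>n\<in>S. H n \<in> ?V n" "\<forall>z. G z = (\<Sum>n\<in>S. H n z)"
      by (rule gsumE)
    note H = H0(2,3)[rule_format]
    have "(\<lambda>z. \<Sum>n\<in>S. H n z) \<in> Hsum k rho ups"
    proof (rule Hsum_sum)
      fix n assume "n \<in> S"
      then have "H n \<in> ?V n" by (rule H(1))
      then show "H n \<in> Hsum k rho ups" unfolding V by (rule Hk_imp_Hsum)
    qed
    then show "G \<in> Hsum k rho ups" by (simp add: H(2)[symmetric])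
  }
qed

text \<open>The decomposition and the pointwise independence reduce the dimension to the sum of
  those of the scalar spaces of weight \<open>2 (v - j)\<close> for j below 4.\<close>

lemma cdim_Hk: "cdim (Hk (k + 2 * real v) rho ups) = 2 * v div 3 + 1"
proof -
  \<comment> \<open>The condition \<open>j \<le> v\<close> keeps the natural subtraction
    \<open>v - j\<close> exact; for larger \<open>j\<close> the coefficient has negative weight and
    is 0.\<close>
  define I where "I = (SIGMA j:{j. j < 4 \<and> j \<le> v}. Mindex (v - j))"
  define b where "b = (\<lambda>(j, i) z. Mbasis (v - j) i z *s Dpow j k F z)"
  have fin: "finite {j. j < 4 \<and> j \<le> v}" by (rule finite_subset[of _ "{..<4}"]) auto
  have finI: "finite I" unfolding I_def by (intro finite_SigmaI fin finite_Mindex)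
  have V: "Hk (k + 2 * real v) rho ups = V (2 * int v)" by simp
  have expand: "(\<Sum>p\<in>I. c p *s b p z) =
      (\<Sum>j<4. (if j \<le> v then \<Sum>i\<in>Mindex (v - j). c (j, i) * Mbasis (v - j) i z else 0) *s Dpow j k F z)" for c z
  proof -
    have "(\<Sum>p\<in>I. c p *s b p z) = (\<Sum>j | j < 4 \<and> j \<le> v. \<Sum>i\<in>Mindex (v - j). c (j, i) *s b (j, i) z)"
      unfolding I_def by (subst sum.Sigma) (auto simp: fin finite_Mindex)
    also have "\<dots> = (\<Sum>j | j < 4 \<and> j \<le> v. (\<Sum>i\<in>Mindex (v - j). c (j, i) * Mbasis (v - j) i z) *s Dpow j k F z)"
      by (simp add: b_def vec_eq_iff sum_component sum_distrib_right mult.assoc)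
    also have "\<dots> = (\<Sum>j<4. (if j \<le> v then \<Sum>i\<in>Mindex (v - j). c (j, i) * Mbasis (v - j) i z else 0) *s Dpow j k F z)"
      by (rule sum.mono_neutral_cong_left) auto
    finally show ?thesis .
  qed
  have "cdim (V (2 * int v)) = card I"
  proof (rule cdim_eq_card_family[OF finI, of b])
    fix p assume "p \<in> I"
    then obtain j i where p: "p = (j, i)" "j < 4" "j \<le> v" "i \<in> Mindex (v - j)" by (auto simp: I_def)
    have "(\<lambda>z. Mbasis (v - j) i z *s Dpow j k F z) \<in> V (2 * int (v - j) + 2 * int j)"
      by (intro Mk_smult_Hk Mbasis_Mk p Dpow_Hk)
    then show "b p \<in> V (2 * int v)" using p by (simp add: b_def of_nat_diff)
  next
    fix G assume "G \<in> V (2 * int v)"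
    then obtain M where M: "\<And>j. j < 4 \<Longrightarrow> M j \<in> Mk (2 * int v - 2 * int j)" "\<And>z. G z = (\<Sum>j<4. M j z *s Dpow j k F z)"
      by (rule Hk_decomposition) blast
    have "\<exists>c. \<forall>z. M j z = (if j \<le> v then \<Sum>i\<in>Mindex (v - j). c i * Mbasis (v - j) i z else 0)" if "j < 4" for j
    proof (cases "j \<le> v")
      case True
      then have "M j \<in> Mk (2 * int (v - j))" using M(1)[OF that] by (simp add: of_nat_diff algebra_simps)
      from Mk_span[OF this] show ?thesis using True by simp
    next
      case False
      then show ?thesis using Mk_neg[OF M(1)[OF that]] by simp
    qed
    then obtain c where "\<And>j z. j < 4 \<Longrightarrow> M j z = (if j \<le> v then \<Sum>i\<in>Mindex (v - j). c j i * Mbasis (v - j) i z else 0)"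
      by metis
    then have "G = (\<lambda>z. \<Sum>p\<in>I. case_prod c p *s b p z)"
      unfolding expand by (auto simp: M(2) fun_eq_iff intro!: sum.cong)
    then show "\<exists>c. G = (\<lambda>z. \<Sum>p\<in>I. c p *s b p z)" by blast
  next
    fix c p assume 0: "\<And>z. (\<Sum>p\<in>I. c p *s b p z) = 0" and "p \<in> I"
    then obtain j i where p: "p = (j, i)" "j < 4" "j \<le> v" "i \<in> Mindex (v - j)" by (auto simp: I_def)
    have "(\<Sum>i\<in>Mindex (v - j). c (j, i) * Mbasis (v - j) i z) = 0" if z: "z \<in> uhp" for z
      using Dpow_independent[OF z 0[of z, unfolded expand] p(2)] p(3) by simp
    from Mbasis_independent[OF this p(4)] show "c p = 0" by (simp add: p(1))
  qed
  also have "card I = (\<Sum>j | j < 4 \<and> j \<le> v. card (Mindex (v - j)))"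
    unfolding I_def by (rule card_SigmaI) (auto simp: fin finite_Mindex)
  also have "\<dots> = (\<Sum>j<4. if j \<le> v then card (Mindex (v - j)) else 0)"
    by (rule sum.mono_neutral_cong_left) auto
  also have "\<dots> = 2 * v div 3 + 1" by (rule sum_card_Mindex)
  finally show ?thesis unfolding V .
qed

text \<open>Variation of constants: the Wronskian matrix and the jet of a solution satisfy the same first
  order system, so the coordinates of the jet have derivative zero.\<close>
lemma fundamental_system: "fundamental_system4 k M4 M6 M8 (\<lambda>j z. F z $ j)"
  unfolding fundamental_system4_def
proof (intro conjI allI impI ballI)
  show "(\<lambda>z. F z $ j) \<in> mlde4_solutions k M4 M6 M8" for j by (rule solution)
next
  fix c :: "4 \<Rightarrow> complex" and j
  assume 0: "(\<lambda>z. \<Sum>j\<in>UNIV. c j * F z $ j) = (\<lambda>z. 0)"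
  have "(wmat \<i> *v (\<chi> j. c j)) $ i = 0" for i
  proof -
    have "(wmat \<i> *v (\<chi> j. c j)) $ i = (\<Sum>j\<in>UNIV. c j * Dscpow (idx i) k (\<lambda>w. F w $ j) \<i>)"
      by (simp add: matrix_vector_mult_def wmat_def mult.commute)
    also have "\<dots> = Dscpow (idx i) k (\<lambda>z. 0) \<i>"
      using fun_cong[OF 0] by (intro Dscpow_linear[symmetric]) (auto simp: F_holomorphic i_in_uhp)
    \<comment> \<open>The zero function is treated as an empty linear combination.\<close>
    also have "\<dots> = 0" using Dscpow_linear[of "{}" "\<lambda>_ z. 0" "\<lambda>z. 0" "\<lambda>_. 0" \<i> "idx i" k] i_in_uhp by simp
    finally show ?thesis .
  qed
  then have "wmat \<i> *v (\<chi> j. c j) = wmat \<i> *v 0" by (simp add: vec_eq_iff)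
  then have "(\<chi> j. c j) = (0::complex^4)"
    by (rule cramer_unique[OF det_wmat_nonzero[OF i_in_uhp]])
  then show "c j = 0" by (simp add: vec_eq_iff)
next
  fix f assume f: "f \<in> mlde4_solutions k M4 M6 M8"
  then have f_hol: "f holomorphic_on uhp" and f_off: "\<And>z. z \<notin> uhp \<Longrightarrow> f z = 0"
    by (auto simp: mlde4_solutions_def)
  define v :: "complex \<Rightarrow> complex^4" where "v z = (\<chi> j. Dscpow (idx j) k f z)" for z
  define c :: "complex \<Rightarrow> complex^4" where
    "c z = (\<chi> l. det (\<chi> i j. if j = l then v z $ i else wmat z $ i $ j) / det (wmat z))" for z
  have v_hol: "(\<lambda>z. v z $ i) holomorphic_on uhp" for i
    by (simp add: v_def Dscpow_holomorphic f_hol)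
  have c: "wmat z *v c z = v z" if "z \<in> uhp" for z
    using cramer[OF det_wmat_nonzero[OF that], of "c z" "v z"] by (simp add: c_def)
  have c_hol: "(\<lambda>z. c z $ l) holomorphic_on uhp" for l
  proof -
    have "(\<lambda>z. det (\<chi> i j. if j = l then v z $ i else wmat z $ i $ j)) holomorphic_on uhp"
    proof (rule holomorphic_on_det)
      show "(\<lambda>z. (\<chi> i j. if j = l then v z $ i else wmat z $ i $ j) $ i $ j) holomorphic_on uhp" for i j
        by (cases "j = l") (simp_all add: v_hol wmat_holomorphic)
    qed
    then show ?thesis
      using det_wmat_nonzero by (simp add: c_def) (intro holomorphic_on_divide det_wmat_holomorphic; blast)
  qed
  have "qder (\<lambda>z. c z $ l) z = 0" if z: "z \<in> uhp" for l z
  proof -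
    let ?C = "companion k M4 M6 M8 z"
    have "(wmat z *v (\<chi> l. qder (\<lambda>z. c z $ l) z)) $ i = 0" for i
    proof -
      have "(?C *v v z) $ i = qder (\<lambda>z. v z $ i) z"
        using qder_mlde_solution[OF f z, of i] by (simp add: v_def matrix_vector_mult_def)
      also have "\<dots> = qder (\<lambda>z. \<Sum>j\<in>UNIV. wmat z $ i $ j * c z $ j) z"
        by (rule qder_cong[OF _ z]) (simp add: c[symmetric] matrix_vector_mult_def)
      also have "\<dots> = (\<Sum>j\<in>UNIV. qder (\<lambda>z. wmat z $ i $ j * c z $ j) z)"
        by (intro qder_sum z holomorphic_intros wmat_holomorphic c_hol)
      also have "\<dots> = (\<Sum>j\<in>UNIV. qder (\<lambda>z. wmat z $ i $ j) z * c z $ j + wmat z $ i $ j * qder (\<lambda>z. c z $ j) z)"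
        by (intro sum.cong refl qder_mult z wmat_holomorphic c_hol)
      also have "\<dots> = (\<Sum>j\<in>UNIV. (?C ** wmat z) $ i $ j * c z $ j) + (\<Sum>j\<in>UNIV. wmat z $ i $ j * qder (\<lambda>z. c z $ j) z)"
      proof -
        have "qder (\<lambda>z. wmat z $ i $ j) z = (?C ** wmat z) $ i $ j" for j
          using qder_mlde_solution[OF solution z] by (simp add: wmat_def matrix_matrix_mult_def)
        then show ?thesis by (simp add: sum.distrib)
      qed
      also have "(\<Sum>j\<in>UNIV. (?C ** wmat z) $ i $ j * c z $ j) = (?C *v v z) $ i"
        unfolding c[OF z, symmetric] matrix_vector_mul_assoc by (simp add: matrix_vector_mult_def)
      finally show ?thesis by (simp add: matrix_vector_mult_def)
    qed
    then have "wmat z *v (\<chi> l. qder (\<lambda>z. c z $ l) z) = wmat z *v 0" by (simp add: vec_eq_iff)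
    then have "(\<chi> l. qder (\<lambda>z. c z $ l) z) = (0::complex^4)"
      by (rule cramer_unique[OF det_wmat_nonzero[OF z]])
    then show ?thesis by (simp add: vec_eq_iff)
  qed
  then have "\<exists>a. \<forall>z\<in>uhp. c z $ l = a" for l
    using qder_0_imp_constant[OF c_hol] by blast
  then obtain a where a: "\<And>l z. z \<in> uhp \<Longrightarrow> c z $ l = a l" by metis
  have "f z = (\<Sum>j\<in>UNIV. a j * F z $ j)" for z
  proof (cases "z \<in> uhp")
    case True
    \<comment> \<open>Coordinate 4 is the undifferentiated one, as \<open>idx 4 = 0\<close>.\<close>
    have "f z = v z $ 4" by (simp add: v_def)
    also have "\<dots> = (\<Sum>j\<in>UNIV. a j * F z $ j)"
      unfolding c[OF True, symmetric] using a[OF True] by (simp add: matrix_vector_mult_def wmat_def mult.commute)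
    finally show ?thesis .
  qed (simp add: f_off F_off)
  then show "\<exists>c. f = (\<lambda>z. \<Sum>j\<in>UNIV. c j * F z $ j)" by blast
qed

end

section \<open>From the data of the theorem to the abstract system\<close>

lemma qser_of_sums:
  assumes s: "\<forall>z\<in>uhp. (\<lambda>n. a n * ee (of_real (l + real n) * z)) sums f z"
  shows "\<exists>\<phi>. qser l \<phi> f \<and> \<phi> 0 = a 0"
proof (intro exI conjI)
  \<comment> \<open>Convergence on the punctured disc is inherited from the half-plane, since every
    such \<open>q\<close> is some \<open>ee z\<close>; at the centre the series converges
    trivially.\<close>
  define \<phi> where "\<phi> q = (\<Sum>n. a n * (q - 0) ^ n)" for q
  have *: "(\<lambda>n. a n * ee z ^ n) sums (f z / ee (of_real l * z))" if "z \<in> uhp" for z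
  proof -
    have "(\<lambda>n. a n * ee (of_real (l + real n) * z) / ee (of_real l * z)) sums (f z / ee (of_real l * z))"
      using s that by (intro sums_divide) blast
    moreover have "ee (of_real (l + real n) * z) = ee (of_real l * z) * ee z ^ n" for n
      by (simp add: ring_distribs ee_add ee_of_nat_mult)
    ultimately show ?thesis by (simp add: mult.commute)
  qed
  have sums: "(\<lambda>n. a n * (q - 0) ^ n) sums \<phi> q" if "q \<in> ball 0 1" for q
  proof (cases "q = 0")
    case True
    then show ?thesis using powser_sums_zero[of a]
      by (simp add: \<phi>_def sums_iff)
  next
    case False
    moreover have "norm q < 1" using that by simp
    ultimately obtain z where "z \<in> uhp" "ee z = q" by (rule ee_onto_punctured_disc)
    then show ?thesis using *[of z] by (simp add: \<phi>_def sums_iff)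
  qed
  show "qser l \<phi> f"
    unfolding qser_def
  proof (intro conjI ballI)
    show "\<phi> holomorphic_on ball 0 1" using sums by (rule power_series_holomorphic)
    fix z assume z: "z \<in> uhp"
    have "\<phi> (ee z) = f z / ee (of_real l * z)" using *[OF z] by (simp add: \<phi>_def sums_iff)
    then show "f z = ee (of_real l * z) * \<phi> (ee z)" by simp
  qed
  show "\<phi> 0 = a 0" using powser_sums_zero[of a] by (simp add: \<phi>_def sums_iff)
qed

text \<open>Equal fractional parts would make \<open>s - r\<close> an integer strictly between 0 and
  1. This transfers distinctness from the \<open>r\<close>'s to the exponents.\<close>

lemma frac_add_neq:
  fixes r s c :: real
  assumes "r < s" "s < r + 1"
  shows "frac (r + c) \<noteq> frac (s + c)"
proof
  assume "frac (r + c) = frac (s + c)"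
  then have "s - r = of_int (\<lfloor>s + c\<rfloor> - \<lfloor>r + c\<rfloor>)" by (simp add: frac_def)
  then have "0 < \<lfloor>s + c\<rfloor> - \<lfloor>r + c\<rfloor>" "\<lfloor>s + c\<rfloor> - \<lfloor>r + c\<rfloor> < 1" using assms by linarith+
  then show False by simp
qed

lemma vector_4 [simp]:
  "(vector [a, b, c, d] :: 'a::zero^4) $ 1 = a" "(vector [a, b, c, d] :: 'a^4) $ 2 = b"
  "(vector [a, b, c, d] :: 'a^4) $ 3 = c" "(vector [a, b, c, d] :: 'a^4) $ 4 = d"
  by (simp_all add: vector_def)

theorem theorem4p11:
  fixes rho rho0 :: "int^2^2 \<Rightarrow> complex^4^4"
    and ups :: "int^2^2 \<Rightarrow> complex"
    and m r1 r2 r3 r4 :: real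
    and f1 f2 f3 f4 M4 M6 M8 :: "complex \<Rightarrow> complex"
    and a1 a2 a3 a4 :: "nat \<Rightarrow> complex"
  defines "l1 \<equiv> frac (r1 + m / 12)"
      and "l2 \<equiv> frac (r2 + m / 12)"
      and "l3 \<equiv> frac (r3 + m / 12)"
      and "l4 \<equiv> frac (r4 + m / 12)"
  defines "k0 \<equiv> 3 * (l1 + l2 + l3 + l4) - 3"
      and "F0 \<equiv> (\<lambda>z. vector [f1 z, f2 z, f3 z, f4 z] :: complex^4)"
  assumes rho_Tdet: "T_determined rho"
      and rho_Tunit: "T_unitarizable rho"
      and r_order: "0 \<le> r1" "r1 < r2" "r2 < r3" "r3 < r4" "r4 < 1"
      and rho_eig: "eigenvalues (rho Tmat) = {ee (of_real r1), ee (of_real r2), ee (of_real r3), ee (of_real r4)}"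
      and ups_mult: "multiplier_system k0 ups"
      and ups_cusp: "cusp_parameter ups m"
      and M_wt: "M4 \<in> Mk 4" "M6 \<in> Mk 6" "M8 \<in> Mk 8"
      and f_sol: "f1 \<in> mlde4_solutions k0 M4 M6 M8" "f2 \<in> mlde4_solutions k0 M4 M6 M8"
                 "f3 \<in> mlde4_solutions k0 M4 M6 M8" "f4 \<in> mlde4_solutions k0 M4 M6 M8"
      and a_lead: "a1 0 = 1" "a2 0 = 1" "a3 0 = 1" "a4 0 = 1"
      and f_exp: "\<forall>z\<in>uhp. (\<lambda>n. a1 n * ee (of_real (l1 + real n) * z)) sums f1 z"
                 "\<forall>z\<in>uhp. (\<lambda>n. a2 n * ee (of_real (l2 + real n) * z)) sums f2 z"
                 "\<forall>z\<in>uhp. (\<lambda>n. a3 n * ee (of_real (l3 + real n) * z)) sums f3 z"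
                 "\<forall>z\<in>uhp. (\<lambda>n. a4 n * ee (of_real (l4 + real n) * z)) sums f4 z"
      and rho0_def: "\<forall>g\<in>SL2Z. \<forall>z\<in>uhp. slash k0 ups F0 g z = rho0 g *v F0 z"
  shows
    \<comment> \<open>(i)\<close>
    "((\<forall>n::int. Hk (k0 + real_of_int n) rho0 ups \<noteq> {0} \<longrightarrow> 0 \<le> n \<and> even n) \<and>
      Hsum k0 rho0 ups =
        {F. \<exists>(S::nat set) G. finite S \<and> (\<forall>n\<in>S. G n \<in> Hk (k0 + 2 * real n) rho0 ups)
              \<and> F = (\<lambda>z. \<Sum>n\<in>S. G n z)} \<and>
      F0 \<in> Hk k0 rho0 ups \<and>
      (\<exists>N4 N6 N8. N4 \<in> Mk 4 \<and> N6 \<in> Mk 6 \<and> N8 \<in> Mk 8 \<and>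
                  fundamental_system4 k0 N4 N6 N8 (\<lambda>j z. F0 z $ j)))
     \<and>
     \<comment> \<open>(ii)\<close>
     ((\<forall>j<4. Dpow j k0 F0 \<in> Hsum k0 rho0 ups) \<and>
      (\<forall>F\<in>Hsum k0 rho0 ups. \<exists>M. (\<forall>j<4. M j \<in> Mring) \<and>
                               F = (\<lambda>z. \<Sum>j<4. M j z *s Dpow j k0 F0 z)) \<and>
      (\<forall>M. (\<forall>j<4. M j \<in> Mring) \<and> (\<lambda>z. \<Sum>j<4. M j z *s Dpow j k0 F0 z) = 0
             \<longrightarrow> (\<forall>j<4. M j = 0)))
     \<and>
     \<comment> \<open>(iii)\<close>
     Hsum k0 rho0 ups =
       {F. \<exists>n M. (\<forall>j<n. M j \<in> Mring) \<and> F = (\<lambda>z. \<Sum>j<n. M j z *s Dpow j k0 F0 z)}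
     \<and>
     \<comment> \<open>(iv)\<close>
     (\<forall>k::nat. cdim (Hk (k0 + 2 * real k) rho0 ups) = nat \<lfloor>2 * real k / 3\<rfloor> + 1)"
proof -
  define lam :: "4 \<Rightarrow> real" where "lam j = (vector [l1, l2, l3, l4] :: real^4) $ j" for j
  have lam: "lam 1 = l1" "lam 2 = l2" "lam 3 = l3" "lam 4 = l4" by (simp_all add: lam_def)
  have F0: "(\<lambda>z. F0 z $ 1) = f1" "(\<lambda>z. F0 z $ 2) = f2" "(\<lambda>z. F0 z $ 3) = f3" "(\<lambda>z. F0 z $ 4) = f4"
    by (simp_all add: F0_def)
  have ups0: "ups g \<noteq> 0" if "g \<in> SL2Z" for g
    using ups_mult that unfolding multiplier_system_def by force
  interpret mlde_system F0 lam k0 ups rho0 M4 M6 M8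
  proof
    show "k0 = 3 * (\<Sum>j\<in>UNIV. lam j) - 3" by (simp add: k0_def sum_4 lam)
    show "0 \<le> lam j" "lam j < 1" for j
      using exhaust_4[of j] by (auto simp: lam l1_def l2_def l3_def l4_def frac_lt_1)
    have "l1 \<noteq> l2" "l1 \<noteq> l3" "l1 \<noteq> l4" "l2 \<noteq> l3" "l2 \<noteq> l4" "l3 \<noteq> l4"
      unfolding l1_def l2_def l3_def l4_def using r_order by (simp_all add: frac_add_neq)
    then show "inj lam"
      unfolding inj_def by (auto simp: forall_4 lam)
    show "(\<lambda>z. F0 z $ j) \<in> mlde4_solutions k0 M4 M6 M8" for j
      using exhaust_4[of j] f_sol F0 by auto
    show "\<exists>\<phi>. qser (lam j) \<phi> (\<lambda>z. F0 z $ j) \<and> \<phi> 0 = 1" for j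
      using exhaust_4[of j] F0 lam f_exp[THEN qser_of_sums] a_lead by auto
    show "F0 (moeb g z) = (ups g * autf k0 g z) *s (rho0 g *v F0 z)" if "g \<in> SL2Z" "z \<in> uhp" for g z
      using rho0_def that ups0 slash_eq_iff[of g z ups k0 F0 "rho0 g *v F0 z"] by blast
  qed (use M_wt ups0 in auto)
  have F0_Hk: "F0 \<in> Hk k0 rho0 ups" using Dpow_Hk[of 0] by simp
  have even: "0 \<le> n \<and> even n" if ne: "Hk (k0 + real_of_int n) rho0 ups \<noteq> {0}" for n
  proof (rule ccontr)
    assume n: "\<not> (0 \<le> n \<and> even n)"
    have "G = 0" if "G \<in> V n" for G
      using Hk_trivial[OF that] n by (auto simp: fun_eq_iff)
    moreover have "0 \<in> V n" using Hk_zero[of n] by (simp add: zero_fun_def)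
    ultimately show False using ne by blast
  qed
  have free: "M j = 0" if M: "\<forall>j<4. M j \<in> Mring" and 0: "(\<lambda>z. \<Sum>j<4. M j z *s Dpow j k0 F0 z) = 0" and j: "j < 4" for M j
  proof
    fix z
    show "M j z = 0 z"
    proof (cases "z \<in> uhp")
      case True
      then show ?thesis using Dpow_independent[OF True _ j, of "\<lambda>j. M j z"] fun_cong[OF 0, of z] by simp
    qed (use Mring_off M j in simp)
  qed
  have "nat \<lfloor>2 * real v / 3\<rfloor> = 2 * v div 3" for v
    using floor_divide_of_nat_eq[where 'a = real, of "2 * v" 3] by simp
  then have dim: "cdim (Hk (k0 + 2 * real v) rho0 ups) = nat \<lfloor>2 * real v / 3\<rfloor> + 1" for v
    by (simp add: cdim_Hk)
  show ?thesis
  proof (intro conjI)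
    show "\<forall>n::int. Hk (k0 + real_of_int n) rho0 ups \<noteq> {0} \<longrightarrow> 0 \<le> n \<and> even n"
      using even by blast
    show "Hsum k0 rho0 ups = {F. \<exists>(S::nat set) G. finite S \<and> (\<forall>n\<in>S. G n \<in> Hk (k0 + 2 * real n) rho0 ups)
        \<and> F = (\<lambda>z. \<Sum>n\<in>S. G n z)}"
      using Hsum_eq_nonnegative_even unfolding gsum_def .
    show "\<exists>N4 N6 N8. N4 \<in> Mk 4 \<and> N6 \<in> Mk 6 \<and> N8 \<in> Mk 8 \<and>
        fundamental_system4 k0 N4 N6 N8 (\<lambda>j z. F0 z $ j)"
      using M_wt fundamental_system by blast
    show "\<forall>j<4. Dpow j k0 F0 \<in> Hsum k0 rho0 ups"
      using Hk_imp_Hsum[OF Dpow_Hk] by simp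
    show "\<forall>F\<in>Hsum k0 rho0 ups. \<exists>M. (\<forall>j<4. M j \<in> Mring) \<and> F = (\<lambda>z. \<Sum>j<4. M j z *s Dpow j k0 F0 z)"
      using Hsum_decomposition by (rule ballI)
    show "\<forall>M. (\<forall>j<4. M j \<in> Mring) \<and> (\<lambda>z. \<Sum>j<4. M j z *s Dpow j k0 F0 z) = 0 \<longrightarrow> (\<forall>j<4. M j = 0)"
      by (intro allI impI, elim conjE) (rule free)
    show "Hsum k0 rho0 ups = {F. \<exists>n M. (\<forall>j<n. M j \<in> Mring) \<and> F = (\<lambda>z. \<Sum>j<n. M j z *s Dpow j k0 F0 z)}"
      by (rule Hsum_eq_cyclic)
    show "\<forall>k::nat. cdim (Hk (k0 + 2 * real k) rho0 ups) = nat \<lfloor>2 * real k / 3\<rfloor> + 1"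
      using dim by (rule allI)
  qed (rule F0_Hk)
qed

end
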